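(* Let $\mathcal{A}\subseteq\mathbb{N}$ be a finite alphabet with $|\mathcal{A}|\ge 2$, and let $\delta_{\mathcal{A}}$ denote the Hausdorff dimension of the set $\mathcal{E}_{\mathcal{A}}$ of infinite continued fractions $[d_1,d_2,\ldots]$ all of whose partial quotients $d_j$ belong to $\mathcal{A}$. For $N\ge1$ let $$\mathcal{D}_{\mathcal{A}}(N)=\Bigl\{d\in\mathbb{N}\;\Bigl|\; d\le N,\ \exists\, b\in\mathbb{N}:\ \gcd(b,d)=1,\ \tfrac{b}{d}=[d_1,\ldots,d_k]\text{ for some }k\ge1\text{ and some } d_1,\ldots,d_k\in\mathcal{A}\Bigr\}.$$ If $\delta_{\mathcal{A}}>\frac{7}{8}$, then there is a constant $c=c(\mathcal{A})>0$ such that $\#\mathcal{D}_{\mathcal{A}}(N)\ge cN$ for all sufficiently large $N$ (i.e. $\#\mathcal{D}_{\mathcal{A}}(N)\gg N$).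
   Context: Finite continued fractions are written $[d_1,d_2,\ldots,d_k]=\cfrac{1}{d_1+\cfrac{1}{d_2+\cdots+\cfrac{1}{d_k}}}$ with positive integer partial quotients $d_j$; infinite continued fractions $[d_1,d_2,\ldots]$ are defined analogously as limits. The notation $f\gg g$ means $f\ge Cg$ for a positive constant $C$ depending only on the alphabet $\mathcal{A}$. *)

theory Defs
  imports "HOL-Analysis.Analysis"
begin

text \<open>
  The \<open>s\<close>-th power of the diameter, with the usual conventions for \<open>s = 0\<close>: nonempty sets
  count 1 (whereas \<open>0 powr 0 = 0\<close>) and the empty set counts 0.
\<close>

definition diam_power :: "real \<Rightarrow> 'a::metric_space set \<Rightarrow> ennreal" where
  "diam_power s U =
     (if U = {} then 0 else if s = 0 then 1 else ennreal (diameter U powr s))"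

text \<open>
  Boundedness is required explicitly because \<^const>\<open>diameter\<close> is real-valued and carries no
  information on unbounded sets.
\<close>

definition fine_covers :: "real \<Rightarrow> 'a::metric_space set \<Rightarrow> (nat \<Rightarrow> 'a set) set" where
  "fine_covers \<epsilon> E =
     {U. E \<subseteq> (\<Union>i. U i) \<and> (\<forall>i. bounded (U i) \<and> diameter (U i) \<le> \<epsilon>)}"

definition hausdorff_measure :: "real \<Rightarrow> 'a::metric_space set \<Rightarrow> ennreal" where
  "hausdorff_measure s E =
     (SUP \<epsilon>\<in>{0<..}. INF U\<in>fine_covers \<epsilon> E. \<Sum>i. diam_power s (U i))"

definition hausdorff_dim :: "'a::metric_space set \<Rightarrow> ereal" where
  "hausdorff_dim E = (INF s\<in>{s. 0 \<le> s \<and> hausdorff_measure s E = 0}. ereal s)"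

text \<open>The value 0 at the empty list only serves to end the recursion: \<open>[d] = 1 / d\<close>.\<close>

fun cfrac :: "nat list \<Rightarrow> real" where
  "cfrac [] = 0"
| "cfrac (d # ds) = 1 / (real d + cfrac ds)"

definition cfrac_set :: "nat set \<Rightarrow> real set" where
  "cfrac_set A =
     {x. \<exists>d :: nat \<Rightarrow> nat. (\<forall>j. d j \<in> A) \<and> (\<lambda>k. cfrac (map d [0..<k])) \<longlonglongrightarrow> x}"

definition cfrac_denoms :: "nat set \<Rightarrow> real \<Rightarrow> nat set" where
  "cfrac_denoms A N =
     {d. 0 < d \<and> real d \<le> N \<and>
         (\<exists>b::nat. 0 < b \<and> coprime b d \<and>
            (\<exists>ds. ds \<noteq> [] \<and> set ds \<subseteq> A \<and> real b / real d = cfrac ds))}"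

end

theory Submission
  imports Defs "HOL-Real_Asymp.Real_Asymp"
begin

text \<open>
  Let \<open>\<langle>w\<rangle>\<close> be the continuant of a word \<open>w\<close> over \<open>A\<close> and \<open>g(X)\<close> the number of words with
  \<open>\<langle>w\<rangle> \<le> X\<close>. By Cauchy--Schwarz it suffices that the number of pairs of words with equal
  continuant at most \<open>N\<close> is \<open>O(g(N)\<^sup>2 / N)\<close>, which is a mean square of the exponential sum
  \<open>S(\<theta>) = \<Sum> z^\<langle>w\<rangle>\<close>, \<open>z = exp (2 \<pi> i \<theta> - 1/N)\<close>, over the fractions \<open>\<theta> = j/N\<close>.

  The words with \<open>\<langle>w\<rangle> \<ge> M\<close> are exactly the concatenations \<open>x y\<close> of a word \<open>x\<close> of the stopping
  set at level \<open>M\<close> with an arbitrary word \<open>y\<close>, and \<open>\<langle>x y\<rangle>\<close> is the inner product of the integer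
  vectors of \<open>x\<close> and \<open>y\<close>. The damping factor \<open>exp (-\<langle>x y\<rangle>/N)\<close> is absorbed into \<open>z\<close>, so \<open>S\<close> is a
  genuine bilinear form for every choice of \<open>M\<close>. Completing the sum over \<open>x\<close> to all integer
  vectors loses a factor \<open>M^(2 - 2 s)\<close>, where \<open>s > 7/8\<close> is below the Hausdorff dimension, and
  reduces matters to counting the coincidences \<open>\<theta> y \<equiv> \<theta>' y'\<close> modulo 1 up to \<open>1/M\<close>.

  For \<open>\<theta>\<close> within about \<open>K/N\<close> of \<open>a/q\<close> with \<open>q K\<close> at most about \<open>N^(1/4)\<close>, choosing \<open>M\<close> slightly
  larger than \<open>q\<^sup>2 K\<close> makes these coincidences exact: \<open>q\<close> divides the determinant of \<open>y\<close> and
  \<open>y'\<close>, and the two directions agree up to \<open>1/K\<close>. A prefix of \<open>y'\<close> of size \<open>K^(1/2)\<close> controls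
  the direction and a suffix of size \<open>q\<close> the residue class. For all other \<open>\<theta>\<close> one takes
  \<open>M = N^(5/8)\<close> and counts the determinants \<open>D\<close> with \<open>\<theta> D\<close> close to an integer; this is where
  \<open>s > 7/8\<close> is needed.
\<close>

subsection \<open>Continuants\<close>

fun cont cont_tl :: "nat list \<Rightarrow> nat" where
  "cont [] = 1"
| "cont (d # w) = d * cont w + cont_tl w"
| "cont_tl [] = 0"
| "cont_tl (d # w) = cont w"

text \<open>The second column of the matrix product whose first column is
  \<open>(cont w, cont_tl w)\<close>; thus \<open>cont_bl w\<close> is the continuant of \<open>butlast w\<close>.\<close>

fun cont_bl cont_mid :: "nat list \<Rightarrow> nat" where
  "cont_bl [] = 0"
| "cont_bl (d # w) = d * cont_bl w + cont_mid w"
| "cont_mid [] = 1"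
| "cont_mid (d # w) = cont_bl w"

definition cont_vec :: "nat list \<Rightarrow> nat \<times> nat" where
  "cont_vec w = (cont w, cont_tl w)"

definition cross :: "nat list \<Rightarrow> nat list \<Rightarrow> int" where
  "cross v w = int (cont v) * int (cont_tl w) - int (cont_tl v) * int (cont w)"

lemma cont_append: "cont (x @ y) = cont x * cont y + cont_bl x * cont_tl y"
  and cont_tl_append: "cont_tl (x @ y) = cont_tl x * cont y + cont_mid x * cont_tl y"
  by (induction x) (auto simp: algebra_simps)

lemma cont_bl_snoc: "cont_bl (w @ [d]) = cont w"
  and cont_mid_snoc: "cont_mid (w @ [d]) = cont_tl w"
  by (induction w) auto

lemma cont_snoc: "cont (w @ [d]) = d * cont w + cont_bl w"
  by (simp add: cont_append)

lemma cont_rev: "cont (rev w) = cont w"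
  and cont_tl_rev: "cont_tl (rev w) = cont_bl w"
  and cont_bl_rev: "cont_bl (rev w) = cont_tl w"
  and cont_mid_rev: "cont_mid (rev w) = cont_mid w"
  by (induction w) (auto simp: cont_append cont_tl_append cont_bl_snoc cont_mid_snoc algebra_simps)

lemma cont_det:
  "int (cont w) * int (cont_mid w) - int (cont_bl w) * int (cont_tl w) = (-1) ^ length w"
proof (induction w)
  case (Cons d w)
  have "int (cont (d # w)) * int (cont_mid (d # w)) - int (cont_bl (d # w)) * int (cont_tl (d # w))
      = - (int (cont w) * int (cont_mid w) - int (cont_bl w) * int (cont_tl w))"
    by (simp add: algebra_simps)
  then show ?case using Cons by simp
qed simp

lemma coprime_cont: "coprime (cont w) (cont_tl w)"
proof -
  have "coprime (int (cont w)) (int (cont_tl w))"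
  proof (rule coprimeI)
    fix c assume "c dvd int (cont w)" "c dvd int (cont_tl w)"
    then have "c dvd (-1) ^ length w"
      unfolding cont_det[of w, symmetric] by (intro dvd_diff dvd_mult dvd_mult2)
    then show "is_unit c"
      by (metis dvd_trans is_unit_power_iff dvd_minus_iff minus_dvd_iff one_dvd dvd_refl)
  qed
  then show ?thesis by simp
qed

lemma cont_pos: "0 \<notin> set w \<Longrightarrow> 0 < cont w"
  by (induction w) auto

lemma cont_tl_le: "0 \<notin> set w \<Longrightarrow> cont_tl w \<le> cont w"
proof (cases w)
  case (Cons d x)
  assume "0 \<notin> set w"
  then have "1 * cont x \<le> d * cont x" using Cons by (intro mult_right_mono) auto
  then have "cont x \<le> d * cont x + cont_tl x" by linarith
  then show ?thesis using Cons by simp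
qed simp

lemma cont_bl_le: "0 \<notin> set w \<Longrightarrow> cont_bl w \<le> cont w"
  using cont_tl_le[of "rev w"] by (simp add: cont_rev cont_tl_rev)

lemma cont_tl_eq_0_iff: "0 \<notin> set w \<Longrightarrow> cont_tl w = 0 \<longleftrightarrow> w = []"
  using cont_pos by (cases w) auto

lemma length_le_cont: "0 \<notin> set w \<Longrightarrow> length w \<le> cont w"
proof (induction w)
  case (Cons d w)
  show ?case
  proof (cases "w = []")
    case False
    then have "0 < cont_tl w" using cont_tl_eq_0_iff[of w] Cons.prems by auto
    moreover have "1 * cont w \<le> d * cont w" using Cons.prems by (intro mult_right_mono) auto
    moreover have "length w \<le> cont w" using Cons by simp
    ultimately have "Suc (length w) \<le> d * cont w + cont_tl w" by linarith
    then show ?thesis by simp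
  qed (use Cons.prems in auto)
qed simp

lemma cont_mult_le_cont_append: "real (cont x) * real (cont y) \<le> real (cont (x @ y))"
proof -
  have "cont x * cont y \<le> cont (x @ y)" by (simp add: cont_append)
  then show ?thesis by (metis of_nat_le_iff of_nat_mult)
qed

lemma cont_append_le:
  assumes "0 \<notin> set x" "0 \<notin> set y"
  shows "real (cont (x @ y)) \<le> 2 * (real (cont x) * real (cont y))"
proof -
  have "cont_bl x * cont_tl y \<le> cont x * cont y"
    using assms by (intro mult_mono cont_bl_le cont_tl_le) auto
  then have "cont (x @ y) \<le> 2 * (cont x * cont y)" by (simp add: cont_append)
  then show ?thesis by (metis of_nat_le_iff of_nat_mult of_nat_numeral)
qed

lemma cont_prefix_le:
  assumes "0 \<notin> set y"
  shows "cont x \<le> cont (x @ y)"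
  using cont_pos[OF assms] by (auto simp: cont_append intro: trans_le_add1)

lemma cont_suffix_le:
  assumes "0 \<notin> set x"
  shows "cont y \<le> cont (x @ y)"
  using cont_pos[OF assms] by (auto simp: cont_append intro: trans_le_add1)

subsection \<open>Convergents\<close>

lemma cfrac_eq_cont: "0 \<notin> set w \<Longrightarrow> cfrac w = real (cont_tl w) / real (cont w)"
proof (induction w)
  case (Cons d w)
  then have "0 < cont w" "cfrac w = real (cont_tl w) / real (cont w)"
    using cont_pos[of w] by auto
  moreover have "real d + real (cont_tl w) / real (cont w) = real (cont (d # w)) / real (cont w)"
    using \<open>0 < cont w\<close> by (simp add: field_simps)
  ultimately show ?case by simp
qed simp

lemma cfrac_nonneg: "0 \<notin> set w \<Longrightarrow> 0 \<le> cfrac w"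
  by (simp add: cfrac_eq_cont)

lemma cfrac_le_1: "0 \<notin> set w \<Longrightarrow> cfrac w \<le> 1"
  using cont_pos[of w] cont_tl_le[of w] by (simp add: cfrac_eq_cont)

lemma cross_eq_cfrac_diff:
  assumes "0 \<notin> set v" "0 \<notin> set w"
  shows "real_of_int (cross v w) = (cfrac w - cfrac v) * (real (cont v) * real (cont w))"
  using assms cont_pos[of v] cont_pos[of w] by (simp add: cross_def cfrac_eq_cont field_simps)

lemma cross_append: "cross x (x @ y) = (-1) ^ length x * int (cont_tl y)"
  unfolding cont_det[symmetric] by (simp add: cross_def cont_append cont_tl_append algebra_simps)

lemma abs_cfrac_append_diff_le:
  assumes "0 \<notin> set x" "0 \<notin> set y"
  shows "\<bar>cfrac (x @ y) - cfrac x\<bar> \<le> 1 / (real (cont x))\<^sup>2"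
proof -
  have xy: "0 \<notin> set (x @ y)" using assms by simp
  note pos = cont_pos[OF assms(1)] cont_pos[OF xy]
  have "\<bar>cfrac (x @ y) - cfrac x\<bar> * (real (cont x) * real (cont (x @ y)))
      = \<bar>real_of_int (cross x (x @ y))\<bar>"
    using pos by (simp add: cross_eq_cfrac_diff[OF assms(1) xy] abs_mult)
  also have "\<dots> = real (cont_tl y)" by (simp add: cross_append abs_mult power_abs)
  finally have "\<bar>cfrac (x @ y) - cfrac x\<bar> * (real (cont x) * real (cont (x @ y)))
      = real (cont_tl y)" .
  moreover have "real (cont_tl y) * real (cont x) \<le> real (cont (x @ y))"
    using cont_mult_le_cont_append[of x y] cont_tl_le[OF assms(2)]
      mult_right_mono[of "real (cont_tl y)" "real (cont y)" "real (cont x)"]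
    by (simp add: mult.commute)
  ultimately have "(\<bar>cfrac (x @ y) - cfrac x\<bar> * (real (cont x))\<^sup>2) * real (cont (x @ y))
      \<le> 1 * real (cont (x @ y))"
    by (simp add: power2_eq_square ac_simps)
  then have "\<bar>cfrac (x @ y) - cfrac x\<bar> * (real (cont x))\<^sup>2 \<le> 1"
    using pos by (simp only: mult_le_cancel_right_pos of_nat_0_less_iff)
  then show ?thesis using pos by (simp add: pos_le_divide_eq)
qed

lemma cross_eq_0_iff:
  assumes "0 \<notin> set v" "0 \<notin> set w"
  shows "cross v w = 0 \<longleftrightarrow> cont_vec v = cont_vec w"
proof
  assume "cross v w = 0"
  then have "int (cont v * cont_tl w) = int (cont_tl v * cont w)" by (simp add: cross_def)
  then have proportional: "cont v * cont_tl w = cont_tl v * cont w" by (simp only: of_nat_eq_iff)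
  have "cont v dvd cont_tl v * cont w" unfolding proportional[symmetric] by simp
  then have "cont v dvd cont w" using coprime_cont[of v] by (simp add: coprime_dvd_mult_right_iff)
  moreover have "cont w dvd cont v * cont_tl w" unfolding proportional by simp
  then have "cont w dvd cont v" using coprime_cont[of w] by (simp add: coprime_dvd_mult_left_iff)
  ultimately have "cont v = cont w" by (rule dvd_antisym)
  then show "cont_vec v = cont_vec w"
    using proportional cont_pos[OF assms(1)] by (simp add: cont_vec_def)
qed (simp add: cross_def cont_vec_def)

lemma cfrac_eq_iff:
  assumes "0 \<notin> set v" "0 \<notin> set w"
  shows "cfrac v = cfrac w \<longleftrightarrow> cont_vec v = cont_vec w"
proof -
  have "cross v w = 0 \<longleftrightarrow> real_of_int (cross v w) = 0" by simp
  also have "\<dots> \<longleftrightarrow> cfrac v = cfrac w"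
    using cont_pos[OF assms(1)] cont_pos[OF assms(2)] by (auto simp: cross_eq_cfrac_diff[OF assms])
  finally show ?thesis using cross_eq_0_iff[OF assms] by simp
qed

lemma cfrac_separated:
  assumes "0 \<notin> set v" "0 \<notin> set w" "cfrac v \<noteq> cfrac w"
  shows "1 / (real (cont v) * real (cont w)) \<le> \<bar>cfrac v - cfrac w\<bar>"
proof -
  note pos = cont_pos[OF assms(1)] cont_pos[OF assms(2)]
  have "cross v w \<noteq> 0" using assms by (simp add: cross_eq_0_iff cfrac_eq_iff)
  then have "1 \<le> \<bar>real_of_int (cross v w)\<bar>" by linarith
  also have "\<dots> = \<bar>cfrac v - cfrac w\<bar> * (real (cont v) * real (cont w))"
    by (simp add: cross_eq_cfrac_diff[OF assms(1,2)] abs_mult abs_minus_commute)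
  finally show ?thesis using pos by (simp add: pos_divide_le_eq)
qed

text \<open>The only ambiguity of finite continued fractions is \<open>[\<dots>, d + 1] = [\<dots>, d, 1]\<close>, which changes
  the parity of the length.\<close>

lemma leading_digit_le:
  assumes "0 \<notin> set x" "0 \<notin> set y" "cont x = cont y" "even (length x) = even (length y)"
    and same_cont: "d * cont x + cont_tl x = e * cont y + cont_tl y"
  shows "e \<le> d"
proof (rule ccontr)
  assume "\<not> e \<le> d"
  then have "Suc d * cont x \<le> e * cont x" by (intro mult_right_mono) auto
  moreover have "cont_tl x \<le> cont x" by (rule cont_tl_le[OF assms(1)])
  ultimately have tls: "cont_tl x = cont x" "cont_tl y = 0"
    using assms(3) same_cont by auto
  then have "y = []" using cont_tl_eq_0_iff assms(2) by simp
  then have "cont x = 1" using assms(3) by simp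
  then obtain f u where x: "x = f # u" using tls by (cases x) auto
  then have "cont u = 1" "f * cont u + cont_tl u = 1" "f \<noteq> 0"
    using tls \<open>cont x = 1\<close> assms(1) by auto
  then have "cont_tl u = 0" by (cases f) auto
  then have "u = []" using cont_tl_eq_0_iff[of u] x assms(1) by auto
  then show False using x \<open>y = []\<close> assms(4) by simp
qed

lemma cont_vec_inj:
  assumes "0 \<notin> set x" "0 \<notin> set y" "cont_vec x = cont_vec y" "even (length x) = even (length y)"
  shows "x = y"
  using assms
proof (induction x arbitrary: y)
  case Nil
  then show ?case using cont_tl_eq_0_iff[of y] by (simp add: cont_vec_def)
next
  case (Cons d x)
  then have "cont_tl y \<noteq> 0" using cont_pos[of x] by (auto simp: cont_vec_def)
  then obtain e z where y: "y = e # z" by (cases y) simp_all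
  have nz: "0 \<notin> set x" "0 \<notin> set z" using Cons.prems y by auto
  have same_tl: "cont x = cont z" and same_cont: "d * cont x + cont_tl x = e * cont z + cont_tl z"
    and parity: "even (length x) = even (length z)"
    using Cons.prems y by (auto simp: cont_vec_def)
  have "d = e"
    using leading_digit_le[OF nz same_tl parity same_cont]
      leading_digit_le[OF nz(2,1) same_tl[symmetric] parity[symmetric] same_cont[symmetric]] by simp
  moreover have "x = z"
    by (rule Cons.IH[OF nz _ parity]) (use same_tl same_cont \<open>d = e\<close> in \<open>simp add: cont_vec_def\<close>)
  ultimately show ?case using y by simp
qed

lemma card_le_twice_card_image:
  assumes "finite S" "\<And>w. w \<in> S \<Longrightarrow> 0 \<notin> set w"
    and determined: "\<And>v w. v \<in> S \<Longrightarrow> w \<in> S \<Longrightarrow> f v = f w \<Longrightarrow> cont_vec v = cont_vec w"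
  shows "card S \<le> 2 * card (f ` S)"
proof -
  let ?f = "\<lambda>w. (f w, even (length w))"
  have "inj_on ?f S"
  proof (rule inj_onI)
    fix v w assume "v \<in> S" "w \<in> S" "?f v = ?f w"
    then show "v = w" by (intro cont_vec_inj determined assms(2)) simp_all
  qed
  then have "card S = card (?f ` S)" by (simp add: card_image)
  also have "\<dots> \<le> card (f ` S \<times> (UNIV :: bool set))"
    using assms(1) by (intro card_mono) auto
  also have "\<dots> = 2 * card (f ` S)"
    by (simp add: card_cartesian_product)
  finally show ?thesis .
qed

subsection \<open>Words over a finite alphabet\<close>

locale alphabet =
  fixes A :: "nat set"
  assumes finite_A: "finite A" and zero_notin_A: "0 \<notin> A" and A_nonempty: "A \<noteq> {}"
begin

definition step_ratio :: real where "step_ratio = real (Max A) + 1"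

definition words_upto :: "real \<Rightarrow> nat list set" where
  "words_upto X = {w \<in> lists A. real (cont w) \<le> X}"

definition word_count :: "real \<Rightarrow> real" where
  "word_count X = real (card (words_upto X))"

definition dyadic_words :: "real \<Rightarrow> nat list set" where
  "dyadic_words X = {w \<in> lists A. X \<le> real (cont w) \<and> real (cont w) \<le> 2 * X}"

definition stop_words :: "real \<Rightarrow> nat list set" where
  "stop_words M = {w \<in> lists A. M \<le> real (cont w) \<and> (w = [] \<or> real (cont (butlast w)) < M)}"

lemma zero_notin_word: "w \<in> lists A \<Longrightarrow> 0 \<notin> set w"
  using zero_notin_A by auto

lemma cont_ge_1: "w \<in> lists A \<Longrightarrow> 1 \<le> cont w"
  using cont_pos[OF zero_notin_word] by (simp add: Suc_le_eq)

lemma digit_less_step_ratio: "d \<in> A \<Longrightarrow> real d + 1 \<le> step_ratio"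
  using finite_A by (simp add: step_ratio_def)

lemma step_ratio_ge_2: "2 \<le> step_ratio"
proof -
  obtain d where "d \<in> A" using A_nonempty by blast
  then have "1 \<le> d" using zero_notin_A by (cases d) auto
  then show ?thesis using digit_less_step_ratio[OF \<open>d \<in> A\<close>] by linarith
qed

lemma finite_words_upto: "finite (words_upto X)"
proof (rule finite_subset)
  show "words_upto X \<subseteq> {w. set w \<subseteq> A \<and> length w \<le> nat \<lfloor>X\<rfloor>}"
  proof
    fix w assume w: "w \<in> words_upto X"
    then have "real (length w) \<le> X"
      using length_le_cont[OF zero_notin_word, of w] by (auto simp: words_upto_def)
    then show "w \<in> {w. set w \<subseteq> A \<and> length w \<le> nat \<lfloor>X\<rfloor>}"
      using w by (auto simp: words_upto_def le_nat_floor)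
  qed
qed (simp add: finite_A finite_lists_length_le)

lemma word_count_nonneg: "0 \<le> word_count X"
  by (simp add: word_count_def)

lemma card_le_word_count: "S \<subseteq> words_upto X \<Longrightarrow> real (card S) \<le> word_count X"
  unfolding word_count_def by (intro of_nat_mono card_mono finite_words_upto)

lemma word_count_mono: "X \<le> Y \<Longrightarrow> word_count X \<le> word_count Y"
  unfolding word_count_def[of X] by (intro card_le_word_count) (auto simp: words_upto_def)

lemma word_count_ge_1: "1 \<le> X \<Longrightarrow> 1 \<le> word_count X"
  using card_le_word_count[of "{[]}" X] by (simp add: words_upto_def)

lemma word_count_eq_0: "X < 1 \<Longrightarrow> word_count X = 0"
proof -
  assume "X < 1"
  then have "words_upto X = {}" using cont_ge_1 by (force simp: words_upto_def)
  then show ?thesis by (simp add: word_count_def)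
qed

lemma dyadic_words_subset: "dyadic_words X \<subseteq> words_upto (2 * X)"
  by (auto simp: dyadic_words_def words_upto_def)

lemma finite_dyadic_words: "finite (dyadic_words X)"
  using dyadic_words_subset finite_words_upto by (rule finite_subset)

lemma dyadic_wordsD:
  assumes "w \<in> dyadic_words X"
  shows "w \<in> lists A" "0 \<notin> set w" "X \<le> real (cont w)" "real (cont w) \<le> 2 * X" "0 < cont w"
  using assms zero_notin_word cont_pos unfolding dyadic_words_def by blast+

lemma cont_snoc_le:
  assumes "w \<in> lists A" "d \<in> A"
  shows "real (cont (w @ [d])) \<le> step_ratio * real (cont w)"
proof -
  have "real (cont (w @ [d])) = real d * real (cont w) + real (cont_bl w)" by (simp add: cont_snoc)
  also have "\<dots> \<le> (real d + 1) * real (cont w)"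
    using cont_bl_le[OF zero_notin_word[OF assms(1)]] by (simp add: algebra_simps)
  also have "\<dots> \<le> step_ratio * real (cont w)"
    using digit_less_step_ratio[OF assms(2)] by (intro mult_right_mono) auto
  finally show ?thesis .
qed

lemma cont_le_cont_bl:
  assumes "w \<in> lists A" "w \<noteq> []"
  shows "real (cont w) \<le> step_ratio * real (cont_bl w)"
proof -
  obtain x d where "w = x @ [d]" using assms(2) by (metis rev_exhaust)
  then show ?thesis using cont_snoc_le[of x d] assms by (simp add: cont_bl_snoc)
qed

subsection \<open>The stopping set\<close>

lemma stop_words_lists: "w \<in> stop_words M \<Longrightarrow> w \<in> lists A"
  by (simp add: stop_words_def)

lemma stop_words_ge: "w \<in> stop_words M \<Longrightarrow> M \<le> real (cont w)"
  by (simp add: stop_words_def)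

lemma stop_words_le:
  assumes "w \<in> stop_words M" "1 \<le> M"
  shows "real (cont w) \<le> step_ratio * M"
proof (cases "w = []")
  case True
  then show ?thesis using assms step_ratio_ge_2 mult_mono[of 1 step_ratio 1 M] by simp
next
  case False
  then obtain x d where w: "w = x @ [d]" by (metis rev_exhaust)
  then have "real (cont w) \<le> step_ratio * real (cont x)"
    using assms cont_snoc_le by (auto simp: stop_words_def)
  also have "\<dots> \<le> step_ratio * M"
    using assms w step_ratio_ge_2 by (intro mult_left_mono) (auto simp: stop_words_def)
  finally show ?thesis .
qed

lemma finite_stop_words: "1 \<le> M \<Longrightarrow> finite (stop_words M)"
  by (rule finite_subset[OF _ finite_words_upto[of "step_ratio * M"]])
    (use stop_words_le in \<open>auto simp: words_upto_def stop_words_def\<close>)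

lemma stop_prefixE:
  assumes "w \<in> lists A" "M \<le> real (cont w)"
  obtains x y where "w = x @ y" "x \<in> stop_words M" "y \<in> lists A"
proof -
  have "\<exists>x y. w = x @ y \<and> x \<in> stop_words M \<and> y \<in> lists A"
    using assms
  proof (induction w rule: rev_induct)
    case Nil
    then show ?case by (auto simp: stop_words_def)
  next
    case (snoc d w)
    show ?case
    proof (cases "M \<le> real (cont w)")
      case True
      then obtain x y where "w = x @ y" "x \<in> stop_words M" "y \<in> lists A" using snoc by auto
      then show ?thesis using snoc.prems by (intro exI[of _ x] exI[of _ "y @ [d]"]) auto
    next
      case False
      then show ?thesis using snoc.prems
        by (intro exI[of _ "w @ [d]"] exI[of _ "[]"]) (auto simp: stop_words_def)
    qed
  qed
  then show thesis using that by blast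
qed

lemma stop_words_prefix_free:
  assumes "x \<in> stop_words M" "x @ z \<in> stop_words M"
  shows "z = []"
proof (rule ccontr)
  assume "z \<noteq> []"
  then have butlast: "butlast (x @ z) = x @ butlast z" by (simp add: butlast_append)
  have "0 \<notin> set (butlast z)"
    using zero_notin_word[OF stop_words_lists[OF assms(2)]] by (auto dest: in_set_butlastD)
  then have "cont x \<le> cont (x @ butlast z)" by (rule cont_prefix_le)
  then show False using assms \<open>z \<noteq> []\<close> butlast by (auto simp: stop_words_def)
qed

lemma stop_prefix_unique:
  assumes "x \<in> stop_words M" "x' \<in> stop_words M" "x @ y = x' @ y'"
  shows "x = x' \<and> y = y'"
proof -
  from assms(3) consider z where "x = x' @ z" "z @ y = y'" | z where "x @ z = x'" "y = z @ y'"
    by (auto simp: append_eq_append_conv2)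
  then show ?thesis
    using stop_words_prefix_free[of x' M] stop_words_prefix_free[of x M] assms(1,2) by cases auto
qed

lemma stop_suffixE:
  assumes "w \<in> lists A" "M \<le> real (cont w)" "1 \<le> M"
  obtains y z where "w = y @ z" "y \<in> lists A" "z \<in> lists A" "M \<le> real (cont z)"
    "real (cont z) \<le> step_ratio * M"
proof -
  have "rev w \<in> lists A" using assms by auto
  then obtain x y where xy: "rev w = x @ y" "x \<in> stop_words M" "y \<in> lists A"
    using assms stop_prefixE[of "rev w" M] by (auto simp: cont_rev)
  show thesis
  proof (rule that)
    show "w = rev y @ rev x" using xy(1) by (metis rev_append rev_rev_ident)
    show "real (cont (rev x)) \<le> step_ratio * M"
      using stop_words_le[OF xy(2) assms(3)] by (simp add: cont_rev)
  qed (use xy in \<open>auto simp: cont_rev stop_words_def\<close>)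
qed

lemma stop_words_nonempty: "stop_words M \<noteq> {}"
proof -
  obtain d where "d \<in> A" using A_nonempty by blast
  let ?w = "replicate (nat \<lceil>M\<rceil>) d"
  have w: "?w \<in> lists A" using \<open>d \<in> A\<close> by auto
  have "M \<le> real (length ?w)" by simp linarith
  also have "\<dots> \<le> real (cont ?w)" using length_le_cont[OF zero_notin_word[OF w]] by simp
  finally obtain x y where "?w = x @ y" "x \<in> stop_words M" "y \<in> lists A"
    by (rule stop_prefixE[OF w])
  then show ?thesis by blast
qed

end

subsection \<open>Growth of the number of words\<close>

lemma doubling_imp_power_growth:
  fixes g :: "real \<Rightarrow> real"
  assumes mono: "\<And>x y. x \<le> y \<Longrightarrow> g x \<le> g y"
    and doubling: "\<And>x. 1 \<le> x \<Longrightarrow> g (2 * x) \<le> D * g x"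
    and "1 \<le> D" "0 \<le> g x" "1 \<le> x" "1 \<le> y"
  shows "g (y * x) \<le> D * y powr log 2 D * g x"
proof -
  have iterated: "g (2 ^ n * x) \<le> D ^ n * g x" for n
  proof (induction n)
    case (Suc n)
    have "1 * 1 \<le> 2 ^ n * x" using \<open>1 \<le> x\<close> by (intro mult_mono) auto
    then have "g (2 * (2 ^ n * x)) \<le> D * g (2 ^ n * x)" by (intro doubling) auto
    also have "\<dots> \<le> D * (D ^ n * g x)" using Suc \<open>1 \<le> D\<close> by (intro mult_left_mono) auto
    finally show ?case by (simp add: mult.assoc)
  qed simp
  define n where "n = nat \<lceil>log 2 y\<rceil>"
  have "0 \<le> log 2 y" using \<open>1 \<le> y\<close> by simp
  then have n: "log 2 y \<le> n" "real n \<le> log 2 y + 1" unfolding n_def by linarith+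
  have "y = 2 powr (log 2 y)" using \<open>1 \<le> y\<close> by simp
  also have "\<dots> \<le> 2 powr n" using n by simp
  finally have "y \<le> 2 ^ n" by (simp add: powr_realpow)
  then have "g (y * x) \<le> g (2 ^ n * x)" using \<open>1 \<le> x\<close> by (intro mono mult_right_mono) auto
  also have "\<dots> \<le> D ^ n * g x" by (rule iterated)
  also have "D ^ n \<le> D * y powr log 2 D"
  proof -
    have "D ^ n = D powr n" using \<open>1 \<le> D\<close> by (simp add: powr_realpow)
    also have "\<dots> \<le> D powr (log 2 y + 1)" using n \<open>1 \<le> D\<close> by (intro powr_mono) auto
    also have "\<dots> = D * D powr (log 2 y)" using \<open>1 \<le> D\<close> by (simp add: powr_add)
    also have "D powr (log 2 y) = y powr log 2 D"
      using \<open>1 \<le> D\<close> \<open>1 \<le> y\<close> by (simp add: powr_def log_def)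
    finally show ?thesis .
  qed
  finally show ?thesis using \<open>0 \<le> g x\<close> by (simp add: mult_right_mono)
qed

lemma sum_exp_minus_le:
  fixes f :: "'a \<Rightarrow> real" and a :: "nat \<Rightarrow> real"
  assumes "finite S" and nonneg: "\<And>w. w \<in> S \<Longrightarrow> 0 \<le> f w"
    and count: "\<And>j. real (card {w \<in> S. f w < real j + 1}) \<le> a j"
    and summable: "summable (\<lambda>j. a j * exp (- real j))"
  shows "(\<Sum>w\<in>S. exp (- f w)) \<le> (\<Sum>j. a j * exp (- real j))"
proof -
  define i where "i w = nat \<lfloor>f w\<rfloor>" for w
  have i: "real (i w) \<le> f w" "f w < real (i w) + 1" if "w \<in> S" for w
    unfolding i_def using nonneg[OF that] by linarith+
  have "(\<Sum>w\<in>S. exp (- f w)) \<le> (\<Sum>w\<in>S. exp (- real (i w)))"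
    using i by (intro sum_mono) auto
  also have "\<dots> = (\<Sum>j\<in>i ` S. \<Sum>w\<in>{w\<in>S. i w = j}. exp (- real (i w)))"
    by (rule sum.image_gen[OF assms(1)])
  also have "\<dots> = (\<Sum>j\<in>i ` S. real (card {w\<in>S. i w = j}) * exp (- real j))"
    by (intro sum.cong refl) simp
  also have "\<dots> \<le> (\<Sum>j\<in>i ` S. a j * exp (- real j))"
  proof (intro sum_mono mult_right_mono)
    fix j
    have "real (card {w\<in>S. i w = j}) \<le> real (card {w \<in> S. f w < real j + 1})"
      using i assms(1) by (intro of_nat_mono card_mono) auto
    then show "real (card {w\<in>S. i w = j}) \<le> a j" using count[of j] by linarith
  qed simp
  also have "\<dots> \<le> (\<Sum>j. a j * exp (- real j))"
    using assms(1) order_trans[OF of_nat_0_le_iff count]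
    by (intro sum_le_suminf summable) auto
  finally show ?thesis .
qed

lemma two_cont_le_cont_Cons_Cons: "0 < d \<Longrightarrow> 0 < e \<Longrightarrow> 2 * cont w \<le> cont (d # e # w)"
proof -
  assume "0 < d" "0 < e"
  then have "1 * (1 * cont w) \<le> d * (e * cont w)" by (intro mult_mono) auto
  moreover have "cont (d # e # w) = d * (e * cont w) + d * cont_tl w + cont w"
    by (simp add: algebra_simps)
  ultimately show ?thesis by linarith
qed

context alphabet
begin

definition doubling :: real where "doubling = 1 + real (card A) + (real (card A))\<^sup>2"

definition growth_exp :: real where "growth_exp = log 2 doubling"

definition stop_mult_const :: real where
  "stop_mult_const = doubling * (2 * step_ratio) powr growth_exp"

definition exp_sum_const :: real where
  "exp_sum_const = doubling * (\<Sum>j. (real j + 1) powr growth_exp * exp (- real j))"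

lemma doubling_ge_2: "2 \<le> doubling"
proof -
  have "1 \<le> real (card A)" using finite_A A_nonempty by (simp add: Suc_le_eq card_gt_0_iff)
  then have "1 \<le> real (card A) + (real (card A))\<^sup>2" by (smt (verit) zero_le_power2)
  then show ?thesis by (simp add: doubling_def)
qed

lemma growth_exp_ge_1: "1 \<le> growth_exp"
  using doubling_ge_2 by (simp add: growth_exp_def le_log_iff)

lemma stop_mult_const_pos: "0 < stop_mult_const"
  using doubling_ge_2 step_ratio_ge_2 by (simp add: stop_mult_const_def)

lemma words_upto_double_subset:
  "words_upto (2 * X) \<subseteq> {[]} \<union> (\<lambda>d. [d]) ` A \<union> (\<lambda>(d, e, w). d # e # w) ` (A \<times> A \<times> words_upto X)"
proof
  fix w assume w: "w \<in> words_upto (2 * X)"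
  consider (empty) "w = []" | (single) d where "w = [d]" | (longer) d e x where "w = d # e # x"
    by (metis neq_Nil_conv)
  then show "w \<in> {[]} \<union> (\<lambda>d. [d]) ` A \<union> (\<lambda>(d, e, w). d # e # w) ` (A \<times> A \<times> words_upto X)"
  proof cases
    case (longer d e x)
    then have digits: "d \<in> A" "e \<in> A" "x \<in> lists A" using w by (auto simp: words_upto_def)
    then have "0 < d" "0 < e" using zero_notin_A by (metis gr0I)+
    then have "2 * cont x \<le> cont w" unfolding longer by (rule two_cont_le_cont_Cons_Cons)
    then have "x \<in> words_upto X" using w digits by (auto simp: words_upto_def)
    then have "(d, e, x) \<in> A \<times> A \<times> words_upto X" using digits by simp
    then show ?thesis unfolding longer by (intro UnI2 image_eqI[of _ _ "(d, e, x)"]) simp_all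
  qed (use w in \<open>auto simp: words_upto_def\<close>)
qed

lemma word_count_double:
  assumes "1 \<le> X"
  shows "word_count (2 * X) \<le> doubling * word_count X"
proof -
  let ?ext = "(\<lambda>(d, e, w). d # e # w) ` (A \<times> A \<times> words_upto X)"
  have "card (words_upto (2 * X)) \<le> card ({[]} \<union> (\<lambda>d. [d]) ` A \<union> ?ext)"
    using words_upto_double_subset finite_A finite_words_upto by (intro card_mono) auto
  also have "\<dots> \<le> card {[] :: nat list} + card ((\<lambda>d. [d]) ` A) + card ?ext"
    by (meson add_mono card_Un_le le_trans order_refl)
  also have "\<dots> \<le> 1 + card A + card (A \<times> A \<times> words_upto X)"
    using finite_A finite_words_upto by (intro add_mono card_image_le) auto
  finally have "word_count (2 * X) \<le> real (1 + card A + card A * (card A * card (words_upto X)))"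
    unfolding word_count_def by (simp only: of_nat_le_iff card_cartesian_product)
  also have "\<dots> = (1 + real (card A)) * 1 + (real (card A))\<^sup>2 * word_count X"
    by (simp add: word_count_def power2_eq_square mult.assoc)
  also have "\<dots> \<le> (1 + real (card A)) * word_count X + (real (card A))\<^sup>2 * word_count X"
    using word_count_ge_1[OF assms] by (intro add_mono mult_left_mono) auto
  finally show ?thesis by (simp add: doubling_def algebra_simps)
qed

lemma word_count_scale:
  assumes "1 \<le> X" "1 \<le> y"
  shows "word_count (y * X) \<le> doubling * y powr growth_exp * word_count X"
  unfolding growth_exp_def using doubling_ge_2 assms
  by (intro doubling_imp_power_growth word_count_mono word_count_double word_count_nonneg) auto

lemma card_stop_words_mult_le:
  assumes "1 \<le> M"
  shows "real (card (stop_words M)) * word_count X \<le> stop_mult_const * word_count (M * X)"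
proof (cases "1 \<le> X")
  case True
  let ?app = "\<lambda>(x, y). x @ (y :: nat list)"
  have "inj_on ?app (stop_words M \<times> words_upto X)"
    by (rule inj_onI) (auto dest: stop_prefix_unique)
  then have "real (card (stop_words M)) * word_count X
      = real (card (?app ` (stop_words M \<times> words_upto X)))"
    by (simp add: card_image card_cartesian_product word_count_def)
  also have "\<dots> \<le> word_count (2 * step_ratio * (M * X))"
  proof (rule card_le_word_count, safe)
    fix x y assume x: "x \<in> stop_words M" and y: "y \<in> words_upto X"
    then have lists: "x \<in> lists A" "y \<in> lists A" by (auto simp: stop_words_def words_upto_def)
    have "real (cont (x @ y)) \<le> 2 * (real (cont x) * real (cont y))"
      by (rule cont_append_le[OF zero_notin_word zero_notin_word, OF lists])
    also have "\<dots> \<le> 2 * ((step_ratio * M) * X)"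
      using stop_words_le[OF x assms] y step_ratio_ge_2 assms
      by (intro mult_left_mono mult_mono) (auto simp: words_upto_def)
    finally show "x @ y \<in> words_upto (2 * step_ratio * (M * X))"
      using lists by (auto simp: words_upto_def algebra_simps)
  qed
  also have "\<dots> \<le> stop_mult_const * word_count (M * X)"
    unfolding stop_mult_const_def
    using assms True step_ratio_ge_2 mult_mono[of 1 M 1 X] by (intro word_count_scale) auto
  finally show ?thesis .
next
  case False
  then show ?thesis using word_count_eq_0[of X] word_count_nonneg stop_mult_const_pos by simp
qed

lemma summable_powr_exp: "summable (\<lambda>j. (real j + 1) powr growth_exp * exp (- real j))"
proof (rule summable_comparison_test_bigo)
  show "summable (\<lambda>j. norm (1 / (real j) ^ 2 :: real))"
    using inverse_power_summable[of 2, where 'a = real] by (simp add: field_simps)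
  show "(\<lambda>j. (real j + 1) powr growth_exp * exp (- real j)) \<in> O(\<lambda>j. 1 / (real j)^2)"
    by real_asymp
qed

lemma exp_sum_const_pos: "0 < exp_sum_const"
  using doubling_ge_2 suminf_pos2[OF summable_powr_exp, of 0] by (simp add: exp_sum_const_def)

lemma sum_exp_words_le:
  assumes "1 \<le> Y"
  shows "(\<Sum>w\<in>words_upto Z. exp (- real (cont w) / Y)) \<le> exp_sum_const * word_count Y"
proof -
  let ?a = "\<lambda>j. doubling * (real j + 1) powr growth_exp * word_count Y"
  have a_exp: "?a j * exp (- real j)
      = (doubling * word_count Y) * ((real j + 1) powr growth_exp * exp (- real j))" for j by simp
  have summable_a: "summable (\<lambda>j. ?a j * exp (- real j))"
    unfolding a_exp by (intro summable_mult summable_powr_exp)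
  have "(\<Sum>w\<in>words_upto Z. exp (- (real (cont w) / Y))) \<le> (\<Sum>j. ?a j * exp (- real j))"
  proof (rule sum_exp_minus_le[OF finite_words_upto])
    fix j :: nat
    have "real (card {w \<in> words_upto Z. real (cont w) / Y < real j + 1})
        \<le> word_count ((real j + 1) * Y)"
      using assms by (intro card_le_word_count) (auto simp: words_upto_def field_simps)
    also have "\<dots> \<le> ?a j" using assms by (intro word_count_scale) auto
    finally show "real (card {w \<in> words_upto Z. real (cont w) / Y < real j + 1}) \<le> ?a j" .
  qed (use assms summable_a in auto)
  also have "\<dots> = exp_sum_const * word_count Y"
    unfolding a_exp suminf_mult[OF summable_powr_exp] by (simp add: exp_sum_const_def)
  finally show ?thesis by simp
qed

end

subsection \<open>Hausdorff dimension and the number of words\<close>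

lemma INF_fine_covers_le:
  fixes E :: "'a::metric_space set"
  assumes "0 < s" "0 \<le> d" "d \<le> \<epsilon>" "finite F" "E \<subseteq> \<Union>F"
    and small: "\<And>U. U \<in> F \<Longrightarrow> bounded U \<and> diameter U \<le> d"
  shows "(INF U\<in>fine_covers \<epsilon> E. \<Sum>i. diam_power s (U i)) \<le> ennreal (real (card F) * d powr s)"
proof -
  obtain Us where Us: "set Us = F" "distinct Us" using finite_distinct_list[OF assms(4)] by blast
  define U where "U i = (if i < length Us then Us ! i else {})" for i
  have U_mem: "U i \<in> F" if "i < length Us" for i using that Us by (auto simp: U_def)
  have "E \<subseteq> (\<Union>i. U i)"
  proof
    fix x assume "x \<in> E"
    then obtain V where "V \<in> set Us" "x \<in> V" using assms(5) Us(1) by blast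
    then obtain i where "i < length Us" "x \<in> Us ! i" by (metis in_set_conv_nth)
    then show "x \<in> (\<Union>i. U i)" by (auto simp: U_def intro!: exI[of _ i])
  qed
  moreover have "bounded (U i) \<and> diameter (U i) \<le> \<epsilon>" for i
    using small[OF U_mem, of i] assms(2,3) by (cases "i < length Us") (auto simp: U_def)
  ultimately have "U \<in> fine_covers \<epsilon> E" by (simp add: fine_covers_def)
  then have "(INF U\<in>fine_covers \<epsilon> E. \<Sum>i. diam_power s (U i)) \<le> (\<Sum>i. diam_power s (U i))"
    by (rule INF_lower)
  also have "\<dots> = (\<Sum>i\<in>{..<length Us}. diam_power s (U i))"
    by (rule suminf_finite) (auto simp: U_def diam_power_def)
  also have "\<dots> \<le> (\<Sum>i\<in>{..<length Us}. ennreal (d powr s))"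
    using small[OF U_mem] assms(1)
    by (intro sum_mono) (auto simp: diam_power_def intro!: ennreal_leI powr_mono2 diameter_ge_0)
  also have "\<dots> = ennreal (real (card F) * d powr s)"
    using distinct_card[OF Us(2)] Us(1) by (simp add: ennreal_mult ennreal_of_nat_eq_real_of_nat)
  finally show ?thesis .
qed

lemma hausdorff_measure_neq_0E:
  fixes E :: "'a::metric_space set"
  assumes "0 < s" "hausdorff_measure s E \<noteq> 0"
  obtains \<epsilon> m where "0 < \<epsilon>" "0 < m"
    "\<And>F d. finite F \<Longrightarrow> E \<subseteq> \<Union>F \<Longrightarrow> (\<And>U. U \<in> F \<Longrightarrow> bounded U \<and> diameter U \<le> d) \<Longrightarrow> 0 \<le> d \<Longrightarrow>
       d \<le> \<epsilon> \<Longrightarrow> m \<le> real (card F) * d powr s"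
proof -
  let ?inf = "\<lambda>\<epsilon>. INF U\<in>fine_covers \<epsilon> E. \<Sum>i. diam_power s (U i)"
  have "\<exists>\<epsilon>>0. ?inf \<epsilon> \<noteq> 0"
  proof (rule ccontr)
    assume "\<not> (\<exists>\<epsilon>>0. ?inf \<epsilon> \<noteq> 0)"
    then have "(SUP \<epsilon>\<in>{0<..}. ?inf \<epsilon>) \<le> 0" by (intro SUP_least) auto
    then show False using assms(2) by (simp add: hausdorff_measure_def)
  qed
  then obtain \<epsilon> where \<epsilon>: "0 < \<epsilon>" "?inf \<epsilon> \<noteq> 0" by blast
  define m where "m = enn2real (min (?inf \<epsilon>) 1)"
  have ennreal_m: "ennreal m = min (?inf \<epsilon>) 1"
    unfolding m_def by (rule ennreal_enn2real) (simp add: min_less_iff_disj)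
  have "0 < m" using \<epsilon>(2) ennreal_m
    by (metis ennreal_0 ennreal_le_iff2 enn2real_nonneg m_def less_le min_def one_neq_zero)
  moreover have "m \<le> real (card F) * d powr s"
    if "finite F" "E \<subseteq> \<Union>F" "\<And>U. U \<in> F \<Longrightarrow> bounded U \<and> diameter U \<le> d" "0 \<le> d" "d \<le> \<epsilon>" for F d
  proof -
    have "?inf \<epsilon> \<le> ennreal (real (card F) * d powr s)"
      using assms(1) that by (intro INF_fine_covers_le)
    then have "ennreal m \<le> ennreal (real (card F) * d powr s)"
      using ennreal_m by (metis min.coboundedI1)
    then show ?thesis by (subst (asm) ennreal_le_iff) auto
  qed
  ultimately show thesis using that \<epsilon>(1) by blast
qed

context alphabet
begin

lemma cfrac_set_subset_cballs:
  assumes "0 < M"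
  shows "cfrac_set A \<subseteq> (\<Union>w\<in>stop_words M. cball (cfrac w) (1 / M\<^sup>2))"
proof
  fix x assume "x \<in> cfrac_set A"
  then obtain d where d: "\<forall>j. d j \<in> A" and lim: "(\<lambda>k. cfrac (map d [0..<k])) \<longlonglongrightarrow> x"
    by (auto simp: cfrac_set_def)
  define n where "n = nat \<lceil>M\<rceil>"
  have lists: "map d [i..<j] \<in> lists A" for i j using d by auto
  have "M \<le> real n" unfolding n_def by linarith
  also have "\<dots> \<le> real (cont (map d [0..<n]))"
    using length_le_cont[OF zero_notin_word[OF lists[of 0 n]]] by simp
  finally obtain w y where wy: "map d [0..<n] = w @ y" "w \<in> stop_words M" "y \<in> lists A"
    by (rule stop_prefixE[OF lists])
  define k where "k = length w"
  have "w = take k (map d [0..<n])" using wy k_def by simp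
  moreover have "k \<le> n" using arg_cong[OF wy(1), of length] k_def by simp
  ultimately have w: "w = map d [0..<k]" by (simp add: take_map)
  have "cfrac (map d [0..<j]) \<in> cball (cfrac w) (1 / M\<^sup>2)" if "j \<ge> k" for j
  proof -
    have "map d [0..<j] = w @ map d [k..<j]"
      using w that by (metis map_append upt_add_eq_append le_add_diff_inverse zero_le)
    then have "\<bar>cfrac (map d [0..<j]) - cfrac w\<bar> \<le> 1 / (real (cont w))\<^sup>2"
      using abs_cfrac_append_diff_le[OF zero_notin_word zero_notin_word,
          OF stop_words_lists[OF wy(2)] lists]
      by simp
    also have "\<dots> \<le> 1 / M\<^sup>2"
      using assms(1) stop_words_ge[OF wy(2)]
      by (intro divide_left_mono power_mono mult_pos_pos zero_less_power) auto
    finally show ?thesis by (simp add: dist_real_def abs_minus_commute)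
  qed
  then have "x \<in> cball (cfrac w) (1 / M\<^sup>2)"
    by (intro Lim_in_closed_set[OF closed_cball _ _ lim]) (auto simp: eventually_at_top_linorder)
  then show "x \<in> (\<Union>w\<in>stop_words M. cball (cfrac w) (1 / M\<^sup>2))" using wy(2) by blast
qed

lemma card_stop_words_ge:
  assumes s: "0 < s" and "hausdorff_measure s (cfrac_set A) \<noteq> 0"
  shows "\<exists>c>0. \<forall>M\<ge>1. c * M powr (2 * s) \<le> real (card (stop_words M))"
proof -
  obtain \<epsilon> m where \<epsilon>: "0 < \<epsilon>" and m: "0 < m"
    and cover: "\<And>F d. finite F \<Longrightarrow> cfrac_set A \<subseteq> \<Union>F \<Longrightarrow> (\<And>U. U \<in> F \<Longrightarrow> bounded U \<and> diameter U \<le> d) \<Longrightarrow>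
      0 \<le> d \<Longrightarrow> d \<le> \<epsilon> \<Longrightarrow> m \<le> real (card F) * d powr s"
    using hausdorff_measure_neq_0E[OF assms] by blast
  define c where "c = min (m / 2 powr s) ((\<epsilon> / 2) powr s)"
  have "0 < c" using m \<epsilon> by (simp add: c_def)
  moreover have "c * M powr (2 * s) \<le> real (card (stop_words M))" if M: "1 \<le> M" for M
  proof (cases "2 / M\<^sup>2 \<le> \<epsilon>")
    case True
    let ?F = "(\<lambda>w. cball (cfrac w) (1 / M\<^sup>2)) ` stop_words M"
    have "m \<le> real (card ?F) * (2 / M\<^sup>2) powr s"
    proof (rule cover)
      show "cfrac_set A \<subseteq> \<Union>?F" using cfrac_set_subset_cballs[of M] M by simp
    qed (use finite_stop_words[OF M] True in auto)
    also have "\<dots> \<le> real (card (stop_words M)) * (2 / M\<^sup>2) powr s"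
      using finite_stop_words[OF M] by (intro mult_right_mono of_nat_mono card_image_le) auto
    also have "(2 / M\<^sup>2) powr s = 2 powr s / M powr (2 * s)"
      using M by (simp add: powr_divide powr_powr[symmetric] powr_numeral)
    finally have "m / 2 powr s * M powr (2 * s) \<le> real (card (stop_words M))"
      using M by (simp add: field_simps)
    moreover have "c * M powr (2 * s) \<le> m / 2 powr s * M powr (2 * s)"
      unfolding c_def by (intro mult_right_mono) auto
    ultimately show ?thesis by linarith
  next
    case False
    have "c * M powr (2 * s) \<le> (\<epsilon> / 2) powr s * (M\<^sup>2) powr s"
      unfolding c_def using M
      by (simp add: powr_powr[symmetric] powr_numeral mult_right_mono)
    also have "\<dots> = (\<epsilon> / 2 * M\<^sup>2) powr s" using \<epsilon> by (simp only: powr_mult)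
    also have "\<dots> \<le> 1 powr s"
      using False \<epsilon> s M by (intro powr_mono2) (auto simp: field_simps)
    also have "\<dots> \<le> real (card (stop_words M))"
      using stop_words_nonempty finite_stop_words[OF M] by (simp add: Suc_le_eq card_gt_0_iff)
    finally show ?thesis .
  qed
  ultimately show ?thesis by blast
qed

end

subsection \<open>A weighted mean value estimate\<close>

lemma negative_binomial_sums:
  fixes z :: complex
  assumes "norm z < 1"
  shows "(\<lambda>n. of_nat ((n + k) choose k) * z ^ n) sums (1 / (1 - z) ^ Suc k)"
proof -
  have "(\<lambda>n. (- of_nat (Suc k) gchoose n) * (- z) ^ n) sums (1 + - z) powr (- of_nat (Suc k))"
    using assms by (intro gen_binomial_complex) simp
  moreover have "(- of_nat (Suc k) gchoose n) * (- z) ^ n = of_nat ((n + k) choose k) * z ^ n" for n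
  proof -
    have "((- of_nat (Suc k)) gchoose n :: complex)
        = (-1) ^ n * ((of_nat (Suc k) + of_nat n - 1) gchoose n)"
      by (rule gbinomial_minus)
    also have "(of_nat (Suc k) + of_nat n - 1 :: complex) = of_nat (n + k)" by simp
    also have "(of_nat (n + k) gchoose n :: complex) = of_nat ((n + k) choose n)"
      by (simp add: binomial_gbinomial)
    also have "(n + k) choose n = (n + k) choose k" using binomial_symmetric[of n "n + k"] by simp
    finally have "(- of_nat (Suc k) gchoose n) * (- z) ^ n
        = of_nat ((n + k) choose k) * ((-1) ^ n * (- z) ^ n)" by simp
    also have "(-1) ^ n * (- z) ^ n = z ^ n" by (simp add: power_mult_distrib[symmetric])
    finally show ?thesis .
  qed
  moreover have "(1 + - z) powr (- of_nat (Suc k)) = 1 / (1 - z) ^ Suc k"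
  proof -
    have "1 - z \<noteq> 0" using assms by auto
    then have "(1 - z) powr (of_nat (Suc k)) = (1 - z) ^ Suc k" by (intro powr_nat') simp
    then show ?thesis by (simp only: powr_minus add_uminus_conv_diff inverse_eq_divide)
  qed
  ultimately show ?thesis by simp
qed

definition negbin_weight :: "nat \<Rightarrow> real \<Rightarrow> nat \<Rightarrow> real" where
  "negbin_weight k M n = real ((n + k) choose k) * exp (- real n / M)"

definition negbin_kernel :: "nat \<Rightarrow> real \<Rightarrow> complex \<Rightarrow> complex" where
  "negbin_kernel k M z = 1 / (1 - of_real (exp (- 1 / M)) * z) ^ Suc k"

lemma negbin_weight_nonneg: "0 \<le> negbin_weight k M n"
  by (simp add: negbin_weight_def)

lemma negbin_weight_sums:
  assumes "0 < M" "norm z \<le> 1"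
  shows "(\<lambda>n. of_real (negbin_weight k M n) * z ^ n) sums negbin_kernel k M z"
proof -
  let ?r = "exp (- 1 / M)"
  have "?r < 1" using assms by simp
  then have "?r * norm z < 1" using assms(2)
    by (smt (verit) mult_left_le exp_ge_zero)
  then have "norm (of_real ?r * z) < 1" by (simp add: norm_mult)
  from negative_binomial_sums[OF this, of k] show ?thesis
    unfolding negbin_kernel_def negbin_weight_def
    by (simp add: power_mult_distrib exp_of_nat_mult[symmetric] mult.assoc flip: of_real_power)
qed

lemma weighted_mean_square_expand:
  fixes \<psi> :: "'p \<Rightarrow> real" and b :: "'i \<Rightarrow> complex" and a :: "'i \<Rightarrow> 'p \<Rightarrow> complex"
  shows "of_real (\<Sum>p\<in>U. \<psi> p * (cmod (\<Sum>i\<in>I. b i * a i p))\<^sup>2)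
    = (\<Sum>i\<in>I. \<Sum>j\<in>I. b i * cnj (b j) * (\<Sum>p\<in>U. of_real (\<psi> p) * (a i p * cnj (a j p))))"
proof -
  have "of_real (\<Sum>p\<in>U. \<psi> p * (cmod (\<Sum>i\<in>I. b i * a i p))\<^sup>2)
      = (\<Sum>p\<in>U. of_real (\<psi> p) * ((\<Sum>i\<in>I. b i * a i p) * (\<Sum>j\<in>I. cnj (b j) * cnj (a j p))))"
    by (simp add: complex_norm_square del: of_real_power flip: of_real_power)
  also have "\<dots> = (\<Sum>p\<in>U. \<Sum>i\<in>I. \<Sum>j\<in>I. b i * cnj (b j) * (of_real (\<psi> p) * (a i p * cnj (a j p))))"
    by (subst sum_product, intro sum.cong refl) (simp add: sum_distrib_left ac_simps)
  also have "\<dots> = (\<Sum>i\<in>I. \<Sum>p\<in>U. \<Sum>j\<in>I. b i * cnj (b j) * (of_real (\<psi> p) * (a i p * cnj (a j p))))"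
    by (rule sum.swap)
  also have "\<dots> = (\<Sum>i\<in>I. \<Sum>j\<in>I. \<Sum>p\<in>U. b i * cnj (b j) * (of_real (\<psi> p) * (a i p * cnj (a j p))))"
    by (intro sum.cong refl sum.swap)
  finally show ?thesis by (simp only: sum_distrib_left)
qed

lemma negbin_mean_square_le:
  fixes b x y :: "'i \<Rightarrow> complex"
  assumes "finite I" "0 < M" and x: "\<And>i. i \<in> I \<Longrightarrow> norm (x i) \<le> 1" and y: "\<And>i. i \<in> I \<Longrightarrow> norm (y i) \<le> 1"
  shows "(\<Sum>u<n. \<Sum>v<n. negbin_weight k M u * negbin_weight k M v *
            (cmod (\<Sum>i\<in>I. b i * (x i ^ u * y i ^ v)))\<^sup>2)
       \<le> (\<Sum>i\<in>I. \<Sum>j\<in>I. cmod (b i) * cmod (b j) *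
            (cmod (negbin_kernel k M (x i * cnj (x j)))
              * cmod (negbin_kernel k M (y i * cnj (y j)))))"
proof -
  let ?\<psi> = "negbin_weight k M" and ?\<Phi> = "negbin_kernel k M"
  define summand
    where "summand p = (?\<psi> (fst p) * ?\<psi> (snd p))
        * (cmod (\<Sum>i\<in>I. b i * (x i ^ fst p * y i ^ snd p)))\<^sup>2" for p
  define partial where "partial n z = (\<Sum>u<n. of_real (?\<psi> u) * z ^ u :: complex)" for n z
  define total where "total n = (\<Sum>p\<in>{..<n} \<times> {..<n}. summand p)" for n
  let ?R = "\<Sum>i\<in>I. \<Sum>j\<in>I. b i * cnj (b j) * (?\<Phi> (x i * cnj (x j)) * ?\<Phi> (y i * cnj (y j)))"
  have pair_sum: "(\<Sum>p\<in>{..<n} \<times> {..<n}. of_real (?\<psi> (fst p) * ?\<psi> (snd p)) *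
        ((x i ^ fst p * y i ^ snd p) * cnj (x j ^ fst p * y j ^ snd p)))
      = partial n (x i * cnj (x j)) * partial n (y i * cnj (y j))" for n i j
    unfolding partial_def sum_product sum.cartesian_product
    by (intro sum.cong refl) (auto simp: power_mult_distrib)
  have total_eq: "of_real (total n)
      = (\<Sum>i\<in>I. \<Sum>j\<in>I. b i * cnj (b j)
        * (partial n (x i * cnj (x j)) * partial n (y i * cnj (y j))))" for n
    unfolding total_def summand_def weighted_mean_square_expand pair_sum ..
  have partial_lim: "(\<lambda>n. partial n z) \<longlonglongrightarrow> ?\<Phi> z" if "norm z \<le> 1" for z
    using negbin_weight_sums[OF assms(2) that] by (simp add: sums_def partial_def)
  have "norm (x i * cnj (x j)) \<le> 1" "norm (y i * cnj (y j)) \<le> 1" if "i \<in> I" "j \<in> I" for i j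
    using x y that by (simp_all add: norm_mult mult_le_one)
  then have "(\<lambda>n. of_real (total n)) \<longlonglongrightarrow> ?R"
    unfolding total_eq by (intro tendsto_sum tendsto_mult tendsto_const partial_lim)
  then have "(\<lambda>n. norm (complex_of_real (total n))) \<longlonglongrightarrow> norm ?R" by (rule tendsto_norm)
  moreover have summand_nonneg: "0 \<le> summand p" for p
    by (simp add: summand_def negbin_weight_nonneg)
  moreover from this have "0 \<le> total n" for n unfolding total_def by (rule sum_nonneg)
  ultimately have "total \<longlonglongrightarrow> norm ?R" by simp
  moreover have "incseq total"
    unfolding total_def by (intro incseq_SucI sum_mono2 summand_nonneg) auto
  ultimately have "total n \<le> norm ?R" by (intro incseq_le)
  also have "\<dots> \<le> (\<Sum>i\<in>I. \<Sum>j\<in>I. cmod (b i) * cmod (b j) *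
            (cmod (?\<Phi> (x i * cnj (x j))) * cmod (?\<Phi> (y i * cnj (y j)))))"
    by (intro order.trans[OF norm_sum] sum_mono) (simp add: norm_mult)
  finally show ?thesis by (simp add: total_def summand_def sum.cartesian_product case_prod_beta)
qed

subsection \<open>Kernel bounds\<close>

definition near_int :: "real \<Rightarrow> real \<Rightarrow> bool" where
  "near_int t x \<longleftrightarrow> (\<exists>m::int. \<bar>x - of_int m\<bar> \<le> t)"

lemma near_intI: "\<bar>x - of_int m\<bar> \<le> t \<Longrightarrow> near_int t x"
  by (auto simp: near_int_def)

lemma near_intE:
  assumes "near_int t x"
  obtains m where "\<bar>x - of_int m\<bar> \<le> t"
  using assms by (auto simp: near_int_def)

lemma near_int_mono: "near_int t x \<Longrightarrow> t \<le> t' \<Longrightarrow> near_int t' x"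
  unfolding near_int_def by (meson order_trans)

lemma near_int_diff:
  assumes "near_int t (z - x)" "near_int t (z - y)"
  shows "near_int (2 * t) (x - y)"
proof -
  obtain m m' where "\<bar>z - x - of_int m\<bar> \<le> t" "\<bar>z - y - of_int m'\<bar> \<le> t"
    using assms by (auto elim!: near_intE)
  then have "\<bar>x - y - of_int (m' - m)\<bar> \<le> 2 * t" by simp
  then show ?thesis by (rule near_intI)
qed

lemma near_int_minus_commute: "near_int t (x - y) \<longleftrightarrow> near_int t (y - x)"
proof -
  have "near_int t (y - x)" if near: "near_int t (x - y)" for x y
  proof -
    obtain m where "\<bar>x - y - of_int m\<bar> \<le> t" using near by (rule near_intE)
    then have "\<bar>y - x - of_int (- m)\<bar> \<le> t" by (simp add: abs_if split: if_splits)
    then show ?thesis by (rule near_intI)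
  qed
  then show ?thesis by blast
qed

lemma half_le_sin:
  assumes "0 \<le> x" "x \<le> pi / 2"
  shows "x / 2 \<le> sin (x::real)"
proof -
  have "\<bar>sin x - (\<Sum>m<3. sin_coeff m * x ^ m)\<bar> \<le> inverse (fact 3) * \<bar>x\<bar> ^ 3"
    by (rule Maclaurin_sin_bound)
  moreover have "(\<Sum>m<3. sin_coeff m * x ^ m) = x"
    by (simp add: numeral_3_eq_3 sin_coeff_def)
  moreover have "inverse (fact 3) * \<bar>x\<bar> ^ 3 = x * x\<^sup>2 / 6"
    using assms by (simp add: fact_numeral power3_eq_cube power2_eq_square)
  moreover have "x \<le> 8/5" using assms pi_less_4 pi_approx by simp
  then have "x\<^sup>2 \<le> (8/5)\<^sup>2" using assms by (intro power_mono) auto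
  then have "x * x\<^sup>2 \<le> x * 3" using assms by (intro mult_left_mono) (auto simp: power2_eq_square)
  ultimately have "\<bar>sin x - x\<bar> \<le> x * 3 / 6" by simp
  then show ?thesis by linarith
qed

lemma cmod_one_minus_cis_ge:
  assumes "\<not> near_int t \<xi>"
  shows "t \<le> cmod (1 - cis (2 * pi * \<xi>))"
proof -
  define \<eta> where "\<eta> = \<xi> - of_int (round \<xi>)"
  have \<eta>: "\<bar>\<eta>\<bar> \<le> 1/2" "t < \<bar>\<eta>\<bar>"
    using assms of_int_round_abs_le[of \<xi>] unfolding \<eta>_def near_int_def
    by (simp_all add: abs_minus_commute not_le del: of_int_round_abs_le)
  have split: "2 * pi * \<xi> = 2 * pi * \<eta> + 2 * pi * of_int (round \<xi>)"
    by (simp add: \<eta>_def algebra_simps)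
  have "cis (2 * pi * \<xi>) = cis (2 * pi * \<eta>)"
    unfolding split cis_mult[symmetric] by (simp add: cis_multiple_2pi)
  then have "cmod (1 - cis (2 * pi * \<xi>)) = 2 * \<bar>sin (pi * \<eta>)\<bar>"
    using dist_exp_i_1[of "2 * pi * \<eta>"] by (simp add: cis_conv_exp norm_minus_commute)
  moreover have "pi * \<bar>\<eta>\<bar> / 2 \<le> sin (pi * \<bar>\<eta>\<bar>)" using \<eta> by (intro half_le_sin) auto
  moreover have "1 * \<bar>\<eta>\<bar> \<le> pi * \<bar>\<eta>\<bar>" using pi_ge_two by (intro mult_right_mono) auto
  moreover have "sin (pi * \<bar>\<eta>\<bar>) \<le> \<bar>sin (pi * \<eta>)\<bar>" by (cases "0 \<le> \<eta>") auto
  ultimately show ?thesis using \<eta>(2) by linarith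
qed

lemma cmod_negbin_kernel:
  "cmod (negbin_kernel k M z) = inverse (cmod (1 - of_real (exp (- 1 / M)) * z)) ^ Suc k"
  unfolding negbin_kernel_def norm_divide norm_power norm_one power_inverse
  by (rule divide_inverse[THEN trans]) simp

lemma cmod_negbin_kernel_le_inverse:
  assumes "0 < t" "t \<le> cmod (1 - of_real (exp (- 1 / M)) * z)"
  shows "cmod (negbin_kernel k M z) \<le> (1 / t) ^ Suc k"
proof -
  have "inverse (cmod (1 - of_real (exp (- 1 / M)) * z)) \<le> inverse t"
    using assms by (intro le_imp_inverse_le) auto
  then show ?thesis unfolding cmod_negbin_kernel inverse_eq_divide by (intro power_mono) auto
qed

lemma cmod_negbin_kernel_le:
  assumes "1 \<le> M" "norm z \<le> 1"
  shows "cmod (negbin_kernel k M z) \<le> (2 * M) ^ Suc k"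
proof -
  let ?r = "exp (- 1 / M)"
  have "1 + 1 / M \<le> exp (1 / M)" by (rule exp_ge_add_one_self)
  then have "?r \<le> 1 / (1 + 1 / M)"
    using assms by (simp add: exp_minus inverse_eq_divide divide_left_mono add_pos_pos)
  also have "\<dots> \<le> 1 - 1 / (2 * M)" using assms by (simp add: field_simps)
  finally have "1 / (2 * M) \<le> 1 - ?r" by simp
  also have "\<dots> \<le> cmod (1 - of_real ?r * z)"
  proof -
    have "cmod (of_real ?r * z) \<le> ?r * 1" using assms by (simp add: norm_mult)
    then show ?thesis using norm_triangle_ineq2[of 1 "of_real ?r * z"] by simp
  qed
  finally have "cmod (negbin_kernel k M z) \<le> (1 / (1 / (2 * M))) ^ Suc k"
    using assms by (intro cmod_negbin_kernel_le_inverse) auto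
  then show ?thesis by simp
qed

lemma cmod_one_minus_scaled_cis_ge:
  assumes "0 \<le> \<sigma>" "\<sigma> \<le> 1" "\<not> near_int t \<xi>"
  shows "t / 2 \<le> cmod (1 - of_real \<sigma> * cis (2 * pi * \<xi>))"
proof -
  let ?e = "cis (2 * pi * \<xi>)"
  have "1 - ?e = (1 - of_real \<sigma> * ?e) + (of_real \<sigma> * ?e - ?e)" by simp
  then have "cmod (1 - ?e) \<le> cmod (1 - of_real \<sigma> * ?e) + cmod (of_real \<sigma> * ?e - ?e)"
    by (metis norm_triangle_ineq)
  moreover have "of_real \<sigma> * ?e - ?e = - (of_real (1 - \<sigma>) * ?e)" by (simp add: algebra_simps)
  then have "cmod (of_real \<sigma> * ?e - ?e) = \<bar>1 - \<sigma>\<bar>"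
    by (simp only: norm_minus_cancel norm_mult norm_of_real norm_cis mult_1_right)
  moreover have "1 - \<sigma> \<le> cmod (1 - of_real \<sigma> * ?e)"
    using norm_triangle_ineq2[of 1 "of_real \<sigma> * ?e"] assms by (simp add: norm_mult)
  moreover have "t \<le> cmod (1 - ?e)" by (rule cmod_one_minus_cis_ge[OF assms(3)])
  ultimately show ?thesis using assms by simp
qed

lemma cmod_negbin_kernel_far_le:
  assumes "0 < M" "0 \<le> \<rho>" "\<rho> \<le> 1" "0 < t" "\<not> near_int t \<xi>"
  shows "cmod (negbin_kernel k M (of_real \<rho> * cis (2 * pi * \<xi>))) \<le> (2 / t) ^ Suc k"
proof -
  have "t / 2 \<le> cmod (1 - of_real (exp (- 1 / M) * \<rho>) * cis (2 * pi * \<xi>))"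
    using assms by (intro cmod_one_minus_scaled_cis_ge) (auto intro!: mult_le_one)
  then have "cmod (negbin_kernel k M (of_real \<rho> * cis (2 * pi * \<xi>))) \<le> (1 / (t / 2)) ^ Suc k"
    using assms(4) by (intro cmod_negbin_kernel_le_inverse) (simp_all only: of_real_mult mult.assoc)
  then show ?thesis by simp
qed

subsection \<open>The bilinear large sieve\<close>

definition damped :: "real \<Rightarrow> real \<Rightarrow> complex" where
  "damped N \<theta> = of_real (exp (- 1 / N)) * cis (2 * pi * \<theta>)"

lemma damped_power:
  "damped N \<theta> ^ n = of_real (exp (- real n / N)) * cis (2 * pi * (\<theta> * real n))"
proof -
  have "exp (- 1 / N) ^ n = exp (- real n / N)" by (simp add: exp_of_nat_mult[symmetric])
  moreover have "cis (2 * pi * \<theta>) ^ n = cis (2 * pi * (\<theta> * real n))"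
    by (simp only: Complex.DeMoivre) (simp add: ac_simps)
  ultimately show ?thesis by (simp only: damped_def power_mult_distrib of_real_power[symmetric])
qed

lemma norm_damped_power: "norm (damped N \<theta> ^ n) = exp (- real n / N)"
  by (simp add: damped_power norm_mult)

lemma norm_damped_power_le_1: "0 < N \<Longrightarrow> norm (damped N \<theta> ^ n) \<le> 1"
  by (simp add: norm_damped_power)

lemma damped_power_mult_cnj:
  "damped N \<theta> ^ n * cnj (damped N \<theta>' ^ n')
     = of_real (exp (- (real n + real n') / N)) * cis (2 * pi * (\<theta> * real n - \<theta>' * real n'))"
proof -
  have "damped N \<theta> ^ n * cnj (damped N \<theta>' ^ n') =
     of_real (exp (- real n / N) * exp (- real n' / N)) *
       (cis (2 * pi * (\<theta> * real n)) * cis (- (2 * pi * (\<theta>' * real n'))))"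
    unfolding damped_power by (simp add: cis_cnj ac_simps)
  also have "exp (- real n / N) * exp (- real n' / N) = exp (- (real n + real n') / N)"
    by (simp add: exp_add[symmetric] diff_divide_distrib)
  also have "cis (2 * pi * (\<theta> * real n)) * cis (- (2 * pi * (\<theta>' * real n')))
      = cis (2 * pi * (\<theta> * real n - \<theta>' * real n'))"
    by (simp add: cis_mult algebra_simps)
  finally show ?thesis .
qed

definition near_vec :: "real \<Rightarrow> real \<Rightarrow> nat list \<Rightarrow> real \<Rightarrow> nat list \<Rightarrow> bool" where
  "near_vec t \<theta> w \<theta>' w' \<longleftrightarrow>
     near_int t (\<theta> * real (cont w) - \<theta>' * real (cont w')) \<and>
     near_int t (\<theta> * real (cont_tl w) - \<theta>' * real (cont_tl w'))"

definition near_pairs :: "real \<Rightarrow> real set \<Rightarrow> nat list set \<Rightarrow> real \<Rightarrow> real" where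
  "near_pairs t \<Theta> V \<theta> = (\<Sum>w\<in>V. \<Sum>w'\<in>V. real (card {\<theta>'\<in>\<Theta>. near_vec t \<theta> w \<theta>' w'}))"

lemma near_vec_sym: "near_vec t \<theta> w \<theta>' w' \<longleftrightarrow> near_vec t \<theta>' w' \<theta> w"
  unfolding near_vec_def by (subst (1 2) near_int_minus_commute) simp

lemma cmod_negbin_kernel_damped_le:
  assumes "0 < N" "1 \<le> M"
  shows "cmod (negbin_kernel k M (damped N \<theta> ^ a * cnj (damped N \<theta>' ^ b))) \<le> (2 * M) ^ Suc k"
proof (rule cmod_negbin_kernel_le[OF assms(2)])
  show "norm (damped N \<theta> ^ a * cnj (damped N \<theta>' ^ b)) \<le> 1"
    unfolding damped_power_mult_cnj using assms by (simp add: norm_mult divide_nonpos_pos)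
qed

lemma cmod_negbin_kernel_damped_far_le:
  assumes "0 < N" "1 \<le> M" "1 \<le> H" "\<not> near_int (H / M) (\<theta> * real a - \<theta>' * real b)"
  shows "cmod (negbin_kernel k M (damped N \<theta> ^ a * cnj (damped N \<theta>' ^ b)))
      \<le> (2 * M) ^ Suc k / H ^ Suc k"
proof -
  have "cmod (negbin_kernel k M (damped N \<theta> ^ a * cnj (damped N \<theta>' ^ b))) \<le> (2 / (H / M)) ^ Suc k"
    unfolding damped_power_mult_cnj using assms
    by (intro cmod_negbin_kernel_far_le) (auto simp: divide_nonpos_pos)
  then show ?thesis by (simp add: power_divide power_mult_distrib)
qed

lemma negbin_kernels_near_vec_le:
  assumes "0 < N" "1 \<le> M" "1 \<le> H"
  shows "cmod (negbin_kernel k M (damped N \<theta> ^ cont w * cnj (damped N \<theta>' ^ cont w'))) *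
         cmod (negbin_kernel k M (damped N \<theta> ^ cont_tl w * cnj (damped N \<theta>' ^ cont_tl w')))
       \<le> (2 * M) ^ (2 * Suc k) * (of_bool (near_vec (H / M) \<theta> w \<theta>' w') + 1 / H ^ Suc k)"
proof -
  let ?K = "\<lambda>a b. cmod (negbin_kernel k M (damped N \<theta> ^ a * cnj (damped N \<theta>' ^ b)))"
  define P where "P = (2 * M) ^ Suc k"
  define h where "h = 1 / H ^ Suc k"
  have nonneg: "0 \<le> P" "0 \<le> h" using assms by (auto simp: P_def h_def)
  have near_bound: "?K a b \<le> P" for a b
    unfolding P_def by (rule cmod_negbin_kernel_damped_le[OF assms(1,2)])
  have far_bound: "?K a b \<le> P * h" if "\<not> near_int (H / M) (\<theta> * real a - \<theta>' * real b)" for a b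
    using cmod_negbin_kernel_damped_far_le[OF assms that] by (simp add: P_def h_def)
  have "?K (cont w) (cont w') * ?K (cont_tl w) (cont_tl w')
      \<le> P * P * (of_bool (near_vec (H / M) \<theta> w \<theta>' w') + h)"
  proof (cases "near_vec (H / M) \<theta> w \<theta>' w'")
    case True
    have "?K (cont w) (cont w') * ?K (cont_tl w) (cont_tl w') \<le> P * P * 1"
      unfolding mult_1_right using nonneg near_bound by (intro mult_mono) auto
    also have "\<dots> \<le> P * P * (1 + h)" using nonneg by (intro mult_left_mono) auto
    finally show ?thesis using True by simp
  next
    case False
    then consider (first) "\<not> near_int (H / M) (\<theta> * real (cont w) - \<theta>' * real (cont w'))"
      | (second) "\<not> near_int (H / M) (\<theta> * real (cont_tl w) - \<theta>' * real (cont_tl w'))"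
      by (auto simp: near_vec_def)
    then have "?K (cont w) (cont w') * ?K (cont_tl w) (cont_tl w') \<le> P * (P * h)"
    proof cases
      case first
      then have "?K (cont w) (cont w') * ?K (cont_tl w) (cont_tl w') \<le> (P * h) * P"
        using far_bound near_bound nonneg by (intro mult_mono) auto
      then show ?thesis by (simp only: mult.commute)
    next
      case second
      then show ?thesis using far_bound near_bound nonneg by (intro mult_mono) auto
    qed
    then show ?thesis using False by (simp add: mult.assoc)
  qed
  then show ?thesis by (simp only: P_def h_def mult_2 power_add)
qed

text \<open>Schur's test: \<open>\<beta> i * \<beta> j\<close> is at most the mean of the squares.\<close>

lemma symmetric_form_le_row_sums:
  fixes \<beta> :: "'i \<Rightarrow> real"
  assumes "\<And>i j. i \<in> I \<Longrightarrow> j \<in> I \<Longrightarrow> 0 \<le> g i j" "\<And>i j. i \<in> I \<Longrightarrow> j \<in> I \<Longrightarrow> g i j = g j i"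
  shows "(\<Sum>i\<in>I. \<Sum>j\<in>I. \<beta> i * \<beta> j * g i j) \<le> (\<Sum>i\<in>I. (\<beta> i)\<^sup>2 * (\<Sum>j\<in>I. g i j))"
proof -
  have "(\<Sum>i\<in>I. \<Sum>j\<in>I. \<beta> i * \<beta> j * g i j) \<le> (\<Sum>i\<in>I. \<Sum>j\<in>I. ((\<beta> i)\<^sup>2 + (\<beta> j)\<^sup>2) / 2 * g i j)"
  proof (intro sum_mono mult_right_mono)
    show "\<beta> i * \<beta> j \<le> ((\<beta> i)\<^sup>2 + (\<beta> j)\<^sup>2) / 2" for i j
      using sum_squares_bound[of "\<beta> i" "\<beta> j"] by simp
  qed (use assms(1) in auto)
  also have "\<dots> = ((\<Sum>i\<in>I. \<Sum>j\<in>I. (\<beta> i)\<^sup>2 * g i j) + (\<Sum>i\<in>I. \<Sum>j\<in>I. (\<beta> j)\<^sup>2 * g i j)) / 2"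
    by (simp only: sum.distrib[symmetric] sum_divide_distrib)
      (simp add: algebra_simps add_divide_distrib)
  also have "(\<Sum>i\<in>I. \<Sum>j\<in>I. (\<beta> j)\<^sup>2 * g i j) = (\<Sum>i\<in>I. \<Sum>j\<in>I. (\<beta> i)\<^sup>2 * g i j)"
    by (subst sum.swap, intro sum.cong refl) (simp add: assms(2))
  finally show ?thesis unfolding sum_distrib_left by simp
qed

lemma large_sieve_duality:
  fixes T :: "'t \<Rightarrow> 'x \<Rightarrow> complex"
  assumes dual: "\<And>\<beta>. (\<Sum>x\<in>U. (cmod (\<Sum>\<theta>\<in>\<Theta>. \<beta> \<theta> * T \<theta> x))\<^sup>2) \<le> \<Delta> * (\<Sum>\<theta>\<in>\<Theta>. (cmod (\<beta> \<theta>))\<^sup>2)"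
    and "0 \<le> \<Delta>"
  shows "(\<Sum>\<theta>\<in>\<Theta>. (cmod (\<Sum>x\<in>U. T \<theta> x))\<^sup>2) \<le> real (card U) * \<Delta>"
proof -
  define S where "S \<theta> = (\<Sum>x\<in>U. T \<theta> x)" for \<theta>
  define E where "E = (\<Sum>\<theta>\<in>\<Theta>. (cmod (S \<theta>))\<^sup>2)"
  have "0 \<le> E" unfolding E_def by (intro sum_nonneg) auto
  have "complex_of_real E = (\<Sum>\<theta>\<in>\<Theta>. cnj (S \<theta>) * S \<theta>)"
    unfolding E_def by
      (simp add: complex_norm_square mult.commute del: of_real_power flip: of_real_power)
  also have "\<dots> = (\<Sum>\<theta>\<in>\<Theta>. \<Sum>x\<in>U. cnj (S \<theta>) * T \<theta> x)" by (simp only: S_def sum_distrib_left)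
  also have "\<dots> = (\<Sum>x\<in>U. \<Sum>\<theta>\<in>\<Theta>. cnj (S \<theta>) * T \<theta> x)" by (rule sum.swap)
  finally have "E\<^sup>2 = (cmod (\<Sum>x\<in>U. \<Sum>\<theta>\<in>\<Theta>. cnj (S \<theta>) * T \<theta> x))\<^sup>2"
    by (metis norm_of_real power2_abs)
  also have "\<dots> \<le> (\<Sum>x\<in>U. cmod (\<Sum>\<theta>\<in>\<Theta>. cnj (S \<theta>) * T \<theta> x))\<^sup>2"
    by (intro power_mono norm_sum) auto
  also have "\<dots> \<le> (\<Sum>x\<in>U. (cmod (\<Sum>\<theta>\<in>\<Theta>. cnj (S \<theta>) * T \<theta> x))\<^sup>2) * card U"
    by (rule sum_squared_le_sum_of_squares)
  also have "\<dots> \<le> (\<Delta> * E) * card U"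
    using dual[of "\<lambda>\<theta>. cnj (S \<theta>)"] by (intro mult_right_mono) (auto simp: E_def)
  finally have "E * E \<le> E * (real (card U) * \<Delta>)" by (simp add: power2_eq_square ac_simps)
  then have "E \<le> real (card U) * \<Delta>"
    using \<open>0 \<le> E\<close> \<open>0 \<le> \<Delta>\<close> by (cases "E = 0") (auto simp: mult_le_cancel_left)
  then show ?thesis by (simp add: E_def S_def)
qed

lemma sum_near_vec_row:
  assumes "finite \<Theta>" "finite V"
  shows "(\<Sum>w\<in>V. \<Sum>j\<in>\<Theta> \<times> V. of_bool (near_vec t \<theta> w (fst j) (snd j)) + e)
    = near_pairs t \<Theta> V \<theta> + (real (card V))\<^sup>2 * real (card \<Theta>) * e"
proof -
  have "(\<Sum>j\<in>\<Theta> \<times> V. of_bool (near_vec t \<theta> w (fst j) (snd j)) + e)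
      = (\<Sum>w'\<in>V. real (card {\<theta>'\<in>\<Theta>. near_vec t \<theta> w \<theta>' w'})) + real (card V) * real (card \<Theta>) * e" for w
  proof -
    have "(\<Sum>j\<in>\<Theta> \<times> V. of_bool (near_vec t \<theta> w (fst j) (snd j)) + e)
        = (\<Sum>\<theta>'\<in>\<Theta>. \<Sum>w'\<in>V. of_bool (near_vec t \<theta> w \<theta>' w')) + real (card V) * real (card \<Theta>) * e"
      by (simp add: sum.distrib sum.cartesian_product case_prod_beta card_cartesian_product)
    also have "(\<Sum>\<theta>'\<in>\<Theta>. \<Sum>w'\<in>V. of_bool (near_vec t \<theta> w \<theta>' w'))
        = (\<Sum>w'\<in>V. \<Sum>\<theta>'\<in>\<Theta>. of_bool (near_vec t \<theta> w \<theta>' w') :: real)" by (rule sum.swap)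
    finally show ?thesis using assms by (simp add: sum_of_bool_eq Int_def conj_commute)
  qed
  then show ?thesis by (simp add: sum.distrib near_pairs_def power2_eq_square)
qed

lemma sum_kernel_products_le:
  assumes N: "0 < N" and fin: "finite \<Theta>" "finite V" and M: "1 \<le> M" and H: "1 \<le> H"
    and D: "\<And>\<theta>. \<theta> \<in> \<Theta> \<Longrightarrow> near_pairs (H / M) \<Theta> V \<theta> \<le> D"
  shows "(\<Sum>i\<in>\<Theta> \<times> V. \<Sum>j\<in>\<Theta> \<times> V. cmod (\<beta> (fst i)) * cmod (\<beta> (fst j)) *
      (cmod (negbin_kernel k M (damped N (fst i) ^ cont (snd i)
        * cnj (damped N (fst j) ^ cont (snd j)))) *
       cmod (negbin_kernel k M (damped N (fst i) ^ cont_tl (snd i)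
         * cnj (damped N (fst j) ^ cont_tl (snd j))))))
    \<le> (2 * M) ^ (2 * Suc k) *
       ((D + (real (card V))\<^sup>2 * real (card \<Theta>) / H ^ Suc k) * (\<Sum>\<theta>\<in>\<Theta>. (cmod (\<beta> \<theta>))\<^sup>2))"
    (is "?lhs \<le> ?P * (?row * _)")
proof -
  define I where "I = \<Theta> \<times> V"
  define g
    where "g i j = of_bool (near_vec (H / M) (fst i) (snd i) (fst j) (snd j)) + 1 / H ^ Suc k"
      for i j
  have sum_I: "(\<Sum>i\<in>I. f i) = (\<Sum>\<theta>\<in>\<Theta>. \<Sum>w\<in>V. f (\<theta>, w))" for f :: "real \<times> nat list \<Rightarrow> real"
    by (simp add: I_def sum.cartesian_product case_prod_beta)
  have "?lhs \<le> (\<Sum>i\<in>I. \<Sum>j\<in>I. cmod (\<beta> (fst i)) * cmod (\<beta> (fst j)) * (?P * g i j))"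
    unfolding g_def I_def using N M H
    by (intro sum_mono mult_left_mono negbin_kernels_near_vec_le) auto
  also have "\<dots> = ?P * (\<Sum>i\<in>I. \<Sum>j\<in>I. cmod (\<beta> (fst i)) * cmod (\<beta> (fst j)) * g i j)"
    by (simp only: sum_distrib_left ac_simps)
  also have "\<dots> \<le> ?P * (\<Sum>i\<in>I. (cmod (\<beta> (fst i)))\<^sup>2 * (\<Sum>j\<in>I. g i j))"
    using M H near_vec_sym by (intro mult_left_mono symmetric_form_le_row_sums) (auto simp: g_def)
  also have "(\<Sum>i\<in>I. (cmod (\<beta> (fst i)))\<^sup>2 * (\<Sum>j\<in>I. g i j))
      = (\<Sum>\<theta>\<in>\<Theta>. (cmod (\<beta> \<theta>))\<^sup>2 * (\<Sum>w\<in>V. \<Sum>j\<in>I. g (\<theta>, w) j))"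
    by (subst sum_I) (simp add: sum_distrib_left)
  also have "\<dots> \<le> (\<Sum>\<theta>\<in>\<Theta>. (cmod (\<beta> \<theta>))\<^sup>2 * ?row)"
    using D unfolding I_def g_def fst_conv snd_conv sum_near_vec_row[OF fin]
    by (intro sum_mono mult_left_mono) auto
  also have "\<dots> = ?row * (\<Sum>\<theta>\<in>\<Theta>. (cmod (\<beta> \<theta>))\<^sup>2)"
    unfolding sum_distrib_right[symmetric] by (rule mult.commute)
  finally show ?thesis using M by (simp add: mult_left_mono)
qed

context alphabet
begin

lemma sum_words_le_box:
  assumes "finite U" "U \<subseteq> lists A" "\<And>u v. 0 \<le> (h u v :: real)"
    "\<And>x. x \<in> U \<Longrightarrow> cont x < n"
  shows "(\<Sum>x\<in>U. h (cont x) (cont_bl x)) \<le> 2 * (\<Sum>u<n. \<Sum>v<n. h u v)"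
proof -
  let ?g = "\<lambda>x. (cont x, cont_bl x)"
  have "cont_bl x < n" if "x \<in> U" for x
  proof -
    have "x \<in> lists A" using assms(2) that by blast
    then show ?thesis using cont_bl_le[OF zero_notin_word, of x] assms(4)[OF that] by linarith
  qed
  then have image: "?g ` U \<subseteq> {..<n} \<times> {..<n}" using assms(4) by auto
  have card_fibre: "card {x \<in> U. ?g x = p} \<le> 2" for p
  proof -
    let ?S = "{x \<in> U. ?g x = p}"
    have "card ?S = card (rev ` ?S)" by (simp add: card_image)
    also have "\<dots> \<le> 2 * card (cont_vec ` rev ` ?S)"
      using assms zero_notin_A by (intro card_le_twice_card_image) auto
    also have "card (cont_vec ` rev ` ?S) \<le> card {p}"
      by (rule card_mono) (auto simp: cont_vec_def cont_rev cont_tl_rev)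
    finally show ?thesis by simp
  qed
  have "(\<Sum>x\<in>U. h (cont x) (cont_bl x))
      = (\<Sum>p\<in>{..<n} \<times> {..<n}. \<Sum>x\<in>{x\<in>U. ?g x = p}. h (cont x) (cont_bl x))"
    using assms(1) image by (intro sum.group[symmetric]) auto
  also have "\<dots> = (\<Sum>p\<in>{..<n} \<times> {..<n}. real (card {x\<in>U. ?g x = p}) * h (fst p) (snd p))"
    by (intro sum.cong refl) auto
  also have "\<dots> \<le> (\<Sum>p\<in>{..<n} \<times> {..<n}. 2 * h (fst p) (snd p))"
    using card_fibre assms(3) by (intro sum_mono mult_right_mono) auto
  also have "\<dots> = 2 * (\<Sum>u<n. \<Sum>v<n. h u v)"
    by (simp add: sum_distrib_left sum.cartesian_product case_prod_beta)
  finally show ?thesis .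
qed

definition weight_const :: "nat \<Rightarrow> real" where
  "weight_const k = (1 / (step_ratio * k)) ^ k * exp (- step_ratio)"

definition sieve_const :: "nat \<Rightarrow> real" where
  "sieve_const k = 2 * 2 ^ (2 * Suc k) / (weight_const k)\<^sup>2"

lemma weight_const_pos: "0 < weight_const k"
  unfolding weight_const_def using step_ratio_ge_2
  by (cases "k = 0") (auto intro!: mult_pos_pos zero_less_power)

lemma sieve_const_pos: "0 < sieve_const k"
  using weight_const_pos[of k] by (simp add: sieve_const_def)

lemma negbin_weight_ge:
  assumes "1 \<le> M" "M \<le> step_ratio * real u" "real u \<le> step_ratio * M"
  shows "weight_const k * M ^ k \<le> negbin_weight k M u"
proof -
  have "(M / (step_ratio * k)) ^ k * exp (- step_ratio) \<le> negbin_weight k M u"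
    unfolding negbin_weight_def
  proof (rule mult_mono)
    have "M / step_ratio \<le> real u"
      using assms(2) step_ratio_ge_2 by (simp add: pos_divide_le_eq mult.commute)
    then have "M / step_ratio / k \<le> real (u + k) / real k" by (intro divide_right_mono) auto
    then have "M / (step_ratio * k) \<le> real (u + k) / real k" by simp
    then have "(M / (step_ratio * k)) ^ k \<le> (real (u + k) / real k) ^ k"
      using assms step_ratio_ge_2 by (intro power_mono) auto
    also have "\<dots> \<le> real ((u + k) choose k)" by (rule binomial_ge_n_over_k_pow_k) simp
    finally show "(M / (step_ratio * k)) ^ k \<le> real ((u + k) choose k)" .
    show "exp (- step_ratio) \<le> exp (- real u / M)"
      using assms by (simp add: field_simps)
  qed auto
  then show ?thesis by (simp add: weight_const_def power_divide mult.commute)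
qed

lemma stop_word_weight_ge:
  assumes "1 < M" "x \<in> stop_words M"
  shows "(weight_const k * M ^ k)\<^sup>2 \<le> negbin_weight k M (cont x) * negbin_weight k M (cont_bl x)"
proof -
  note lists = stop_words_lists[OF assms(2)]
  have lower: "M \<le> real (cont x)" by (rule stop_words_ge[OF assms(2)])
  have upper: "real (cont x) \<le> step_ratio * M" using stop_words_le[OF assms(2)] assms(1) by simp
  have bl_le: "real (cont_bl x) \<le> real (cont x)"
    using cont_bl_le[OF zero_notin_word[OF lists]] by simp
  have "x \<noteq> []" using lower assms(1) by auto
  then have bl_ge: "M \<le> step_ratio * real (cont_bl x)" using cont_le_cont_bl[OF lists] lower by simp
  have "M \<le> step_ratio * real (cont x)"
    using bl_ge mult_left_mono[OF bl_le, of step_ratio] step_ratio_ge_2 by linarith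
  then show ?thesis
    unfolding power2_eq_square using assms(1) weight_const_pos[of k] upper bl_le bl_ge
    by (intro mult_mono negbin_weight_ge negbin_weight_nonneg) auto
qed

lemma stop_words_mean_square_le:
  fixes b X Y :: "'i \<Rightarrow> complex"
  assumes "1 < M" "finite I" "\<And>i. i \<in> I \<Longrightarrow> norm (X i) \<le> 1" "\<And>i. i \<in> I \<Longrightarrow> norm (Y i) \<le> 1"
  shows "(weight_const k * M ^ k)\<^sup>2 *
      (\<Sum>x\<in>stop_words M. (cmod (\<Sum>i\<in>I. b i * (X i ^ cont x * Y i ^ cont_bl x)))\<^sup>2)
    \<le> 2 * (\<Sum>i\<in>I. \<Sum>j\<in>I. cmod (b i) * cmod (b j) *
         (cmod (negbin_kernel k M (X i * cnj (X j))) * cmod (negbin_kernel k M (Y i * cnj (Y j)))))"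
proof -
  let ?\<psi> = "negbin_weight k M"
  define F where "F u v = (\<Sum>i\<in>I. b i * (X i ^ u * Y i ^ v))" for u v
  have lists: "stop_words M \<subseteq> lists A" using stop_words_lists by blast
  define n where "n = Suc (nat \<lceil>step_ratio * M\<rceil>)"
  have n: "cont x < n" if "x \<in> stop_words M" for x
    using stop_words_le[OF that] assms(1) unfolding n_def by linarith
  have "(weight_const k * M ^ k)\<^sup>2 * (\<Sum>x\<in>stop_words M. (cmod (F (cont x) (cont_bl x)))\<^sup>2)
      \<le> (\<Sum>x\<in>stop_words M. ?\<psi> (cont x) * ?\<psi> (cont_bl x) * (cmod (F (cont x) (cont_bl x)))\<^sup>2)"
    unfolding sum_distrib_left using stop_word_weight_ge[OF assms(1)]
    by (intro sum_mono mult_right_mono) auto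
  also have "\<dots> \<le> 2 * (\<Sum>u<n. \<Sum>v<n. ?\<psi> u * ?\<psi> v * (cmod (F u v))\<^sup>2)"
    by (rule sum_words_le_box[OF _ lists, where h = "\<lambda>u v. ?\<psi> u * ?\<psi> v * (cmod (F u v))\<^sup>2"])
       (use n finite_stop_words assms(1) negbin_weight_nonneg in auto)
  also have "\<dots> \<le> 2 * (\<Sum>i\<in>I. \<Sum>j\<in>I. cmod (b i) * cmod (b j) *
         (cmod (negbin_kernel k M (X i * cnj (X j))) * cmod (negbin_kernel k M (Y i * cnj (Y j)))))"
    unfolding F_def using assms by (intro mult_left_mono negbin_mean_square_le) auto
  finally show ?thesis by (simp add: F_def)
qed

lemma dual_large_sieve:
  assumes N: "0 < N" and fin: "finite \<Theta>" "finite V" and M: "1 < M" and H: "1 \<le> H"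
    and D: "\<And>\<theta>. \<theta> \<in> \<Theta> \<Longrightarrow> near_pairs (H / M) \<Theta> V \<theta> \<le> D"
  shows "(\<Sum>x\<in>stop_words M. (cmod (\<Sum>\<theta>\<in>\<Theta>. \<beta> \<theta> * (\<Sum>w\<in>V. damped N \<theta> ^ cont (x @ w))))\<^sup>2)
    \<le> sieve_const k * M\<^sup>2 * (D + (real (card V))\<^sup>2 * real (card \<Theta>) / H ^ Suc k) *
        (\<Sum>\<theta>\<in>\<Theta>. (cmod (\<beta> \<theta>))\<^sup>2)"
proof -
  let ?S = "\<Sum>x\<in>stop_words M. (cmod (\<Sum>\<theta>\<in>\<Theta>. \<beta> \<theta> * (\<Sum>w\<in>V. damped N \<theta> ^ cont (x @ w))))\<^sup>2"
  let ?T = "(D + (real (card V))\<^sup>2 * real (card \<Theta>) / H ^ Suc k) * (\<Sum>\<theta>\<in>\<Theta>. (cmod (\<beta> \<theta>))\<^sup>2)"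
  let ?\<kappa> = "weight_const k * M ^ k"
  define X where "X i = damped N (fst i) ^ cont (snd i)" for i
  define Y where "Y i = damped N (fst i) ^ cont_tl (snd i)" for i
  have "(\<Sum>\<theta>\<in>\<Theta>. \<beta> \<theta> * (\<Sum>w\<in>V. damped N \<theta> ^ cont (x @ w)))
      = (\<Sum>i\<in>\<Theta> \<times> V. \<beta> (fst i) * (X i ^ cont x * Y i ^ cont_bl x))" for x
    unfolding sum_distrib_left sum.cartesian_product
    by (intro sum.cong refl)
      (auto simp: X_def Y_def cont_append power_add power_mult[symmetric] ac_simps)
  then have "?\<kappa>\<^sup>2 * ?S \<le> 2 * (\<Sum>i\<in>\<Theta> \<times> V. \<Sum>j\<in>\<Theta> \<times> V. cmod (\<beta> (fst i)) * cmod (\<beta> (fst j)) *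
         (cmod (negbin_kernel k M (X i * cnj (X j))) * cmod (negbin_kernel k M (Y i * cnj (Y j)))))"
    using stop_words_mean_square_le[of M "\<Theta> \<times> V" X Y k "\<lambda>i. \<beta> (fst i)"]
      M fin N norm_damped_power_le_1
    by (simp add: X_def Y_def)
  also have "\<dots> \<le> 2 * ((2 * M) ^ (2 * Suc k) * ?T)"
    unfolding X_def Y_def using sum_kernel_products_le[OF N fin _ H D] M
    by (intro mult_left_mono) auto
  also have "\<dots> = ?\<kappa>\<^sup>2 * (sieve_const k * M\<^sup>2 * ?T)"
    using weight_const_pos[of k]
    by (simp add: sieve_const_def power_mult_distrib power_mult power2_eq_square)
  finally have "?\<kappa>\<^sup>2 * ?S \<le> ?\<kappa>\<^sup>2 * (sieve_const k * M\<^sup>2 * ?T)" .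
  moreover have "0 < ?\<kappa>\<^sup>2" using weight_const_pos[of k] M by simp
  ultimately show ?thesis by (simp only: mult_le_cancel_left_pos mult.assoc)
qed

definition bilinear_sum :: "real \<Rightarrow> real \<Rightarrow> real \<Rightarrow> nat list set \<Rightarrow> complex" where
  "bilinear_sum N \<theta> M V = (\<Sum>x\<in>stop_words M. \<Sum>w\<in>V. damped N \<theta> ^ cont (x @ w))"

lemma bilinear_large_sieve:
  assumes "0 < N" "finite \<Theta>" "finite V" "1 < M" "1 \<le> H" "0 \<le> D"
    and "\<And>\<theta>. \<theta> \<in> \<Theta> \<Longrightarrow> near_pairs (H / M) \<Theta> V \<theta> \<le> D"
  shows "(\<Sum>\<theta>\<in>\<Theta>. (cmod (bilinear_sum N \<theta> M V))\<^sup>2)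
    \<le> real (card (stop_words M)) *
       (sieve_const k * M\<^sup>2 * (D + (real (card V))\<^sup>2 * real (card \<Theta>) / H ^ Suc k))"
  unfolding bilinear_sum_def using assms sieve_const_pos[of k]
  by (intro large_sieve_duality dual_large_sieve) auto

end

subsection \<open>Counting lemmas\<close>

lemma card_separated_le:
  fixes S :: "real set"
  assumes "0 < d" "0 \<le> len" and window: "S \<subseteq> {l..l + len}"
    and separated: "\<And>x y. x \<in> S \<Longrightarrow> y \<in> S \<Longrightarrow> x \<noteq> y \<Longrightarrow> d \<le> \<bar>x - y\<bar>"
  shows "real (card S) \<le> len / d + 1"
proof -
  let ?f = "\<lambda>x. nat \<lfloor>(x - l) / d\<rfloor>"
  have inj: "inj_on ?f S"
  proof (rule inj_onI, rule ccontr)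
    fix x y assume xy: "x \<in> S" "y \<in> S" "?f x = ?f y" "x \<noteq> y"
    then have "0 \<le> (x - l) / d" "0 \<le> (y - l) / d" using assms(1) window by auto
    then have "\<lfloor>(x - l) / d\<rfloor> = \<lfloor>(y - l) / d\<rfloor>" using xy(3) by (simp add: eq_nat_nat_iff)
    then have "\<bar>(x - l) / d - (y - l) / d\<bar> < 1" by linarith
    then have "\<bar>x - y\<bar> < d" using assms(1)
      by (simp add: diff_divide_distrib[symmetric] abs_divide pos_divide_less_eq)
    then show False using separated[OF xy(1,2,4)] by simp
  qed
  have image: "?f ` S \<subseteq> {..nat \<lfloor>len / d\<rfloor>}"
  proof safe
    fix x assume "x \<in> S"
    then have "(x - l) / d \<le> len / d" using assms(1) window by (intro divide_right_mono) auto
    then show "nat \<lfloor>(x - l) / d\<rfloor> \<le> nat \<lfloor>len / d\<rfloor>" by (intro nat_mono floor_mono)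
  qed
  have "card S = card (?f ` S)" using inj by (simp add: card_image)
  also have "\<dots> \<le> card {..nat \<lfloor>len / d\<rfloor>}" using image by (intro card_mono) auto
  finally have "real (card S) \<le> real (nat \<lfloor>len / d\<rfloor>) + 1" by simp
  also have "real (nat \<lfloor>len / d\<rfloor>) \<le> len / d" using assms(1,2) by (intro of_nat_floor) auto
  finally show ?thesis by simp
qed

lemma card_congruent_le:
  fixes S :: "nat set"
  assumes "0 < e" "S \<subseteq> {..n}" and congruent: "\<And>x y. x \<in> S \<Longrightarrow> y \<in> S \<Longrightarrow> int e dvd int x - int y"
  shows "real (card S) \<le> real n / real e + 1"
proof -
  have "real (card (real ` S)) \<le> real n / real e + 1"
  proof (rule card_separated_le[where l = 0])
    fix x y assume xy: "x \<in> real ` S" "y \<in> real ` S" "x \<noteq> y"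
    then obtain i j where ij: "x = real i" "y = real j" "i \<in> S" "j \<in> S" by auto
    then have "int e dvd int i - int j" "int i - int j \<noteq> 0" using congruent xy(3) by auto
    then have "int e \<le> \<bar>int i - int j\<bar>" using dvd_imp_le_int[of "int i - int j" "int e"] by simp
    then show "real e \<le> \<bar>x - y\<bar>" using ij by linarith
  qed (use assms in auto)
  then show ?thesis by (simp add: card_image)
qed

lemma real_card_UN_le:
  assumes "finite I" "\<And>i. i \<in> I \<Longrightarrow> real (card (S i)) \<le> c"
  shows "real (card (\<Union>i\<in>I. S i)) \<le> real (card I) * c"
proof -
  have "real (card (\<Union>i\<in>I. S i)) \<le> (\<Sum>i\<in>I. real (card (S i)))"
    unfolding of_nat_sum[symmetric] of_nat_le_iff by (rule card_UN_le[OF assms(1)])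
  also have "\<dots> \<le> real (card I) * c"
    using sum_bounded_above[of I "\<lambda>i. real (card (S i))" c] assms(2) by simp
  finally show ?thesis .
qed

definition grid :: "nat \<Rightarrow> real set" where
  "grid N = (\<lambda>j. real j / real N) ` {..<N}"

lemma finite_grid: "finite (grid N)" by (simp add: grid_def)

lemma card_grid_le: "card (grid N) \<le> N"
  unfolding grid_def by (metis card_image_le card_lessThan finite_lessThan)

lemma grid_bounds: "\<theta> \<in> grid N \<Longrightarrow> 0 \<le> \<theta> \<and> \<theta> < 1"
  by (auto simp: grid_def)

lemma card_grid_interval_le:
  assumes "0 < N" "0 \<le> \<delta>" and S: "S \<subseteq> grid N" "S \<subseteq> {x - \<delta>..x + \<delta>}"
  shows "real (card S) \<le> 2 * real N * \<delta> + 1"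
proof -
  have "real (card S) \<le> (2 * \<delta>) / (1 / real N) + 1"
  proof (rule card_separated_le[where l = "x - \<delta>"])
    fix y z assume "y \<in> S" "z \<in> S" "y \<noteq> z"
    then have "y \<in> grid N" "z \<in> grid N" using S by auto
    then obtain i j where "y = real i / real N" "z = real j / real N" by (auto simp: grid_def)
    moreover from this have "i \<noteq> j" using \<open>y \<noteq> z\<close> by auto
    moreover from \<open>i \<noteq> j\<close> have "1 \<le> \<bar>real i - real j\<bar>" by linarith
    ultimately show "1 / real N \<le> \<bar>y - z\<bar>"
      using assms(1) by (simp add: diff_divide_distrib[symmetric] abs_divide divide_right_mono)
  qed (use assms in auto)
  then show ?thesis by (simp add: ac_simps)
qed

lemma card_grid_clustered_le:
  assumes "0 < N" "0 \<le> \<delta>" and T: "T \<subseteq> grid N"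
    and clustered: "\<And>x y. x \<in> T \<Longrightarrow> y \<in> T \<Longrightarrow> near_int \<delta> (x - y)"
  shows "real (card T) \<le> 3 * (2 * real N * \<delta> + 1)"
proof (cases "1/2 \<le> \<delta>")
  case True
  then have "real N * (1/2) \<le> real N * \<delta>" by (intro mult_left_mono) auto
  moreover have "card T \<le> N"
    using card_mono[OF finite_grid T] card_grid_le[of N] by linarith
  ultimately show ?thesis by simp
next
  case False
  show ?thesis
  proof (cases "T = {}")
    case True
    then show ?thesis using assms(2) by simp
  next
    case nonempty: False
    then obtain x\<^sub>0 where "x\<^sub>0 \<in> T" by blast
    define near where "near m = T \<inter> {x\<^sub>0 + of_int m - \<delta>..x\<^sub>0 + of_int m + \<delta>}" for m :: int
    have "T \<subseteq> (\<Union>m\<in>{-1, 0, 1}. near m)"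
    proof
      fix x assume "x \<in> T"
      then obtain m where m: "\<bar>x - x\<^sub>0 - of_int m\<bar> \<le> \<delta>"
        using clustered \<open>x\<^sub>0 \<in> T\<close> by (meson near_intE)
      have "\<bar>x - x\<^sub>0\<bar> < 1"
        using grid_bounds[of x N] grid_bounds[of x\<^sub>0 N] \<open>x \<in> T\<close> \<open>x\<^sub>0 \<in> T\<close> T by force
      then have "\<bar>real_of_int m\<bar> < 2" using m False by linarith
      then have "m \<in> {-1, 0, 1}" by auto
      moreover have "x \<in> near m" using \<open>x \<in> T\<close> m unfolding near_def by (auto simp: abs_le_iff)
      ultimately show "x \<in> (\<Union>m\<in>{-1, 0, 1}. near m)" by blast
    qed
    then have "real (card T) \<le> real (card (\<Union>m\<in>{-1, 0, 1}. near m))"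
      using finite_subset[OF T finite_grid] by (intro of_nat_mono card_mono) (auto simp: near_def)
    also have "\<dots> \<le> real (card {-1, 0, 1 :: int}) * (2 * real N * \<delta> + 1)"
      using assms by (intro real_card_UN_le card_grid_interval_le) (auto simp: near_def)
    finally show ?thesis by simp
  qed
qed

lemma div_gcd_dvd_of_dvd_mult:
  fixes q r m :: int
  assumes "q \<noteq> 0" "q dvd r * m"
  shows "q div gcd r q dvd m"
proof -
  let ?d = "gcd r q"
  have factors: "?d * (q div ?d) = q" "?d * (r div ?d) = r" by auto
  have "?d * (q div ?d) dvd ?d * (r div ?d * m)"
    using assms(2) unfolding factors(1) mult.assoc[symmetric] factors(2) .
  then have "q div ?d dvd r div ?d * m"
    using assms(1) by (subst (asm) dvd_mult_cancel_left) auto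
  moreover have "coprime (q div ?d) (r div ?d)"
    using div_gcd_coprime[of r q] assms(1) by (simp add: coprime_commute)
  ultimately show ?thesis by (simp add: coprime_dvd_mult_right_iff)
qed

lemma gcd_dvd_of_dvd_linear:
  fixes p q r x y :: int
  assumes "coprime p r" "q dvd p * x + r * y"
  shows "gcd r q dvd x"
proof -
  have "gcd r q dvd p * x"
    using assms(2) by (meson dvd_add_left_iff dvd_mult2 dvd_trans gcd_dvd1 gcd_dvd2)
  moreover have "coprime (gcd r q) p"
    using assms(1) by (metis coprime_commute coprime_divisors dvd_refl gcd_dvd1)
  ultimately show ?thesis by (simp add: coprime_dvd_mult_right_iff)
qed

lemma card_linear_congruence_fibre_le:
  fixes p r :: int and q n x :: nat
  assumes "0 < q"
  shows "real (card {y. y \<le> n \<and> int q dvd p * int x + r * int y})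
      \<le> real n / real (q div nat (gcd r (int q))) + 1"
proof (rule card_congruent_le)
  have "nat (gcd r (int q)) dvd q" by (simp add: nat_dvd_iff)
  then show "0 < q div nat (gcd r (int q))"
    using assms by (metis div_greater_zero_iff dvd_imp_le dvd_pos_nat)
next
  fix y z
  assume "y \<in> {y. y \<le> n \<and> int q dvd p * int x + r * int y}"
    "z \<in> {y. y \<le> n \<and> int q dvd p * int x + r * int y}"
  then have "int q dvd (p * int x + r * int y) - (p * int x + r * int z)" by (intro dvd_diff) auto
  then have "int q dvd r * (int y - int z)" by (simp add: algebra_simps)
  then show "int (q div nat (gcd r (int q))) dvd int y - int z"
    using div_gcd_dvd_of_dvd_mult[of "int q" r] assms by (simp add: zdiv_int)
qed auto

lemma card_linear_congruence_le:
  fixes p r :: int and q n :: nat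
  assumes "coprime p r" "0 < q" "q \<le> n"
  shows "real (card {(x, y). x \<le> n \<and> y \<le> n \<and> int q dvd p * int x + r * int y})
      \<le> 4 * (real n)\<^sup>2 / real q"
proof -
  define d where "d = nat (gcd r (int q))"
  define e where "e = q div d"
  have d: "int d = gcd r (int q)" "0 < d" using assms(2) by (auto simp: d_def)
  then have "d dvd q" by (metis gcd_dvd2 of_nat_dvd_iff)
  then have q: "q = d * e" by (simp add: e_def)
  then have "0 < e" using assms(2) by (cases e) auto
  have de_le: "d \<le> n" "e \<le> n" using q d \<open>0 < e\<close> assms(3)
    by (metis le_trans mult_le_mono1 mult_1 Suc_leI One_nat_def mult.commute)+
  define xs where "xs = {x. x \<le> n \<and> d dvd x}"
  define ys where "ys x = {y. y \<le> n \<and> int q dvd p * int x + r * int y}" for x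
  have "{(x, y). x \<le> n \<and> y \<le> n \<and> int q dvd p * int x + r * int y} \<subseteq> (SIGMA x:xs. ys x)"
  proof safe
    fix x y assume xy: "x \<le> n" "y \<le> n" "int q dvd p * int x + r * int y"
    have "int d dvd int x" unfolding d(1) by (rule gcd_dvd_of_dvd_linear[OF assms(1) xy(3)])
    then show "x \<in> xs" using xy by (simp add: xs_def)
    show "y \<in> ys x" using xy by (simp add: ys_def)
  qed
  then have "card {(x, y). x \<le> n \<and> y \<le> n \<and> int q dvd p * int x + r * int y}
      \<le> card (SIGMA x:xs. ys x)"
    by (intro card_mono) (auto simp: xs_def ys_def)
  also have "\<dots> = (\<Sum>x\<in>xs. card (ys x))" by (simp add: xs_def ys_def)
  finally have "real (card {(x, y). x \<le> n \<and> y \<le> n \<and> int q dvd p * int x + r * int y})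
      \<le> (\<Sum>x\<in>xs. real (card (ys x)))" unfolding of_nat_sum[symmetric] of_nat_le_iff .
  also have "\<dots> \<le> (\<Sum>x\<in>xs. real n / real e + 1)"
    unfolding ys_def e_def d_def by (intro sum_mono card_linear_congruence_fibre_le assms(2))
  also have "\<dots> = real (card xs) * (real n / real e + 1)" by simp
  also have "\<dots> \<le> (real n / real d + 1) * (real n / real e + 1)"
    by (intro mult_right_mono card_congruent_le[OF d(2)]) (auto simp: xs_def intro!: dvd_diff)
  also have "\<dots> \<le> (2 * (real n / real d)) * (2 * (real n / real e))"
    using de_le d(2) \<open>0 < e\<close> by (intro mult_mono) (auto simp: field_simps)
  also have "\<dots> = 4 * (real n)\<^sup>2 / real q" by (simp add: q power2_eq_square)
  finally show ?thesis .
qed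

lemma card_int_le_blocks:
  fixes S :: "int set" and q :: int and Y c :: real
  assumes "0 < q" "0 \<le> Y" "0 \<le> c" and bounded: "\<And>D. D \<in> S \<Longrightarrow> \<bar>real_of_int D\<bar> \<le> Y"
    and block: "\<And>b. real (card {D \<in> S. D div q = b}) \<le> c"
  shows "real (card S) \<le> (2 * Y / q + 2) * c"
proof -
  define blocks where "blocks = {\<lfloor>- Y / q\<rfloor>..\<lfloor>Y / q\<rfloor>}"
  have "S \<subseteq> {-\<lceil>Y\<rceil>..\<lceil>Y\<rceil>}"
  proof
    fix D assume "D \<in> S"
    then show "D \<in> {-\<lceil>Y\<rceil>..\<lceil>Y\<rceil>}" using bounded[of D] by simp linarith
  qed
  then have "finite S" by (rule finite_subset) simp
  have "S \<subseteq> (\<Union>b\<in>blocks. {D \<in> S. D div q = b})"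
  proof
    fix D assume "D \<in> S"
    then have "- Y \<le> D" "D \<le> Y" using bounded[of D] by (auto simp: abs_le_iff)
    then have "- Y / q \<le> real_of_int D / q" "real_of_int D / q \<le> Y / q"
      using assms(1) by (intro divide_right_mono; simp)+
    then have "D div q \<in> blocks"
      unfolding blocks_def floor_divide_of_int_eq[symmetric, where 'a = real]
      by (auto intro: floor_mono)
    then show "D \<in> (\<Union>b\<in>blocks. {D \<in> S. D div q = b})" using \<open>D \<in> S\<close> by auto
  qed
  then have "real (card S) \<le> real (card (\<Union>b\<in>blocks. {D \<in> S. D div q = b}))"
    using \<open>finite S\<close> by (intro of_nat_mono card_mono) (auto simp: blocks_def)
  also have "\<dots> \<le> real (card blocks) * c"
    by (intro real_card_UN_le block) (simp add: blocks_def)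
  also have "real (card blocks) \<le> 2 * Y / q + 2"
  proof -
    have "0 \<le> Y / q" using assms by simp
    then have "real (card blocks) = real_of_int (\<lfloor>Y / q\<rfloor> - \<lfloor>- Y / q\<rfloor> + 1)"
      unfolding blocks_def by simp linarith
    also have "\<dots> \<le> 2 * Y / q + 2" by simp linarith
    finally show ?thesis .
  qed
  finally show ?thesis using assms(3) by (simp add: mult_right_mono)
qed

lemma abs_residue_approx_le:
  fixes a b m q t :: int and \<theta> \<epsilon> :: real
  assumes "0 < q" "0 \<le> t" "t < q" "\<bar>\<theta> - a / q\<bar> \<le> 1 / (real_of_int q)\<^sup>2"
    and near: "\<bar>\<theta> * real_of_int (b * q + t) - m\<bar> \<le> \<epsilon>"
  shows "\<bar>real_of_int (m * q - t * a) - \<theta> * (b * q) * q\<bar> \<le> \<epsilon> * q + 1"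
proof -
  have "\<bar>q * (\<theta> * real_of_int (b * q + t) - m)\<bar> \<le> q * \<epsilon>"
    using near assms(1) by (simp add: abs_mult)
  moreover have "\<bar>q * (t * (\<theta> - a / q))\<bar> \<le> 1"
  proof -
    have "\<bar>q * (t * (\<theta> - a / q))\<bar> = q * (t * \<bar>\<theta> - a / q\<bar>)"
      using assms by (simp add: abs_mult)
    also have "\<dots> \<le> q * (q * (1 / (real_of_int q)\<^sup>2))"
      using assms by (intro mult_left_mono mult_mono) auto
    also have "\<dots> = 1" using assms(1) by (simp add: power2_eq_square)
    finally show ?thesis .
  qed
  moreover have "real_of_int (m * q - t * a) - \<theta> * (b * q) * q
      = - (q * (\<theta> * real_of_int (b * q + t) - m)) + q * (t * (\<theta> - a / q))"
    using assms(1) by (simp add: field_simps)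
  ultimately show ?thesis by (simp add: mult.commute)
qed

lemma card_near_int_multiples_block_le:
  fixes a q :: int and \<theta> \<epsilon> :: real and S :: "int set"
  assumes "coprime a q" "0 < q" "\<bar>\<theta> - a / q\<bar> \<le> 1 / (real_of_int q)\<^sup>2" "0 \<le> \<epsilon>"
    and S: "\<And>D. D \<in> S \<Longrightarrow> D div q = b \<and> near_int \<epsilon> (\<theta> * D)"
  shows "real (card S) \<le> 2 * \<epsilon> * q + 3"
proof -
  have "\<exists>m::int. \<bar>\<theta> * real_of_int D - m\<bar> \<le> \<epsilon>" if "D \<in> S" for D
    using S[OF that] by (auto simp: near_int_def)
  then obtain m :: "int \<Rightarrow> int" where m: "\<And>D. D \<in> S \<Longrightarrow> \<bar>\<theta> * real_of_int D - m D\<bar> \<le> \<epsilon>" by metis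
  have div_mod: "D = b * q + D mod q" if "D \<in> S" for D
    using S[OF that] div_mult_mod_eq[of D q] by simp
  define i where "i D = real_of_int (m D * q - (D mod q) * a)" for D
  have window: "\<bar>i D - \<theta> * (b * q) * q\<bar> \<le> \<epsilon> * q + 1" if "D \<in> S" for D
    unfolding i_def using assms(2,3) m[OF that] div_mod[OF that]
    by (intro abs_residue_approx_le) auto
  have "real (card (i ` S)) \<le> 2 * (\<epsilon> * q + 1) / 1 + 1"
  proof (rule card_separated_le[where l = "\<theta> * (b * q) * q - (\<epsilon> * q + 1)"])
    show "i ` S \<subseteq> {\<theta> * (b * q) * q - (\<epsilon> * q + 1)..\<theta> * (b * q) * q - (\<epsilon> * q + 1) + 2 * (\<epsilon> * q + 1)}"
    proof (rule image_subsetI)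
      fix D assume "D \<in> S"
      then show "i D \<in> {\<theta> * (b * q) * q - (\<epsilon> * q + 1)..\<theta> * (b * q) * q - (\<epsilon> * q + 1)
          + 2 * (\<epsilon> * q + 1)}"
        using window[of D] by (simp add: abs_le_iff)
    qed
    fix x y assume "x \<in> i ` S" "y \<in> i ` S" "x \<noteq> y"
    then obtain j j' :: int where "x = of_int j" "y = of_int j'" unfolding i_def by blast
    then show "1 \<le> \<bar>x - y\<bar>" using \<open>x \<noteq> y\<close> by simp
  qed (use assms in auto)
  moreover have "inj_on i S"
  proof (rule inj_onI)
    fix D D' assume D: "D \<in> S" "D' \<in> S" "i D = i D'"
    then have "m D * q - (D mod q) * a = m D' * q - (D' mod q) * a"
      unfolding i_def by (simp only: of_int_eq_iff)
    then have "(D mod q - D' mod q) * a = (m D - m D') * q" by (simp add: algebra_simps)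
    then have "q dvd (D mod q - D' mod q) * a" by simp
    then have "q dvd D mod q - D' mod q"
      using assms(1) by (simp add: coprime_dvd_mult_left_iff coprime_commute)
    then have "D mod q = D' mod q" by (simp add: mod_eq_dvd_iff[symmetric])
    then show "D = D'" using div_mod D(1,2) by metis
  qed
  ultimately show ?thesis by (simp add: card_image)
qed

lemma card_near_int_multiples_le:
  fixes a q :: int and \<theta> \<epsilon> Y :: real
  assumes "coprime a q" "0 < q" "\<bar>\<theta> - a / q\<bar> \<le> 1 / (real_of_int q)\<^sup>2" "0 \<le> \<epsilon>" "0 \<le> Y"
  shows "real (card {D::int. \<bar>real_of_int D\<bar> \<le> Y \<and> near_int \<epsilon> (\<theta> * D)})
     \<le> (2 * Y / q + 2) * (2 * \<epsilon> * q + 3)"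
  using assms by (intro card_int_le_blocks card_near_int_multiples_block_le) auto

subsection \<open>Coincidences modulo 1\<close>

lemma dvd_of_dvd_coprime_multiples:
  fixes q m x y :: int
  assumes "coprime x y" "q dvd m * x" "q dvd m * y"
  shows "q dvd m"
proof -
  have "q dvd gcd (m * x) (m * y)" using assms by simp
  also have "gcd (m * x) (m * y) = \<bar>m\<bar> * gcd x y" by (simp add: gcd_mult_distrib_int)
  also have "gcd x y = 1" using assms(1) by simp
  finally show ?thesis by simp
qed

lemma denominator_dvd:
  fixes a a' q q' x y x' y' n\<^sub>1 n\<^sub>2 :: int
  assumes "coprime a q" "coprime x y"
    and "a * x * q' - a' * x' * q = n\<^sub>1 * (q * q')" "a * y * q' - a' * y' * q = n\<^sub>2 * (q * q')"
  shows "q dvd q'"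
proof -
  have "q dvd q' * a"
  proof (rule dvd_of_dvd_coprime_multiples[OF assms(2)])
    have "q' * a * x = q * (a' * x' + n\<^sub>1 * q')" "q' * a * y = q * (a' * y' + n\<^sub>2 * q')"
      using assms(3,4) by (simp_all add: algebra_simps)
    then show "q dvd q' * a * x" "q dvd q' * a * y" by simp_all
  qed
  then show ?thesis using assms(1) by (simp add: coprime_dvd_mult_left_iff coprime_commute)
qed

lemma near_int_rational_diffE:
  fixes a a' q q' :: int and \<kappa> \<beta> \<beta>' b Y :: real and u u' :: nat
  assumes near: "near_int \<kappa> ((a / q + \<beta>) * real u - (a' / q' + \<beta>') * real u')"
    and "0 < q" "0 < q'" "\<bar>\<beta>\<bar> \<le> b" "\<bar>\<beta>'\<bar> \<le> b" "real u \<le> Y" "real u' \<le> Y"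
    and small: "\<kappa> + 2 * b * Y < 1 / (real_of_int q * real_of_int q')"
  obtains n :: int where "a * int u * q' - a' * int u' * q = n * (q * q')" "\<bar>\<beta> * u - \<beta>' * u'\<bar> \<le> \<kappa>"
proof -
  obtain n :: int where n: "\<bar>(a / q + \<beta>) * real u - (a' / q' + \<beta>') * real u' - n\<bar> \<le> \<kappa>"
    using near by (rule near_intE)
  define z where "z = a * int u * q' - a' * int u' * q - n * (q * q')"
  have split: "(a / q + \<beta>) * real u - (a' / q' + \<beta>') * real u' - n
      = z / (q * q') + (\<beta> * u - \<beta>' * u')"
    using assms(2,3) by (simp add: z_def field_simps)
  have "\<bar>\<beta> * u\<bar> \<le> b * Y" "\<bar>\<beta>' * u'\<bar> \<le> b * Y"
    using assms by (auto simp: abs_mult intro!: mult_mono)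
  then have "\<bar>real_of_int z / (q * q')\<bar> < 1 / (real_of_int q * real_of_int q')"
    using n small unfolding split by linarith
  then have "\<bar>real_of_int z\<bar> < 1" using assms(2,3) by (simp add: abs_mult field_simps)
  then have "z = 0" by linarith
  then show thesis using n unfolding split by (intro that[of n]) (auto simp: z_def)
qed

lemma near_vec_exactE:
  fixes a a' q q' :: int and \<kappa> \<beta> \<beta>' b Y :: real
  assumes near: "near_vec \<kappa> (a / q + \<beta>) w (a' / q' + \<beta>') w'"
    and coprime: "coprime a q" "coprime a' q'" and pos: "0 < q" "0 < q'"
    and \<beta>: "\<bar>\<beta>\<bar> \<le> b" "\<bar>\<beta>'\<bar> \<le> b" and nz: "0 \<notin> set w" "0 \<notin> set w'"
    and Y: "real (cont w) \<le> Y" "real (cont w') \<le> Y"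
    and small: "\<kappa> + 2 * b * Y < 1 / (real_of_int q * real_of_int q')"
  obtains n\<^sub>1 n\<^sub>2 where "q = q'"
    "a * int (cont w) - a' * int (cont w') = n\<^sub>1 * q"
    "a * int (cont_tl w) - a' * int (cont_tl w') = n\<^sub>2 * q"
    "\<bar>\<beta> * cont w - \<beta>' * cont w'\<bar> \<le> \<kappa>" "\<bar>\<beta> * cont_tl w - \<beta>' * cont_tl w'\<bar> \<le> \<kappa>"
proof -
  have Y_tl: "real (cont_tl w) \<le> Y" "real (cont_tl w') \<le> Y"
    using Y cont_tl_le nz by (meson of_nat_le_iff order_trans)+
  obtain n\<^sub>1 where n\<^sub>1: "a * int (cont w) * q' - a' * int (cont w') * q = n\<^sub>1 * (q * q')"
      "\<bar>\<beta> * cont w - \<beta>' * cont w'\<bar> \<le> \<kappa>"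
    using near_int_rational_diffE[OF _ pos \<beta> Y small] near unfolding near_vec_def by blast
  obtain n\<^sub>2 where n\<^sub>2: "a * int (cont_tl w) * q' - a' * int (cont_tl w') * q = n\<^sub>2 * (q * q')"
      "\<bar>\<beta> * cont_tl w - \<beta>' * cont_tl w'\<bar> \<le> \<kappa>"
    using near_int_rational_diffE[OF _ pos \<beta> Y_tl small] near unfolding near_vec_def by blast
  have coprime_vec: "coprime (int (cont u)) (int (cont_tl u))" for u using coprime_cont by simp
  have "q dvd q'" by (rule denominator_dvd[OF coprime(1) coprime_vec n\<^sub>1(1) n\<^sub>2(1)])
  moreover have "q' dvd q"
    by (rule denominator_dvd[OF coprime(2) coprime_vec[of w'], of q a "int (cont w)" "- n\<^sub>1"
        "int (cont_tl w)" "- n\<^sub>2"])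
      (use n\<^sub>1(1) n\<^sub>2(1) in \<open>simp_all add: algebra_simps\<close>)
  ultimately have "q = q'" using pos zdvd_antisym_nonneg[of q q'] by simp
  then have "(a * int (cont w) - a' * int (cont w')) * q = (n\<^sub>1 * q) * q"
    "(a * int (cont_tl w) - a' * int (cont_tl w')) * q = (n\<^sub>2 * q) * q"
    using n\<^sub>1(1) n\<^sub>2(1) by (simp_all add: algebra_simps)
  then have "a * int (cont w) - a' * int (cont w') = n\<^sub>1 * q"
    "a * int (cont_tl w) - a' * int (cont_tl w') = n\<^sub>2 * q" using pos(1) by simp_all
  then show thesis using that \<open>q = q'\<close> n\<^sub>1(2) n\<^sub>2(2) by blast
qed

lemma dvd_cross:
  fixes a a' n\<^sub>1 n\<^sub>2 q :: int
  assumes "coprime a q"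
    and "a * int (cont w) - a' * int (cont w') = n\<^sub>1 * q"
      "a * int (cont_tl w) - a' * int (cont_tl w') = n\<^sub>2 * q"
  shows "q dvd cross w w'"
proof -
  have scaled: "a * int (cont w) = a' * int (cont w') + n\<^sub>1 * q"
    "a * int (cont_tl w) = a' * int (cont_tl w') + n\<^sub>2 * q" using assms(2,3) by simp_all
  have "a * cross w w'
      = (a * int (cont w)) * int (cont_tl w') - (a * int (cont_tl w)) * int (cont w')"
    by (simp add: cross_def algebra_simps)
  also have "\<dots> = (n\<^sub>1 * int (cont_tl w') - n\<^sub>2 * int (cont w')) * q"
    unfolding scaled by (simp add: algebra_simps)
  finally have "q dvd a * cross w w'" by simp
  then show ?thesis using assms(1) by (simp add: coprime_dvd_mult_right_iff coprime_commute)
qed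

lemma near_vec_diff_near_int:
  assumes near: "near_vec \<kappa> \<theta> w \<theta>' w'" "near_vec \<kappa> \<theta> w \<theta>'' w'"
    and nz: "0 \<notin> set w'" and small: "8 * \<kappa> * real (cont w') < 1"
  shows "near_int (2 * \<kappa> / real (cont w')) (\<theta>' - \<theta>'')"
proof -
  define \<tau> where "\<tau> = \<theta>' - \<theta>''"
  let ?v = "cont w'" and ?u = "cont_tl w'"
  have "near_int (2 * \<kappa>) (\<theta>' * ?v - \<theta>'' * ?v)" "near_int (2 * \<kappa>) (\<theta>' * ?u - \<theta>'' * ?u)"
    using near unfolding near_vec_def by (blast intro: near_int_diff)+
  then obtain m\<^sub>1 m\<^sub>2 where m: "\<bar>\<tau> * ?v - of_int m\<^sub>1\<bar> \<le> 2 * \<kappa>" "\<bar>\<tau> * ?u - of_int m\<^sub>2\<bar> \<le> 2 * \<kappa>"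
    unfolding \<tau>_def left_diff_distrib by (meson near_intE)
  have v: "0 < ?v" "?u \<le> ?v" using cont_pos cont_tl_le nz by auto
  have "0 \<le> \<kappa>" using m(1) by linarith
  have "real_of_int (m\<^sub>1 * ?u - m\<^sub>2 * ?v) = ?v * (\<tau> * ?u - m\<^sub>2) - ?u * (\<tau> * ?v - m\<^sub>1)"
    by (simp add: algebra_simps)
  also have "\<bar>\<dots>\<bar> \<le> \<bar>?v * (\<tau> * ?u - m\<^sub>2)\<bar> + \<bar>?u * (\<tau> * ?v - m\<^sub>1)\<bar>" by (rule abs_triangle_ineq4)
  also have "\<dots> \<le> ?v * (2 * \<kappa>) + ?v * (2 * \<kappa>)"
    using m v by (intro add_mono) (auto simp: abs_mult intro!: mult_mono)
  also have "\<dots> < 1" using small \<open>0 \<le> \<kappa>\<close> v by (simp add: algebra_simps)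
  finally have "\<bar>real_of_int (m\<^sub>1 * ?u - m\<^sub>2 * ?v)\<bar> < 1" by simp
  then have "m\<^sub>1 * int ?u = m\<^sub>2 * int ?v" by linarith
  then have "int ?v dvd m\<^sub>1 * int ?u" by simp
  then have "int ?v dvd m\<^sub>1" using coprime_cont[of w'] by (simp add: coprime_dvd_mult_left_iff)
  then obtain m where "m\<^sub>1 = int ?v * m" by (auto simp: dvd_def)
  then have "\<bar>?v * (\<tau> - m)\<bar> \<le> 2 * \<kappa>" using m(1) by (simp add: algebra_simps)
  then have "\<bar>\<tau> - m\<bar> \<le> 2 * \<kappa> / ?v" using v by (simp add: abs_mult pos_le_divide_eq mult.commute)
  then show ?thesis unfolding \<tau>_def by (rule near_intI)
qed

lemma near_pairs_le:
  assumes "finite V" "0 \<le> T"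
    and fibre: "\<And>w w'. w \<in> V \<Longrightarrow> w' \<in> V \<Longrightarrow> real (card {\<theta>'\<in>\<Theta>. near_vec \<kappa> \<theta> w \<theta>' w'}) \<le> T"
    and partner: "\<And>w w' \<theta>'. w \<in> V \<Longrightarrow> w' \<in> V \<Longrightarrow> \<theta>' \<in> \<Theta> \<Longrightarrow> near_vec \<kappa> \<theta> w \<theta>' w' \<Longrightarrow> w' \<in> P w"
    and partners: "\<And>w. w \<in> V \<Longrightarrow> finite (P w)" "\<And>w. w \<in> V \<Longrightarrow> real (card (P w)) \<le> n"
  shows "near_pairs \<kappa> \<Theta> V \<theta> \<le> real (card V) * (n * T)"
proof -
  let ?fibre = "\<lambda>w w'. {\<theta>'\<in>\<Theta>. near_vec \<kappa> \<theta> w \<theta>' w'}"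
  have "(\<Sum>w'\<in>V. real (card (?fibre w w'))) \<le> n * T" if w: "w \<in> V" for w
  proof -
    have "(\<Sum>w'\<in>V. real (card (?fibre w w'))) = (\<Sum>w'\<in>V \<inter> P w. real (card (?fibre w w')))"
    proof (rule sum.mono_neutral_right[OF assms(1)])
      show "\<forall>w'\<in>V - V \<inter> P w. real (card (?fibre w w')) = 0"
      proof
        fix w' assume "w' \<in> V - V \<inter> P w"
        then have "?fibre w w' = {}" using partner[OF w] by blast
        then show "real (card (?fibre w w')) = 0" by (simp only: card.empty of_nat_0)
      qed
    qed blast
    also have "\<dots> \<le> real (card (V \<inter> P w)) * T"
      using fibre[OF w] by (intro sum_bounded_above) auto
    also have "\<dots> \<le> real (card (P w)) * T"
      using assms(2) partners(1)[OF w] by (intro mult_right_mono of_nat_mono card_mono) auto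
    also have "\<dots> \<le> n * T" using partners(2)[OF w] assms(2) by (intro mult_right_mono)
    finally show ?thesis .
  qed
  then show ?thesis unfolding near_pairs_def by (intro sum_bounded_above) auto
qed

context alphabet
begin

lemma card_words_le_twice_card_image:
  assumes "S \<subseteq> words_upto X"
    and "\<And>v w. v \<in> S \<Longrightarrow> w \<in> S \<Longrightarrow> f v = f w \<Longrightarrow> cont_vec v = cont_vec w"
  shows "card S \<le> 2 * card (f ` S)"
proof (rule card_le_twice_card_image)
  show "finite S" using assms(1) finite_words_upto by (rule finite_subset)
  show "0 \<notin> set w" if "w \<in> S" for w
    using that assms(1) by (intro zero_notin_word)
      (auto simp: words_upto_def simp del: in_lists_conv_set)
qed (rule assms(2))

lemma card_words_near_le:
  assumes "1 \<le> D" "0 \<le> \<rho>"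
  shows "real (card {w \<in> words_upto D. \<bar>cfrac w - x\<bar> \<le> \<rho>}) \<le> 2 * (2 * \<rho> * D\<^sup>2 + 1)"
proof -
  let ?S = "{w \<in> words_upto D. \<bar>cfrac w - x\<bar> \<le> \<rho>}"
  have S: "0 \<notin> set w" "real (cont w) \<le> D" "0 < cont w" if "w \<in> ?S" for w
    using that zero_notin_word cont_pos by (auto simp: words_upto_def)
  have "card ?S \<le> 2 * card (cfrac ` ?S)"
  proof (rule card_words_le_twice_card_image)
    show "cont_vec v = cont_vec w" if "v \<in> ?S" "w \<in> ?S" "cfrac v = cfrac w" for v w
      using that(3) unfolding cfrac_eq_iff[OF S(1)[OF that(1)] S(1)[OF that(2)]] .
  qed auto
  moreover have "real (card (cfrac ` ?S)) \<le> 2 * \<rho> / (1 / D\<^sup>2) + 1"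
  proof (rule card_separated_le[where l = "x - \<rho>"])
    fix y z assume "y \<in> cfrac ` ?S" "z \<in> cfrac ` ?S" "y \<noteq> z"
    then obtain v w where vw: "v \<in> ?S" "w \<in> ?S" "y = cfrac v" "z = cfrac w" by blast
    have "real (cont v) * cont w \<le> D\<^sup>2" unfolding power2_eq_square
      using S(2)[OF vw(1)] S(2)[OF vw(2)] assms by (intro mult_mono) auto
    then have "1 / D\<^sup>2 \<le> 1 / (real (cont v) * cont w)"
      using S(3)[OF vw(1)] S(3)[OF vw(2)] assms by (intro divide_left_mono) auto
    also have "\<dots> \<le> \<bar>y - z\<bar>"
      using \<open>y \<noteq> z\<close> unfolding vw(3,4) by (intro cfrac_separated S(1) vw)
    finally show "1 / D\<^sup>2 \<le> \<bar>y - z\<bar>" .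
  qed (use assms in \<open>auto simp: abs_le_iff\<close>)
  ultimately show ?thesis by simp
qed

lemma card_words_cross_eq_le:
  assumes "0 \<notin> set v" "Y \<le> 2 * real (cont v)"
  shows "real (card {w \<in> words_upto Y. cross v w = D}) \<le> 6"
proof -
  let ?S = "{w \<in> words_upto Y. cross v w = D}"
  have v: "0 < cont v" by (rule cont_pos[OF assms(1)])
  have "card ?S \<le> 2 * card (cont ` ?S)"
  proof (rule card_words_le_twice_card_image)
    show "cont_vec w = cont_vec w'" if "w \<in> ?S" "w' \<in> ?S" "cont w = cont w'" for w w'
    proof -
      have "int (cont v) * int (cont_tl w) = int (cont v) * int (cont_tl w')"
        using that by (auto simp: cross_def)
      then show ?thesis using v that(3) by (simp add: cont_vec_def)
    qed
  qed auto
  moreover have "real (card (cont ` ?S)) \<le> real (2 * cont v) / real (cont v) + 1"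
  proof (rule card_congruent_le[OF v])
    show "cont ` ?S \<subseteq> {..2 * cont v}"
    proof (rule image_subsetI)
      fix w assume "w \<in> ?S"
      then have "real (cont w) \<le> real (2 * cont v)" using assms(2) by (simp add: words_upto_def)
      then show "cont w \<in> {..2 * cont v}" by (simp only: of_nat_le_iff atMost_iff)
    qed
    fix x y assume "x \<in> cont ` ?S" "y \<in> cont ` ?S"
    then obtain w w' where w: "x = cont w" "y = cont w'" "cross v w = cross v w'" by auto
    then have "int (cont_tl v) * (int x - int y)
        = int (cont v) * (int (cont_tl w) - int (cont_tl w'))"
      by (simp add: cross_def algebra_simps)
    then have "int (cont v) dvd int (cont_tl v) * (int x - int y)" by simp
    then show "int (cont v) dvd int x - int y"
      using coprime_cont[of v] by (simp add: coprime_dvd_mult_right_iff)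
  qed
  ultimately show ?thesis using v by simp
qed

subsection \<open>Words in a residue class and a direction\<close>

definition class_const :: real where
  "class_const = (4 * step_ratio\<^sup>2 + 2) * (16 * step_ratio\<^sup>2)"

lemma class_const_pos: "0 < class_const"
  using step_ratio_ge_2 by (simp add: class_const_def add_nonneg_pos)

lemma dyadic_word_splitE:
  assumes w: "w \<in> dyadic_words X" and G: "1 \<le> G" and Q: "1 \<le> Q" and X: "2 * step_ratio * G * Q \<le> X"
  obtains x y z
    where "w = x @ y @ z" "x \<in> lists A" "G \<le> real (cont x)" "real (cont x) \<le> step_ratio * G"
    "y \<in> words_upto (2 * X / (G * Q))" "z \<in> words_upto (step_ratio * Q)"
proof -
  note w_bounds = dyadic_wordsD[OF w]
  have "1 * 1 \<le> G * Q" using G Q by (intro mult_mono) auto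
  moreover have "G * 1 \<le> G * Q" using G Q by (intro mult_left_mono) auto
  moreover have "2 * (G * Q) \<le> step_ratio * (G * Q)"
    using step_ratio_ge_2 G Q by (intro mult_right_mono) auto
  moreover have "step_ratio * (G * Q) * 2 \<le> X" using X by (simp add: ac_simps)
  ultimately have GQ: "1 \<le> G * Q" and "G \<le> real (cont w)" using w_bounds(3) by linarith+
  from \<open>G \<le> real (cont w)\<close> obtain x v where xv: "w = x @ v" "x \<in> stop_words G" "v \<in> lists A"
    by (rule stop_prefixE[OF w_bounds(1)])
  note x_lists = stop_words_lists[OF xv(2)] and x_ge = stop_words_ge[OF xv(2)]
    and x_le = stop_words_le[OF xv(2) G]
  have "X \<le> real (cont w)" by (rule w_bounds(3))
  also have "\<dots> \<le> 2 * (real (cont x) * real (cont v))"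
    unfolding xv(1) by (intro cont_append_le zero_notin_word x_lists xv(3))
  also have "\<dots> \<le> 2 * ((step_ratio * G) * real (cont v))"
    using x_le by (intro mult_left_mono mult_right_mono) auto
  finally have "(step_ratio * G) * Q \<le> (step_ratio * G) * real (cont v)"
    using X by (simp add: algebra_simps)
  then have "Q \<le> real (cont v)" using step_ratio_ge_2 G by simp
  then obtain y z where yz: "v = y @ z" "y \<in> lists A" "z \<in> lists A" "Q \<le> real (cont z)"
      "real (cont z) \<le> step_ratio * Q"
    by (rule stop_suffixE[OF xv(3) _ Q])
  have "G * (real (cont y) * Q) \<le> real (cont x) * (real (cont y) * real (cont z))"
    using x_ge yz(4) G Q by (intro mult_mono mult_left_mono) auto
  also have "\<dots> \<le> real (cont x) * real (cont v)"
    unfolding yz(1) by (intro mult_left_mono cont_mult_le_cont_append) auto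
  also have "\<dots> \<le> real (cont w)" unfolding xv(1) by (rule cont_mult_le_cont_append)
  also have "\<dots> \<le> 2 * X" by (rule w_bounds(4))
  finally have "real (cont y) \<le> 2 * X / (G * Q)" using GQ by (simp add: pos_le_divide_eq ac_simps)
  then show thesis using that xv(1) yz x_lists x_ge x_le by (simp add: words_upto_def)
qed

lemma cross_append_linearE:
  assumes "0 \<notin> set v" "0 \<notin> set x"
  obtains p r :: int where "coprime p r"
    "\<And>z. cross v (x @ z) = p * int (cont z) + r * int (cont_tl z)"
proof -
  define p where "p = cross v x"
  define r where "r = int (cont v) * int (cont_mid x) - int (cont_tl v) * int (cont_bl x)"
  define e where "e = int (cont x) * int (cont_mid x) - int (cont_bl x) * int (cont_tl x)"
  have "is_unit e" unfolding e_def cont_det by simp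
  have "coprime p r"
  proof (rule coprimeI)
    fix c assume "c dvd p" "c dvd r"
    moreover have "r * int (cont x) - p * int (cont_bl x) = int (cont v) * e"
      "r * int (cont_tl x) - p * int (cont_mid x) = int (cont_tl v) * e"
      by (simp_all add: p_def r_def e_def cross_def algebra_simps)
    ultimately have "c dvd int (cont v) * e" "c dvd int (cont_tl v) * e"
      by (metis dvd_diff dvd_mult2)+
    then have "c dvd int (cont v)" "c dvd int (cont_tl v)"
      using \<open>is_unit e\<close> by (simp_all add: dvd_mult_unit_iff)
    then show "is_unit c"
      using coprime_cont[of v] coprime_common_divisor[of "int (cont v)" "int (cont_tl v)" c] by simp
  qed
  moreover have "cross v (x @ z) = p * int (cont z) + r * int (cont_tl z)" for z
    by (simp add: cross_def cont_append cont_tl_append p_def r_def algebra_simps)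
  ultimately show thesis using that by blast
qed

lemma card_suffixes_dvd_cross_le:
  fixes q :: nat
  assumes v: "0 \<notin> set v" and x: "x \<in> lists A" and Q: "1 \<le> Q" and q: "Q / 2 \<le> real q" "real q \<le> Q"
  shows "real (card {z \<in> words_upto (step_ratio * Q). int q dvd cross v (x @ z)})
      \<le> 16 * step_ratio\<^sup>2 * Q"
proof -
  let ?Z = "{z \<in> words_upto (step_ratio * Q). int q dvd cross v (x @ z)}"
  obtain p r where pr: "coprime p r" "\<And>z. cross v (x @ z) = p * int (cont z) + r * int (cont_tl z)"
    using cross_append_linearE[OF v zero_notin_word[OF x]] by blast
  define n where "n = nat \<lfloor>step_ratio * Q\<rfloor>"
  let ?T = "{(s, t). s \<le> n \<and> t \<le> n \<and> int q dvd p * int s + r * int t}"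
  have "1 * Q \<le> step_ratio * Q" using step_ratio_ge_2 Q by (intro mult_right_mono) auto
  then have "real q \<le> step_ratio * Q" using q by linarith
  then have n: "q \<le> n" "real n \<le> step_ratio * Q"
    unfolding n_def using \<open>1 * Q \<le> step_ratio * Q\<close> Q by (intro le_nat_floor of_nat_floor; simp)+
  have "cont_vec ` ?Z \<subseteq> ?T"
  proof (rule image_subsetI)
    fix z assume z: "z \<in> ?Z"
    then have "cont z \<le> n" by (simp add: n_def words_upto_def le_nat_floor)
    moreover have "cont_tl z \<le> cont z"
      using z cont_tl_le[OF zero_notin_word, of z] by (simp add: words_upto_def)
    ultimately show "cont_vec z \<in> ?T" using z by (simp add: cont_vec_def pr(2))
  qed
  then have "card (cont_vec ` ?Z) \<le> card ?T"
    by (intro card_mono finite_subset[of ?T "{..n} \<times> {..n}"]) auto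
  moreover have "card ?Z \<le> 2 * card (cont_vec ` ?Z)"
    by (rule card_words_le_twice_card_image) auto
  ultimately have "real (card ?Z) \<le> 2 * real (card ?T)" by linarith
  also have "real (card ?T) \<le> 4 * (real n)\<^sup>2 / real q"
    using q Q n(1) by (intro card_linear_congruence_le pr(1)) (auto simp: zero_less_iff_neq_zero)
  also have "\<dots> \<le> 4 * (step_ratio * Q)\<^sup>2 / (Q / 2)"
    using n(2) q Q by (intro frac_le mult_left_mono power_mono) auto
  also have "\<dots> = 8 * step_ratio\<^sup>2 * Q" using Q by (simp add: power2_eq_square)
  finally show ?thesis by simp
qed

lemma dyadic_word_split_nearE:
  assumes w: "w \<in> dyadic_words X" "\<bar>cfrac w - \<phi>\<bar> \<le> \<alpha>"
    and G: "1 \<le> G" and Q: "1 \<le> Q" and X: "2 * step_ratio * G * Q \<le> X"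
  obtains x y z
    where "w = x @ y @ z" "x \<in> words_upto (step_ratio * G)" "\<bar>cfrac x - \<phi>\<bar> \<le> \<alpha> + 1 / G\<^sup>2"
    "y \<in> words_upto (2 * X / (G * Q))" "z \<in> words_upto (step_ratio * Q)"
proof -
  obtain x y z
    where xyz: "w = x @ y @ z" "x \<in> lists A" "G \<le> real (cont x)" "real (cont x) \<le> step_ratio * G"
    "y \<in> words_upto (2 * X / (G * Q))" "z \<in> words_upto (step_ratio * Q)"
    by (rule dyadic_word_splitE[OF w(1) G Q X])
  have "\<bar>cfrac w - cfrac x\<bar> \<le> 1 / (real (cont x))\<^sup>2"
    unfolding xyz(1) using zero_notin_word xyz(2,5,6)
    by (intro abs_cfrac_append_diff_le) (auto simp: words_upto_def)
  also have "\<dots> \<le> 1 / G\<^sup>2" using G xyz(3) by (intro divide_left_mono power_mono mult_pos_pos) auto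
  finally have "\<bar>cfrac x - \<phi>\<bar> \<le> \<alpha> + 1 / G\<^sup>2" using w(2) by linarith
  then show thesis using that xyz by (simp add: words_upto_def)
qed

lemma card_prefixes_near_le:
  assumes "1 \<le> G" "0 \<le> \<alpha>"
  shows "real (card {x \<in> words_upto (step_ratio * G). \<bar>cfrac x - \<phi>\<bar> \<le> \<alpha> + 1 / G\<^sup>2})
      \<le> (4 * step_ratio\<^sup>2 + 2) * (1 + G\<^sup>2 * \<alpha>)"
proof -
  have "1 * 1 \<le> step_ratio * G" using step_ratio_ge_2 assms by (intro mult_mono) auto
  then have "real (card {x \<in> words_upto (step_ratio * G). \<bar>cfrac x - \<phi>\<bar> \<le> \<alpha> + 1 / G\<^sup>2})
      \<le> 2 * (2 * (\<alpha> + 1 / G\<^sup>2) * (step_ratio * G)\<^sup>2 + 1)"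
    using assms by (intro card_words_near_le) auto
  also have "2 * (\<alpha> + 1 / G\<^sup>2) * (step_ratio * G)\<^sup>2 = 2 * step_ratio\<^sup>2 * (1 + G\<^sup>2 * \<alpha>)"
    using assms by (simp add: power_mult_distrib field_simps)
  also have "2 * (2 * step_ratio\<^sup>2 * (1 + G\<^sup>2 * \<alpha>) + 1) \<le> (4 * step_ratio\<^sup>2 + 2) * (1 + G\<^sup>2 * \<alpha>)"
    using assms by (simp add: algebra_simps)
  finally show ?thesis .
qed

text \<open>A prefix of size \<open>G\<close> determines the direction, a suffix of size \<open>Q\<close> the residue class.\<close>

lemma card_words_class_le:
  fixes q :: nat
  assumes v: "0 \<notin> set v" and Q: "1 \<le> Q" and G: "1 \<le> G" and q: "Q / 2 \<le> real q" "real q \<le> Q"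
    and \<alpha>: "0 \<le> \<alpha>" and X: "2 * step_ratio * G * Q \<le> X"
  shows "real (card {w \<in> dyadic_words X. int q dvd cross v w \<and> \<bar>cfrac w - cfrac v\<bar> \<le> \<alpha>})
      \<le> class_const * (1 + G\<^sup>2 * \<alpha>) * word_count (2 * X / (G * Q)) * Q"
proof -
  let ?S = "{w \<in> dyadic_words X. int q dvd cross v w \<and> \<bar>cfrac w - cfrac v\<bar> \<le> \<alpha>}"
  define prefixes where
    "prefixes = {x \<in> words_upto (step_ratio * G). \<bar>cfrac x - cfrac v\<bar> \<le> \<alpha> + 1 / G\<^sup>2}"
  define middles where "middles = words_upto (2 * X / (G * Q))"
  define suffixes where "suffixes x = {z \<in> words_upto (step_ratio * Q). int q dvd cross v (x @ z)}"
    for x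
  define joined where "joined xy = (\<lambda>z. fst xy @ snd xy @ z) ` suffixes (fst xy @ snd xy)" for xy
  have fin: "finite prefixes" "finite middles" "finite (suffixes x)" for x
    using finite_words_upto by (auto simp: prefixes_def middles_def suffixes_def)
  have "?S \<subseteq> (\<Union>xy\<in>prefixes \<times> middles. joined xy)"
  proof
    fix w assume w: "w \<in> ?S"
    then have "w \<in> dyadic_words X" "\<bar>cfrac w - cfrac v\<bar> \<le> \<alpha>" by auto
    then obtain x y z
      where xyz: "w = x @ y @ z" "x \<in> prefixes" "y \<in> middles" "z \<in> words_upto (step_ratio * Q)"
      unfolding prefixes_def middles_def by (rule dyadic_word_split_nearE[OF _ _ G Q X]) simp
    then have "w \<in> joined (x, y)" using w by (simp add: joined_def suffixes_def)
    then show "w \<in> (\<Union>xy\<in>prefixes \<times> middles. joined xy)" using xyz(2,3) by blast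
  qed
  then have "real (card ?S) \<le> real (card (\<Union>xy\<in>prefixes \<times> middles. joined xy))"
    using fin by (intro of_nat_mono card_mono) (auto simp: joined_def)
  also have "\<dots> \<le> real (card (prefixes \<times> middles)) * (16 * step_ratio\<^sup>2 * Q)"
  proof (rule real_card_UN_le)
    fix xy assume "xy \<in> prefixes \<times> middles"
    then have "fst xy @ snd xy \<in> lists A" by (auto simp: prefixes_def middles_def words_upto_def)
    from card_suffixes_dvd_cross_le[OF v this Q q]
    have "real (card (suffixes (fst xy @ snd xy))) \<le> 16 * step_ratio\<^sup>2 * Q"
      by (simp add: suffixes_def)
    moreover have "card (joined xy) \<le> card (suffixes (fst xy @ snd xy))"
      unfolding joined_def by (rule card_image_le[OF fin(3)])
    ultimately show "real (card (joined xy)) \<le> 16 * step_ratio\<^sup>2 * Q" by linarith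
  qed (use fin in simp)
  also have "\<dots> = real (card prefixes) * (word_count (2 * X / (G * Q)) * (16 * step_ratio\<^sup>2 * Q))"
    by (simp add: card_cartesian_product middles_def word_count_def)
  also have "real (card prefixes) \<le> (4 * step_ratio\<^sup>2 + 2) * (1 + G\<^sup>2 * \<alpha>)"
    unfolding prefixes_def by (rule card_prefixes_near_le[OF G \<alpha>])
  finally show ?thesis
    using Q word_count_nonneg by (simp add: class_const_def mult_right_mono mult_ac)
qed

end

subsection \<open>Coincidences on the major arcs\<close>

text \<open>The grid points at distance about \<open>K / N\<close> from a fraction with denominator about \<open>Q\<close>; the case
  \<open>K = 1\<close> stands for all distances up to \<open>1 / N\<close>.\<close>

definition major_arcs :: "nat \<Rightarrow> real \<Rightarrow> real \<Rightarrow> real set" where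
  "major_arcs N Q K = {\<theta> \<in> grid N. \<exists>a q::int. coprime a q \<and> 0 < q \<and> Q / 2 \<le> q \<and> real_of_int q \<le> Q \<and>
     \<bar>\<theta> - a / q\<bar> \<le> K / N \<and> (K = 1 \<or> K / (2 * real N) \<le> \<bar>\<theta> - a / q\<bar>)}"

lemma major_arcs_subset_grid: "major_arcs N Q K \<subseteq> grid N"
  by (auto simp: major_arcs_def)

lemma major_arcsE:
  assumes "\<theta> \<in> major_arcs N Q K"
  obtains a q :: int where "coprime a q" "0 < q" "Q / 2 \<le> q" "real_of_int q \<le> Q"
    "\<bar>\<theta> - a / q\<bar> \<le> K / N" "K = 1 \<or> K / (2 * real N) \<le> \<bar>\<theta> - a / q\<bar>"
  using assms unfolding major_arcs_def by blast

lemma card_major_arcs_le: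
  assumes "0 < N" "1 \<le> Q" "1 \<le> K" "K \<le> real N"
  shows "real (card (major_arcs N Q K)) \<le> 12 * (Q\<^sup>2 * K)"
proof -
  define m where "m = \<lfloor>Q\<rfloor>"
  have m: "1 \<le> m" "real_of_int m \<le> Q" using assms(2) unfolding m_def by linarith+
  define fractions where "fractions = {1..m} \<times> {-m..2 * m}"
  define arc
    where "arc qa = {\<theta> \<in> grid N. \<bar>\<theta> - real_of_int (snd qa) / real_of_int (fst qa)\<bar> \<le> K / N}" for qa
  have "major_arcs N Q K \<subseteq> (\<Union>qa\<in>fractions. arc qa)"
  proof
    fix \<theta> assume \<theta>: "\<theta> \<in> major_arcs N Q K"
    then obtain a q :: int where aq: "0 < q" "q \<le> Q" "\<bar>\<theta> - a / q\<bar> \<le> K / N" by (rule major_arcsE)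
    have grid: "\<theta> \<in> grid N" using \<theta> major_arcs_subset_grid by blast
    have "K / N \<le> 1" using assms by simp
    then have "-1 \<le> a / q" "a / q \<le> 2" using grid_bounds[OF grid] aq(3) by linarith+
    then have "- real_of_int q \<le> a" "real_of_int a \<le> 2 * q"
      using aq(1) by (simp_all add: field_simps)
    then have "- q \<le> a" "a \<le> 2 * q" by linarith+
    moreover have "q \<le> m" using aq(2) unfolding m_def by linarith
    ultimately have "(q, a) \<in> fractions" using aq(1) by (auto simp: fractions_def)
    moreover have "\<theta> \<in> arc (q, a)" using aq grid by (simp add: arc_def)
    ultimately show "\<theta> \<in> (\<Union>qa\<in>fractions. arc qa)" by blast
  qed
  then have "real (card (major_arcs N Q K)) \<le> real (card (\<Union>qa\<in>fractions. arc qa))"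
    using finite_grid by (intro of_nat_mono card_mono) (auto simp: fractions_def arc_def)
  also have "\<dots> \<le> real (card fractions) * (3 * K)"
  proof (rule real_card_UN_le)
    fix qa :: "int \<times> int"
    have "real (card (arc qa)) \<le> 2 * real N * (K / N) + 1"
      using assms by (intro card_grid_interval_le[of _ _ _ "snd qa / fst qa"])
        (auto simp: arc_def abs_le_iff)
    then show "real (card (arc qa)) \<le> 3 * K" using assms by simp
  qed (simp add: fractions_def)
  also have "real (card fractions) = real_of_int m * real_of_int (3 * m + 1)"
    using m by (simp add: fractions_def card_cartesian_product)
  also have "\<dots> \<le> Q * (4 * Q)" using m assms by (intro mult_mono) auto
  finally show ?thesis using assms(3) by (simp add: power2_eq_square mult_right_mono mult_ac)
qed

lemma abs_cfrac_diff_le_of_parallel: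
  fixes \<beta> \<beta>' \<kappa> :: real
  assumes nz: "0 \<notin> set w" "0 \<notin> set w'"
    and parallel: "\<bar>\<beta> * cont w - \<beta>' * cont w'\<bar> \<le> \<kappa>" "\<bar>\<beta> * cont_tl w - \<beta>' * cont_tl w'\<bar> \<le> \<kappa>"
  shows "\<bar>\<beta>\<bar> * \<bar>cfrac w' - cfrac w\<bar> * real (cont w) \<le> 2 * \<kappa>"
proof -
  let ?v = "real (cont w)" and ?v' = "real (cont w')" and ?u = "real (cont_tl w)"
    and ?u' = "real (cont_tl w')"
  have "?u' \<le> ?v'" "0 < ?v'" using cont_tl_le cont_pos nz by auto
  have "\<beta> * ((cfrac w' - cfrac w) * (?v * ?v'))
      = (\<beta> * ?v - \<beta>' * ?v') * ?u' - (\<beta> * ?u - \<beta>' * ?u') * ?v'"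
    unfolding cross_eq_cfrac_diff[OF nz, symmetric] cross_def by (simp add: algebra_simps)
  also have "\<bar>\<dots>\<bar> \<le> \<bar>(\<beta> * ?v - \<beta>' * ?v') * ?u'\<bar> + \<bar>(\<beta> * ?u - \<beta>' * ?u') * ?v'\<bar>"
    by (rule abs_triangle_ineq4)
  also have "\<dots> \<le> \<kappa> * ?v' + \<kappa> * ?v'"
    using parallel \<open>?u' \<le> ?v'\<close> by (intro add_mono) (auto simp: abs_mult intro!: mult_mono)
  finally have "(\<bar>\<beta>\<bar> * \<bar>cfrac w' - cfrac w\<bar> * ?v) * ?v' \<le> (2 * \<kappa>) * ?v'"
    unfolding abs_mult by (simp add: mult.assoc)
  then show ?thesis using \<open>0 < ?v'\<close> by (simp only: mult_le_cancel_right_pos)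
qed

lemma near_int_of_exact:
  fixes a a\<^sub>1 a\<^sub>2 q :: int and c \<kappa> :: real
  assumes "0 < q" "0 \<notin> set w'"
    and first: "a * int (cont w) - a\<^sub>1 * int (cont w') = m\<^sub>1 * q"
      "a * int (cont_tl w) - a\<^sub>1 * int (cont_tl w') = m\<^sub>2 * q"
      "\<bar>c - (\<theta>\<^sub>1 - a\<^sub>1 / q) * cont w'\<bar> \<le> \<kappa>"
    and second: "a * int (cont w) - a\<^sub>2 * int (cont w') = n\<^sub>1 * q"
      "a * int (cont_tl w) - a\<^sub>2 * int (cont_tl w') = n\<^sub>2 * q"
      "\<bar>c - (\<theta>\<^sub>2 - a\<^sub>2 / q) * cont w'\<bar> \<le> \<kappa>"
  shows "near_int (2 * \<kappa> / cont w') (\<theta>\<^sub>1 - \<theta>\<^sub>2)"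
proof -
  have "q dvd a\<^sub>1 - a\<^sub>2"
  proof (rule dvd_of_dvd_coprime_multiples)
    show "coprime (int (cont w')) (int (cont_tl w'))" using coprime_cont by simp
    have "(a\<^sub>1 - a\<^sub>2) * int (cont w') = (n\<^sub>1 - m\<^sub>1) * q"
      "(a\<^sub>1 - a\<^sub>2) * int (cont_tl w') = (n\<^sub>2 - m\<^sub>2) * q"
      using first second by (simp_all add: algebra_simps)
    then show "q dvd (a\<^sub>1 - a\<^sub>2) * int (cont w')" "q dvd (a\<^sub>1 - a\<^sub>2) * int (cont_tl w')" by simp_all
  qed
  then obtain m where "a\<^sub>1 = a\<^sub>2 + q * m" by (metis dvd_def diff_add_cancel add.commute)
  then have shift: "real_of_int a\<^sub>1 / q = a\<^sub>2 / q + m" using assms(1) by (simp add: field_simps)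
  have "(\<theta>\<^sub>1 - \<theta>\<^sub>2 - m) * cont w' = (\<theta>\<^sub>1 - a\<^sub>1 / q) * cont w' - (\<theta>\<^sub>2 - a\<^sub>2 / q) * cont w'"
    unfolding shift by (simp add: algebra_simps)
  then have "\<bar>(\<theta>\<^sub>1 - \<theta>\<^sub>2 - m) * cont w'\<bar> \<le> 2 * \<kappa>" using first(3) second(3) by linarith
  then have "\<bar>\<theta>\<^sub>1 - \<theta>\<^sub>2 - m\<bar> \<le> 2 * \<kappa> / cont w'"
    using cont_pos[OF assms(2)] by (simp add: abs_mult pos_le_divide_eq)
  then show ?thesis by (rule near_intI)
qed

lemma card_grid_fibre_le:
  assumes "0 < N" "0 \<le> \<kappa>" "0 < X" "T \<subseteq> grid N" "X \<le> c"
    and clustered: "\<And>x y. x \<in> T \<Longrightarrow> y \<in> T \<Longrightarrow> near_int (2 * \<kappa> / c) (x - y)"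
  shows "real (card T) \<le> 12 * (1 + \<kappa> * N / X)"
proof -
  have "2 * \<kappa> / c \<le> 2 * \<kappa> / X" using assms by (intro divide_left_mono) auto
  then have "near_int (2 * \<kappa> / X) (x - y)" if "x \<in> T" "y \<in> T" for x y
    using clustered[OF that] near_int_mono by blast
  then have "real (card T) \<le> 3 * (2 * real N * (2 * \<kappa> / X) + 1)"
    using assms by (intro card_grid_clustered_le) auto
  also have "\<dots> \<le> 12 * (1 + \<kappa> * N / X)" by (simp add: mult.commute)
  finally show ?thesis .
qed

context alphabet
begin

lemma major_arcs_exactE:
  fixes a q :: int
  assumes "0 < N" "1 \<le> Q" and small: "\<kappa> + 4 * K * X / real N < 1 / Q\<^sup>2"
    and aq: "coprime a q" "0 < q" "real_of_int q \<le> Q" "\<bar>\<theta> - a / q\<bar> \<le> K / N"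
    and words: "w \<in> dyadic_words X" "w' \<in> dyadic_words X"
    and near: "near_vec \<kappa> \<theta> w \<theta>' w'" and \<theta>': "\<theta>' \<in> major_arcs N Q K"
  obtains a' n\<^sub>1 n\<^sub>2 :: int where
    "a * int (cont w) - a' * int (cont w') = n\<^sub>1 * q"
    "a * int (cont_tl w) - a' * int (cont_tl w') = n\<^sub>2 * q"
    "\<bar>(\<theta> - a / q) * cont w - (\<theta>' - a' / q) * cont w'\<bar> \<le> \<kappa>"
    "\<bar>(\<theta> - a / q) * cont_tl w - (\<theta>' - a' / q) * cont_tl w'\<bar> \<le> \<kappa>"
proof -
  obtain a' q' :: int where aq': "coprime a' q'" "0 < q'" "q' \<le> Q" "\<bar>\<theta>' - a' / q'\<bar> \<le> K / N"
    using \<theta>' by (rule major_arcsE)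
  have "q * real_of_int q' \<le> Q * Q" using aq aq' \<open>1 \<le> Q\<close> by (intro mult_mono) auto
  then have "1 / Q\<^sup>2 \<le> 1 / (q * real_of_int q')"
    using aq(2) aq'(2) \<open>1 \<le> Q\<close>
    by (intro divide_left_mono mult_pos_pos) (auto simp: power2_eq_square)
  then have small': "\<kappa> + 2 * (K / N) * (2 * X) < 1 / (q * real_of_int q')" using small by simp
  have near': "near_vec \<kappa> (a / q + (\<theta> - a / q)) w (a' / q' + (\<theta>' - a' / q')) w'" using near by simp
  show thesis
    using near_vec_exactE[OF near' aq(1) aq'(1) aq(2) aq'(2) aq(4) aq'(4)
        dyadic_wordsD(2)[OF words(1)] dyadic_wordsD(2)[OF words(2)]
        dyadic_wordsD(4)[OF words(1)] dyadic_wordsD(4)[OF words(2)] small']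
      that by metis
qed

lemma major_arcs_direction:
  fixes a q :: int and \<beta>' :: real
  assumes "0 < N" "1 \<le> K" "0 < X" "0 \<le> \<kappa>"
    and far: "K = 1 \<or> K / (2 * real N) \<le> \<bar>\<theta> - a / q\<bar>"
    and words: "w \<in> dyadic_words X" "w' \<in> dyadic_words X"
    and parallel: "\<bar>(\<theta> - a / q) * cont w - \<beta>' * cont w'\<bar> \<le> \<kappa>"
      "\<bar>(\<theta> - a / q) * cont_tl w - \<beta>' * cont_tl w'\<bar> \<le> \<kappa>"
  shows "\<bar>cfrac w' - cfrac w\<bar> \<le> 4 * (1 + \<kappa> * N / X) / K"
proof (cases "K = 1")
  case True
  note nz = dyadic_wordsD(2)[OF words(1)] dyadic_wordsD(2)[OF words(2)]
  have "\<bar>cfrac w' - cfrac w\<bar> \<le> 1"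
    using cfrac_nonneg[OF nz(1)] cfrac_nonneg[OF nz(2)] cfrac_le_1[OF nz(1)] cfrac_le_1[OF nz(2)]
    by linarith
  moreover have "0 \<le> \<kappa> * N / X" using assms by simp
  ultimately show ?thesis using True by simp
next
  case False
  have "K / (2 * real N) * \<bar>cfrac w' - cfrac w\<bar> * X \<le> \<bar>\<theta> - a / q\<bar> * \<bar>cfrac w' - cfrac w\<bar> * cont w"
    using False far dyadic_wordsD(3)[OF words(1)] \<open>0 < X\<close> \<open>1 \<le> K\<close>
    by (intro mult_mono mult_right_mono mult_nonneg_nonneg) auto
  also have "\<dots> \<le> 2 * \<kappa>"
    by (rule abs_cfrac_diff_le_of_parallel[OF dyadic_wordsD(2)[OF words(1)]
        dyadic_wordsD(2)[OF words(2)] parallel])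
  finally have "\<bar>cfrac w' - cfrac w\<bar> \<le> 4 * (\<kappa> * N / X) / K"
    using assms(1-3) by (simp add: field_simps)
  also have "\<dots> \<le> 4 * (1 + \<kappa> * N / X) / K" using \<open>1 \<le> K\<close> by (intro divide_right_mono) auto
  finally show ?thesis .
qed

context
  fixes N :: nat and Q K X \<kappa> \<theta> :: real and a q :: int
  assumes N: "0 < N" and Q: "1 \<le> Q" and X: "0 < X" and \<kappa>: "0 \<le> \<kappa>"
    and small: "\<kappa> + 4 * K * X / real N < 1 / Q\<^sup>2"
    and aq: "coprime a q" "0 < q" "real_of_int q \<le> Q" "\<bar>\<theta> - a / q\<bar> \<le> K / N"
begin

lemma card_major_arcs_fibre_le:
  assumes words: "w \<in> dyadic_words X" "w' \<in> dyadic_words X"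
  shows "real (card {\<theta>' \<in> major_arcs N Q K. near_vec \<kappa> \<theta> w \<theta>' w'}) \<le> 12 * (1 + \<kappa> * N / X)"
proof (rule card_grid_fibre_le[OF N \<kappa> X _ dyadic_wordsD(3)[OF words(2)]])
  fix x y
  assume "x \<in> {\<theta>' \<in> major_arcs N Q K. near_vec \<kappa> \<theta> w \<theta>' w'}"
    "y \<in> {\<theta>' \<in> major_arcs N Q K. near_vec \<kappa> \<theta> w \<theta>' w'}"
  then have x: "near_vec \<kappa> \<theta> w x w'" "x \<in> major_arcs N Q K"
    and y: "near_vec \<kappa> \<theta> w y w'" "y \<in> major_arcs N Q K" by auto
  note exactE = major_arcs_exactE[OF N Q small aq words]
  show "near_int (2 * \<kappa> / cont w') (x - y)"
    by (rule exactE[OF x], rule exactE[OF y],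
        rule near_int_of_exact[OF aq(2) dyadic_wordsD(2)[OF words(2)]])
qed (use major_arcs_subset_grid in auto)

lemma major_arcs_near_vecD:
  assumes words: "w \<in> dyadic_words X" "w' \<in> dyadic_words X"
    and near: "near_vec \<kappa> \<theta> w \<theta>' w'" and \<theta>': "\<theta>' \<in> major_arcs N Q K"
    and K: "1 \<le> K" "K = 1 \<or> K / (2 * real N) \<le> \<bar>\<theta> - a / q\<bar>"
  shows "q dvd cross w w'" "\<bar>cfrac w' - cfrac w\<bar> \<le> 4 * (1 + \<kappa> * N / X) / K"
proof -
  obtain a' n\<^sub>1 n\<^sub>2 :: int where exact:
      "a * int (cont w) - a' * int (cont w') = n\<^sub>1 * q"
      "a * int (cont_tl w) - a' * int (cont_tl w') = n\<^sub>2 * q"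
      "\<bar>(\<theta> - a / q) * cont w - (\<theta>' - a' / q) * cont w'\<bar> \<le> \<kappa>"
      "\<bar>(\<theta> - a / q) * cont_tl w - (\<theta>' - a' / q) * cont_tl w'\<bar> \<le> \<kappa>"
    by (rule major_arcs_exactE[OF N Q small aq words near \<theta>'])
  show "q dvd cross w w'" by (rule dvd_cross[OF aq(1) exact(1,2)])
  show "\<bar>cfrac w' - cfrac w\<bar> \<le> 4 * (1 + \<kappa> * N / X) / K"
    by (rule major_arcs_direction[OF N K(1) X \<kappa> K(2) words exact(3,4)])
qed

end

lemma major_arcs_near_pairs_le:
  assumes N: "0 < N" and Q: "1 \<le> Q" and K: "1 \<le> K" and X: "0 < X" and \<kappa>: "0 \<le> \<kappa>"
    and large: "2 * step_ratio * sqrt K * Q \<le> X" and small: "\<kappa> + 4 * K * X / real N < 1 / Q\<^sup>2"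
    and \<theta>: "\<theta> \<in> major_arcs N Q K" and V: "V \<subseteq> dyadic_words X"
  shows "near_pairs \<kappa> (major_arcs N Q K) V \<theta>
    \<le> real (card V)
      * (60 * class_const * (1 + \<kappa> * N / X)\<^sup>2 * word_count (2 * X / (sqrt K * Q)) * Q)"
proof -
  define \<Lambda> where "\<Lambda> = 1 + \<kappa> * N / X"
  have "1 \<le> \<Lambda>" using \<kappa> X by (simp add: \<Lambda>_def)
  define W where "W = word_count (2 * X / (sqrt K * Q))"
  obtain a q :: int
    where aq: "coprime a q" "0 < q" "Q / 2 \<le> q" "real_of_int q \<le> Q" "\<bar>\<theta> - a / q\<bar> \<le> K / N"
      "K = 1 \<or> K / (2 * real N) \<le> \<bar>\<theta> - a / q\<bar>" using \<theta> by (rule major_arcsE)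
  define partners where
    "partners w = {w' \<in> dyadic_words X. int (nat q) dvd cross w w'
        \<and> \<bar>cfrac w' - cfrac w\<bar> \<le> 4 * \<Lambda> / K}" for w
  have "near_pairs \<kappa> (major_arcs N Q K) V \<theta>
      \<le> real (card V) * ((class_const * (5 * \<Lambda>) * W * Q) * (12 * \<Lambda>))"
  proof (rule near_pairs_le)
    show "finite V" using V finite_dyadic_words by (rule finite_subset)
    show "0 \<le> 12 * \<Lambda>" using \<open>1 \<le> \<Lambda>\<close> by simp
    show "finite (partners w)" for w using finite_dyadic_words by (simp add: partners_def)
  next
    fix w w' assume "w \<in> V" "w' \<in> V"
    then show "real (card {\<theta>' \<in> major_arcs N Q K. near_vec \<kappa> \<theta> w \<theta>' w'}) \<le> 12 * \<Lambda>"
      unfolding \<Lambda>_def using V by (intro card_major_arcs_fibre_le[OF N Q X \<kappa> small aq(1,2,4,5)]) auto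
  next
    fix w w' \<theta>' assume "w \<in> V" "w' \<in> V" and \<theta>': "\<theta>' \<in> major_arcs N Q K" "near_vec \<kappa> \<theta> w \<theta>' w'"
    then have words: "w \<in> dyadic_words X" "w' \<in> dyadic_words X" using V by auto
    then show "w' \<in> partners w"
      using major_arcs_near_vecD[OF N Q X \<kappa> small aq(1,2,4,5) words \<theta>'(2,1) K aq(6)] aq(2)
      by (simp add: partners_def \<Lambda>_def)
  next
    fix w assume "w \<in> V"
    have "real (card (partners w)) \<le> class_const * (1 + (sqrt K)\<^sup>2 * (4 * \<Lambda> / K)) * W * Q"
      unfolding partners_def W_def using dyadic_wordsD(2)[of w] V \<open>w \<in> V\<close> Q K aq large \<open>1 \<le> \<Lambda>\<close>
      by (intro card_words_class_le) auto
    also have "\<dots> \<le> class_const * (5 * \<Lambda>) * W * Q"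
      using K \<open>1 \<le> \<Lambda>\<close> class_const_pos word_count_nonneg Q
      by (intro mult_right_mono mult_left_mono) (auto simp: W_def)
    finally show "real (card (partners w)) \<le> class_const * (5 * \<Lambda>) * W * Q" .
  qed
  also have "(class_const * (5 * \<Lambda>) * W * Q) * (12 * \<Lambda>) = 60 * class_const * \<Lambda>\<^sup>2 * W * Q"
    by (simp add: power2_eq_square)
  finally show ?thesis by (simp only: \<Lambda>_def W_def)
qed

subsection \<open>Coincidences on the minor arcs\<close>

lemma near_vec_cross_near_int:
  assumes X: "0 < X" and \<kappa>: "0 \<le> \<kappa>" and words: "w \<in> dyadic_words X" "w' \<in> dyadic_words X"
    and near: "near_vec \<kappa> \<theta> w \<theta>' w'"
  shows "\<bar>real_of_int (cross w w')\<bar> \<le> 4 * X\<^sup>2" "near_int (4 * \<kappa> * X) (\<theta> * cross w w')"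
proof -
  let ?v = "real (cont w)" and ?v' = "real (cont w')" and ?u = "real (cont_tl w)"
    and ?u' = "real (cont_tl w')"
  have v: "?v \<le> 2 * X" "?v' \<le> 2 * X" using dyadic_wordsD(4) words by blast+
  have u: "?u \<le> ?v" "?u' \<le> ?v'" using cont_tl_le dyadic_wordsD(2) words by (meson of_nat_le_iff)+
  have "?v * ?u' \<le> (2 * X) * (2 * X)" "?u * ?v' \<le> (2 * X) * (2 * X)"
    using u v X by (intro mult_mono; linarith)+
  moreover have "0 \<le> ?v * ?u'" "0 \<le> ?u * ?v'" by auto
  ultimately have "\<bar>?v * ?u' - ?u * ?v'\<bar> \<le> (2 * X) * (2 * X)" by linarith
  then show "\<bar>real_of_int (cross w w')\<bar> \<le> 4 * X\<^sup>2" by (simp add: cross_def power2_eq_square)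
  obtain n\<^sub>1 n\<^sub>2 :: int where n: "\<bar>\<theta> * ?v - \<theta>' * ?v' - n\<^sub>1\<bar> \<le> \<kappa>" "\<bar>\<theta> * ?u - \<theta>' * ?u' - n\<^sub>2\<bar> \<le> \<kappa>"
    using near unfolding near_vec_def by (meson near_intE)
  have "\<theta> * cross w w' - of_int (n\<^sub>1 * int (cont_tl w') - n\<^sub>2 * int (cont w')) =
    (\<theta> * ?v - \<theta>' * ?v' - n\<^sub>1) * ?u' - (\<theta> * ?u - \<theta>' * ?u' - n\<^sub>2) * ?v'"
    by (simp add: cross_def algebra_simps)
  also have "\<bar>\<dots>\<bar> \<le> \<bar>(\<theta> * ?v - \<theta>' * ?v' - n\<^sub>1) * ?u'\<bar> + \<bar>(\<theta> * ?u - \<theta>' * ?u' - n\<^sub>2) * ?v'\<bar>"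
    by (rule abs_triangle_ineq4)
  also have "\<dots> \<le> \<kappa> * (2 * X) + \<kappa> * (2 * X)"
    using n u v \<kappa> by (intro add_mono) (auto simp: abs_mult intro!: mult_mono)
  finally have "\<bar>\<theta> * cross w w' - of_int (n\<^sub>1 * int (cont_tl w') - n\<^sub>2 * int (cont w'))\<bar>
      \<le> 4 * \<kappa> * X"
    by (simp add: ac_simps)
  then show "near_int (4 * \<kappa> * X) (\<theta> * cross w w')" by (rule near_intI)
qed

definition near_dets :: "real \<Rightarrow> real \<Rightarrow> real \<Rightarrow> int set" where
  "near_dets X \<kappa> \<theta> = {D. \<bar>real_of_int D\<bar> \<le> 4 * X\<^sup>2 \<and> near_int (4 * \<kappa> * X) (\<theta> * D)}"

lemma finite_near_dets: "finite (near_dets X \<kappa> \<theta>)"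
proof (rule finite_subset)
  show "near_dets X \<kappa> \<theta> \<subseteq> {-\<lceil>4 * X\<^sup>2\<rceil>..\<lceil>4 * X\<^sup>2\<rceil>}"
    unfolding near_dets_def by (auto simp: abs_le_iff) linarith+
qed simp

lemma card_words_near_dets_le:
  fixes a q :: int and X \<kappa> \<theta> :: real
  assumes aq: "coprime a q" "0 < q" "\<bar>\<theta> - a / q\<bar> \<le> 1 / (real_of_int q)\<^sup>2"
    and "0 < X" "0 \<le> \<kappa>" "16 * \<kappa> * X < 1" "w \<in> dyadic_words X"
  shows "real (card (\<Union>D\<in>near_dets X \<kappa> \<theta>. {w' \<in> words_upto (2 * X). cross w w' = D}))
    \<le> (8 * X\<^sup>2 / q + 2) * (8 * \<kappa> * X * q + 3) * 6"
proof -
  have "real (card (\<Union>D\<in>near_dets X \<kappa> \<theta>. {w' \<in> words_upto (2 * X). cross w w' = D}))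
      \<le> real (card (near_dets X \<kappa> \<theta>)) * 6"
    using assms(7) dyadic_wordsD[of w X]
    by (intro real_card_UN_le finite_near_dets card_words_cross_eq_le) auto
  also have "real (card (near_dets X \<kappa> \<theta>)) \<le> (8 * X\<^sup>2 / q + 2) * (8 * \<kappa> * X * q + 3)"
    using card_near_int_multiples_le[OF aq, of "4 * \<kappa> * X" "4 * X\<^sup>2"] assms(4-6)
    by (simp add: near_dets_def mult.assoc)
  finally show ?thesis by simp
qed

lemma minor_near_pairs_le:
  fixes a q :: int and X \<kappa> \<theta> :: real
  assumes N: "0 < N" and aq: "coprime a q" "0 < q" "\<bar>\<theta> - a / q\<bar> \<le> 1 / (real_of_int q)\<^sup>2"
    and X: "0 < X" and \<kappa>: "0 \<le> \<kappa>" "16 * \<kappa> * X < 1" and \<Theta>: "\<Theta> \<subseteq> grid N"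
    and V: "V \<subseteq> dyadic_words X"
  shows "near_pairs \<kappa> \<Theta> V \<theta>
    \<le> real (card V) * (72 * (1 + \<kappa> * N / X) * ((8 * X\<^sup>2 / q + 2) * (8 * \<kappa> * X * q + 3)))"
proof -
  define \<Lambda> where "\<Lambda> = 1 + \<kappa> * N / X"
  have "1 \<le> \<Lambda>" using \<kappa> X by (simp add: \<Lambda>_def)
  define B where "B = (8 * X\<^sup>2 / q + 2) * (8 * \<kappa> * X * q + 3)"
  define partners
    where "partners w = (\<Union>D\<in>near_dets X \<kappa> \<theta>. {w' \<in> words_upto (2 * X). cross w w' = D})" for w
  have "near_pairs \<kappa> \<Theta> V \<theta> \<le> real (card V) * ((B * 6) * (12 * \<Lambda>))"
  proof (rule near_pairs_le)
    show "finite V" using V finite_dyadic_words by (rule finite_subset)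
    show "0 \<le> 12 * \<Lambda>" using \<open>1 \<le> \<Lambda>\<close> by simp
    show "finite (partners w)" for w
      using finite_near_dets finite_words_upto by (auto simp: partners_def)
  next
    fix w w' assume "w \<in> V" "w' \<in> V"
    then have w': "w' \<in> dyadic_words X" using V by auto
    show "real (card {\<theta>'\<in>\<Theta>. near_vec \<kappa> \<theta> w \<theta>' w'}) \<le> 12 * \<Lambda>"
      unfolding \<Lambda>_def
    proof (rule card_grid_fibre_le[OF N \<kappa>(1) X _ dyadic_wordsD(3)[OF w']])
      have "\<kappa> * cont w' \<le> \<kappa> * (2 * X)"
        using dyadic_wordsD(4)[OF w'] \<kappa>(1) by (intro mult_left_mono) auto
      then have "8 * \<kappa> * cont w' < 1" using \<kappa>(2) by linarith
      then show "near_int (2 * \<kappa> / cont w') (x - y)"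
        if "x \<in> {\<theta>'\<in>\<Theta>. near_vec \<kappa> \<theta> w \<theta>' w'}" "y \<in> {\<theta>'\<in>\<Theta>. near_vec \<kappa> \<theta> w \<theta>' w'}" for x y
        using that near_vec_diff_near_int dyadic_wordsD(2)[OF w'] by blast
    qed (use \<Theta> in auto)
  next
    fix w w' \<theta>' assume "w \<in> V" "w' \<in> V" and near: "near_vec \<kappa> \<theta> w \<theta>' w'"
    then have words: "w \<in> dyadic_words X" "w' \<in> dyadic_words X" using V by auto
    then show "w' \<in> partners w"
      using near_vec_cross_near_int[OF X \<kappa>(1) words near] dyadic_words_subset
      by (auto simp: partners_def near_dets_def)
  next
    fix w assume "w \<in> V"
    then show "real (card (partners w)) \<le> B * 6"
      unfolding partners_def B_def using V by (intro card_words_near_dets_le[OF aq X \<kappa>]) auto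
  qed
  also have "(B * 6) * (12 * \<Lambda>) = 72 * \<Lambda> * B" by simp
  finally show ?thesis by (simp only: \<Lambda>_def B_def)
qed

end

subsection \<open>Splitting the exponential sum\<close>

lemma power2_sum4_le: "(a + b + c + d)\<^sup>2 \<le> 4 * (a\<^sup>2 + b\<^sup>2 + c\<^sup>2 + (d::real)\<^sup>2)"
proof -
  have "4 * (a\<^sup>2 + b\<^sup>2 + c\<^sup>2 + d\<^sup>2) - (a + b + c + d)\<^sup>2
      = (a - b)\<^sup>2 + (a - c)\<^sup>2 + (a - d)\<^sup>2 + (b - c)\<^sup>2 + (b - d)\<^sup>2 + (c - d)\<^sup>2"
    by (simp add: power2_eq_square algebra_simps)
  moreover have "\<dots> \<ge> 0" by simp
  ultimately show ?thesis by linarith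
qed

lemma sum_dyadic_split:
  fixes f :: "'a \<Rightarrow> real" and h :: "'a \<Rightarrow> 'b::comm_monoid_add"
  assumes "finite S" "0 \<le> Y"
  shows "(\<Sum>x\<in>{x \<in> S. f x < 2 ^ n * Y}. h x)
    = (\<Sum>x\<in>{x \<in> S. f x < Y}. h x) + (\<Sum>i<n. \<Sum>x\<in>{x \<in> S. 2 ^ i * Y \<le> f x \<and> f x < 2 ^ Suc i * Y}. h x)"
proof (induction n)
  case (Suc n)
  have "2 ^ n * Y \<le> 2 ^ Suc n * Y" using assms(2) by (intro mult_right_mono) auto
  then have "{x \<in> S. f x < 2 ^ Suc n * Y}
      = {x \<in> S. f x < 2 ^ n * Y} \<union> {x \<in> S. 2 ^ n * Y \<le> f x \<and> f x < 2 ^ Suc n * Y}"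
    by (auto simp del: power_Suc)
  then have "(\<Sum>x\<in>{x \<in> S. f x < 2 ^ Suc n * Y}. h x) = (\<Sum>x\<in>{x \<in> S. f x < 2 ^ n * Y}. h x)
      + (\<Sum>x\<in>{x \<in> S. 2 ^ n * Y \<le> f x \<and> f x < 2 ^ Suc n * Y}. h x)"
    using assms(1) by (simp only:) (intro sum.union_disjoint, auto)
  then show ?case using Suc by (simp add: add.assoc)
qed simp

context alphabet
begin

definition expsum :: "nat \<Rightarrow> real \<Rightarrow> complex" where
  "expsum N \<theta> = (\<Sum>w\<in>words_upto ((real N)\<^sup>2). damped N \<theta> ^ cont w)"

definition suffixes_upto :: "real \<Rightarrow> nat list \<Rightarrow> nat list set" where
  "suffixes_upto Z x = {y \<in> lists A. real (cont (x @ y)) \<le> Z}"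

definition dyadic_block :: "real \<Rightarrow> real \<Rightarrow> nat \<Rightarrow> nat list set" where
  "dyadic_block Z Y i
      = {w \<in> words_upto Z. 2 ^ i * Y \<le> real (cont w) \<and> real (cont w) < 2 ^ Suc i * Y}"

lemma suffixes_upto_subset:
  assumes "x \<in> lists A"
  shows "suffixes_upto Z x \<subseteq> words_upto Z"
proof
  fix y assume "y \<in> suffixes_upto Z x"
  moreover have "real (cont y) \<le> real (cont (x @ y))"
    unfolding of_nat_le_iff by (rule cont_suffix_le[OF zero_notin_word[OF assms]])
  ultimately show "y \<in> words_upto Z" by (simp add: suffixes_upto_def words_upto_def)
qed

lemma finite_suffixes_upto: "x \<in> lists A \<Longrightarrow> finite (suffixes_upto Z x)"
  using suffixes_upto_subset finite_words_upto by (rule finite_subset)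

lemma bij_betw_stop_prefix:
  "bij_betw (\<lambda>(x, y). x @ y) (SIGMA x:stop_words M. suffixes_upto Z x)
    {w \<in> words_upto Z. M \<le> real (cont w)}"
  unfolding bij_betw_def
proof
  show "inj_on (\<lambda>(x, y). x @ y) (SIGMA x:stop_words M. suffixes_upto Z x)"
    by (rule inj_onI) (auto dest: stop_prefix_unique)
  show "(\<lambda>(x, y). x @ y) ` (SIGMA x:stop_words M. suffixes_upto Z x)
      = {w \<in> words_upto Z. M \<le> real (cont w)}"
  proof (intro equalityI subsetI)
    fix w assume "w \<in> (\<lambda>(x, y). x @ y) ` (SIGMA x:stop_words M. suffixes_upto Z x)"
    then obtain x y where w: "w = x @ y" "x \<in> stop_words M" "y \<in> suffixes_upto Z x" by auto
    then have lists: "x \<in> lists A" "y \<in> lists A"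
      using stop_words_lists by (auto simp: suffixes_upto_def)
    have "real (cont x) \<le> real (cont w)"
      unfolding w(1) of_nat_le_iff by (intro cont_prefix_le zero_notin_word lists)
    then have "M \<le> real (cont w)" using stop_words_ge[OF w(2)] by linarith
    then show "w \<in> {w \<in> words_upto Z. M \<le> real (cont w)}"
      using w lists by (auto simp: words_upto_def suffixes_upto_def)
  next
    fix w assume w: "w \<in> {w \<in> words_upto Z. M \<le> real (cont w)}"
    then have "w \<in> lists A" "M \<le> real (cont w)" by (auto simp: words_upto_def)
    then obtain x y where xy: "w = x @ y" "x \<in> stop_words M" "y \<in> lists A" by (rule stop_prefixE)
    then have "(x, y) \<in> (SIGMA x:stop_words M. suffixes_upto Z x)"
      using w by (auto simp: suffixes_upto_def words_upto_def)
    then show "w \<in> (\<lambda>(x, y). x @ y) ` (SIGMA x:stop_words M. suffixes_upto Z x)"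
      using xy(1) by force
  qed
qed

lemma sum_words_upto_split:
  fixes h :: "nat list \<Rightarrow> 'a::comm_monoid_add"
  assumes "1 \<le> M"
  shows "(\<Sum>w\<in>words_upto Z. h w)
    = (\<Sum>w\<in>{w \<in> words_upto Z. real (cont w) < M}. h w)
      + (\<Sum>x\<in>stop_words M. \<Sum>y\<in>suffixes_upto Z x. h (x @ y))"
proof -
  have "words_upto Z
      = {w \<in> words_upto Z. real (cont w) < M} \<union> {w \<in> words_upto Z. M \<le> real (cont w)}" by auto
  then have "(\<Sum>w\<in>words_upto Z. h w)
      = (\<Sum>w\<in>{w \<in> words_upto Z. real (cont w) < M} \<union> {w \<in> words_upto Z. M \<le> real (cont w)}. h w)"
    by simp
  also have "\<dots> = (\<Sum>w\<in>{w \<in> words_upto Z. real (cont w) < M}. h w)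
      + (\<Sum>w\<in>{w \<in> words_upto Z. M \<le> real (cont w)}. h w)"
    using finite_words_upto by (intro sum.union_disjoint) auto
  also have "(\<Sum>w\<in>{w \<in> words_upto Z. M \<le> real (cont w)}. h w)
      = (\<Sum>(x, y)\<in>(SIGMA x:stop_words M. suffixes_upto Z x). h (x @ y))"
    by (subst sum.reindex_bij_betw[OF bij_betw_stop_prefix, symmetric]) (simp add: case_prod_beta)
  also have "\<dots> = (\<Sum>x\<in>stop_words M. \<Sum>y\<in>suffixes_upto Z x. h (x @ y))"
    using finite_stop_words[OF assms] finite_suffixes_upto stop_words_lists
    by (intro sum.Sigma[symmetric]) blast+
  finally show ?thesis .
qed

lemma words_upto_subset_suffixes_upto:
  assumes x: "x \<in> stop_words M" and M: "1 \<le> M" and Z: "2 * step_ratio * M * Y \<le> Z"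
  shows "words_upto Y \<subseteq> suffixes_upto Z x"
proof
  fix y assume y: "y \<in> words_upto Y"
  then have lists: "x \<in> lists A" "y \<in> lists A"
    using stop_words_lists[OF x] by (auto simp: words_upto_def)
  have "real (cont (x @ y)) \<le> 2 * (real (cont x) * real (cont y))"
    by (intro cont_append_le zero_notin_word lists)
  also have "\<dots> \<le> 2 * ((step_ratio * M) * Y)"
    using stop_words_le[OF x M] y step_ratio_ge_2 M
    by (intro mult_left_mono mult_mono) (auto simp: words_upto_def)
  also have "\<dots> \<le> Z" using Z by (simp add: mult_ac)
  finally show "y \<in> suffixes_upto Z x" using lists by (simp add: suffixes_upto_def)
qed

lemma norm_damped_long_suffix_le:
  assumes L: "0 < L" and M: "0 < M" and LM: "M * L = N" and x: "x \<in> stop_words M"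
    and y: "y \<in> lists A" "L * H < real (cont y)"
  shows "cmod (damped N \<theta> ^ cont (x @ y)) \<le> exp (- H / 2) * exp (- real (cont y) / (2 * L))"
proof -
  have "M * real (cont y) \<le> real (cont x) * real (cont y)"
    using stop_words_ge[OF x] by (intro mult_right_mono) auto
  also have "\<dots> \<le> real (cont (x @ y))" by (rule cont_mult_le_cont_append)
  finally have "M * real (cont y) / N \<le> real (cont (x @ y)) / N"
    using L M LM by (intro divide_right_mono) auto
  moreover have "M * real (cont y) / N = real (cont y) / L"
    unfolding LM[symmetric] using L M by simp
  moreover have "H < real (cont y) / L" using y(2) L by (simp add: pos_less_divide_eq mult.commute)
  moreover have "real (cont y) / L = real (cont y) / (2 * L) + real (cont y) / (2 * L)" by simp
  moreover have "real (cont y) / (2 * L) = real (cont y) / L / 2" by simp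
  ultimately have "- real (cont (x @ y)) / N \<le> - H / 2 + - real (cont y) / (2 * L)" by linarith
  then show ?thesis unfolding norm_damped_power exp_add[symmetric] by simp
qed

lemma expsum_truncation_error:
  assumes N: "0 < N" and M: "1 < M" and HN: "2 * step_ratio * H \<le> N" and LM: "M * L = real N"
  shows "cmod (expsum N \<theta> - bilinear_sum N \<theta> M (words_upto (L * H))) \<le> word_count M
    + real (card (stop_words M)) * exp (- H / 2) *
        (\<Sum>w\<in>words_upto ((real N)\<^sup>2). exp (- real (cont w) / (2 * L)))"
proof -
  let ?U = "stop_words M" and ?\<Omega> = "words_upto ((real N)\<^sup>2)" and ?z = "\<lambda>w. damped N \<theta> ^ cont w"
  let ?Y = "suffixes_upto ((real N)\<^sup>2)" and ?V = "words_upto (L * H)"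
  have L: "0 < L" using LM N M
    by (metis of_nat_0_less_iff order.strict_trans zero_less_mult_pos zero_less_one)
  have "2 * step_ratio * M * (L * H) = (2 * step_ratio * H) * (M * L)" by simp
  also have "\<dots> \<le> (real N)\<^sup>2" unfolding LM power2_eq_square using HN by (intro mult_right_mono) auto
  finally have V_subset: "?V \<subseteq> ?Y x" if "x \<in> ?U" for x
    using words_upto_subset_suffixes_upto[OF that] M by simp
  define small where "small = (\<Sum>w\<in>{w \<in> ?\<Omega>. real (cont w) < M}. ?z w)"
  define long where "long = (\<Sum>x\<in>?U. \<Sum>y\<in>?Y x - ?V. ?z (x @ y))"
  have "expsum N \<theta> = small + (\<Sum>x\<in>?U. \<Sum>y\<in>?Y x. ?z (x @ y))"
    unfolding expsum_def small_def using M by (intro sum_words_upto_split) simp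
  also have "(\<Sum>x\<in>?U. \<Sum>y\<in>?Y x. ?z (x @ y))
      = (\<Sum>x\<in>?U. (\<Sum>y\<in>?Y x - ?V. ?z (x @ y)) + (\<Sum>y\<in>?V. ?z (x @ y)))"
    by (intro sum.cong refl sum.subset_diff V_subset finite_suffixes_upto stop_words_lists)
  finally have error: "expsum N \<theta> - bilinear_sum N \<theta> M ?V = small + long"
    by (simp add: sum.distrib long_def bilinear_sum_def)
  have "cmod small \<le> (\<Sum>w\<in>{w \<in> ?\<Omega>. real (cont w) < M}. 1)"
    unfolding small_def using norm_damped_power_le_1 N by (intro sum_norm_le) auto
  also have "\<dots> \<le> word_count M" by (simp, intro card_le_word_count) (auto simp: words_upto_def)
  finally have small: "cmod small \<le> word_count M" .
  have "cmod long \<le> (\<Sum>x\<in>?U. \<Sum>y\<in>?Y x - ?V. exp (- H / 2) * exp (- real (cont y) / (2 * L)))"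
    unfolding long_def
  proof (intro sum_norm_le)
    fix x y assume "x \<in> ?U" "y \<in> ?Y x - ?V"
    then show "cmod (?z (x @ y)) \<le> exp (- H / 2) * exp (- real (cont y) / (2 * L))"
      using M by (intro norm_damped_long_suffix_le[OF L _ LM])
        (auto simp: suffixes_upto_def words_upto_def)
  qed
  also have "\<dots> \<le> (\<Sum>x\<in>?U. \<Sum>y\<in>?\<Omega>. exp (- H / 2) * exp (- real (cont y) / (2 * L)))"
    using suffixes_upto_subset stop_words_lists finite_words_upto
    by (intro sum_mono sum_mono2) (blast, blast, simp)
  also have "\<dots> = real (card ?U) * exp (- H / 2) * (\<Sum>w\<in>?\<Omega>. exp (- real (cont w) / (2 * L)))"
    by (simp add: sum_distrib_left[symmetric])
  finally have "cmod long
      \<le> real (card ?U) * exp (- H / 2) * (\<Sum>w\<in>?\<Omega>. exp (- real (cont w) / (2 * L)))" .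
  then show ?thesis unfolding error using small norm_triangle_ineq[of small long] by linarith
qed

lemma bilinear_sum_dyadic:
  assumes "0 \<le> Y" "Z < 2 ^ n * Y"
  shows "bilinear_sum N \<theta> M (words_upto Z)
    = bilinear_sum N \<theta> M {w \<in> words_upto Z. real (cont w) < Y}
      + (\<Sum>i<n. bilinear_sum N \<theta> M (dyadic_block Z Y i))"
proof -
  have "words_upto Z = {w \<in> words_upto Z. real (cont w) < 2 ^ n * Y}"
    using assms(2) by (auto simp: words_upto_def)
  then have "(\<Sum>y\<in>words_upto Z. h y)
      = (\<Sum>y\<in>{w \<in> words_upto Z. real (cont w) < Y}. h y) + (\<Sum>i<n. \<Sum>y\<in>dyadic_block Z Y i. h y)"
    for h :: "nat list \<Rightarrow> complex"
    using sum_dyadic_split[OF finite_words_upto[of Z] assms(1),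
        where f = "\<lambda>w. real (cont w)" and n = n and h = h]
    by (simp only: dyadic_block_def)
  then show ?thesis
    unfolding bilinear_sum_def sum.distrib by (subst (2) sum.swap) (simp add: sum.distrib)
qed

lemma norm_bilinear_sum_le:
  assumes "0 < N" "V \<subseteq> words_upto Y"
  shows "cmod (bilinear_sum N \<theta> M V) \<le> real (card (stop_words M)) * word_count Y"
proof -
  have "cmod (bilinear_sum N \<theta> M V) \<le> (\<Sum>x\<in>stop_words M. \<Sum>w\<in>V. 1)"
    unfolding bilinear_sum_def using norm_damped_power_le_1 assms(1) by (intro sum_norm_le) auto
  also have "\<dots> \<le> real (card (stop_words M)) * word_count Y"
    using card_le_word_count[OF assms(2)] by (simp add: mult_left_mono)
  finally show ?thesis .
qed

lemma norm_expsum_le: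
  assumes N: "0 < N" and M: "1 < M" and HN: "2 * step_ratio * H \<le> N" and LM: "M * L = real N"
    and B: "1 \<le> B" and n: "B * H < 2 ^ n"
  shows "cmod (expsum N \<theta>) \<le> word_count M + real (card (stop_words M)) * word_count (L / B)
    + cmod (\<Sum>i<n. bilinear_sum N \<theta> M (dyadic_block (L * H) (L / B) i))
    + real (card (stop_words M)) * exp (- H / 2) *
        (\<Sum>w\<in>words_upto ((real N)\<^sup>2). exp (- real (cont w) / (2 * L)))"
proof -
  let ?short = "{w \<in> words_upto (L * H). real (cont w) < L / B}"
  let ?dyadic = "\<Sum>i<n. bilinear_sum N \<theta> M (dyadic_block (L * H) (L / B) i)"
  have L: "0 < L" using LM N M
    by (metis of_nat_0_less_iff order.strict_trans zero_less_mult_pos zero_less_one)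
  have "L * H = (B * H) * (L / B)" using B by simp
  also have "\<dots> < 2 ^ n * (L / B)" using n L B by (intro mult_strict_right_mono) auto
  finally have split: "bilinear_sum N \<theta> M (words_upto (L * H))
      = bilinear_sum N \<theta> M ?short + ?dyadic"
    using L B by (intro bilinear_sum_dyadic) auto
  have short: "cmod (bilinear_sum N \<theta> M ?short) \<le> real (card (stop_words M)) * word_count (L / B)"
    using N by (intro norm_bilinear_sum_le) (auto simp: words_upto_def)
  have "cmod (expsum N \<theta>) \<le> cmod (expsum N \<theta> - bilinear_sum N \<theta> M (words_upto (L * H)))
      + cmod (bilinear_sum N \<theta> M (words_upto (L * H)))"
    using norm_triangle_ineq2[of "expsum N \<theta>" "bilinear_sum N \<theta> M (words_upto (L * H))"] by simp
  moreover have "cmod (bilinear_sum N \<theta> M (words_upto (L * H)))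
      \<le> cmod (bilinear_sum N \<theta> M ?short) + cmod ?dyadic"
    unfolding split by (rule norm_triangle_ineq)
  ultimately show ?thesis using expsum_truncation_error[OF N M HN LM, of \<theta>] short by linarith
qed

end

subsection \<open>Word counts above a positive Hausdorff measure\<close>

locale dense_alphabet = alphabet +
  fixes s c\<^sub>0 :: real
  assumes s_gt: "7/8 < s" and s_less: "s < 1" and c\<^sub>0_pos: "0 < c\<^sub>0"
    and card_stop_words_lower: "1 \<le> M \<Longrightarrow> c\<^sub>0 * M powr (2 * s) \<le> real (card (stop_words M))"
begin

definition dilate_const :: real where
  "dilate_const = stop_mult_const / c\<^sub>0"

definition cut_const :: real where
  "cut_const = 2 * dilate_const * doubling + 2 * doubling * 2 powr growth_exp"

definition square_const :: real where
  "square_const = stop_mult_const\<^sup>2 / c\<^sub>0"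

lemma dilate_const_pos: "0 < dilate_const"
  using stop_mult_const_pos c\<^sub>0_pos by (simp add: dilate_const_def)

lemma cut_const_pos: "0 < cut_const"
  using dilate_const_pos doubling_ge_2 by (simp add: cut_const_def add_pos_pos)

lemma square_const_pos: "0 < square_const"
  using stop_mult_const_pos c\<^sub>0_pos by (simp add: square_const_def)

lemma word_count_dilate:
  assumes "1 \<le> Y"
  shows "word_count X * Y powr (2 * s) \<le> dilate_const * word_count (X * Y)"
proof -
  have "(c\<^sub>0 * Y powr (2 * s)) * word_count X \<le> real (card (stop_words Y)) * word_count X"
    using card_stop_words_lower[OF assms] word_count_nonneg by (intro mult_right_mono) auto
  also have "\<dots> \<le> stop_mult_const * word_count (Y * X)" by (rule card_stop_words_mult_le[OF assms])
  finally show ?thesis using c\<^sub>0_pos by (simp add: dilate_const_def field_simps)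
qed

lemma word_count_le_dilate:
  assumes "1 \<le> Y"
  shows "word_count X \<le> dilate_const * Y powr (- 2 * s) * word_count (X * Y)"
proof -
  have "word_count X = word_count X * Y powr (2 * s) * Y powr (- 2 * s)"
    using assms by (simp add: mult.assoc powr_add[symmetric])
  also have "\<dots> \<le> dilate_const * word_count (X * Y) * Y powr (- 2 * s)"
    using word_count_dilate[OF assms] by (intro mult_right_mono) auto
  finally show ?thesis by (simp add: ac_simps)
qed

lemma powr_le_word_count:
  assumes "1 \<le> Y"
  shows "Y powr (2 * s) \<le> dilate_const * word_count Y"
proof -
  have "1 * Y powr (2 * s) \<le> word_count 1 * Y powr (2 * s)"
    using word_count_ge_1[of 1] by (intro mult_right_mono) auto
  also have "\<dots> \<le> dilate_const * word_count Y" using word_count_dilate[OF assms, of 1] by simp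
  finally show ?thesis by simp
qed

lemma card_stop_words_square_le:
  assumes M: "1 \<le> M"
  shows "real (card (stop_words M)) * M\<^sup>2 * (word_count L)\<^sup>2
    \<le> square_const * M powr (2 - 2 * s) * (word_count (M * L))\<^sup>2"
proof -
  define f where "f = real (card (stop_words M))"
  have f: "c\<^sub>0 * M powr (2 * s) \<le> f" "0 < c\<^sub>0 * M powr (2 * s)"
    using card_stop_words_lower[OF M] c\<^sub>0_pos M by (auto simp: f_def)
  have "(f * word_count L)\<^sup>2 \<le> (stop_mult_const * word_count (M * L))\<^sup>2"
    using card_stop_words_mult_le[OF M, of L] word_count_nonneg
    by (intro power_mono) (auto simp: f_def)
  then have "(f * word_count L)\<^sup>2 * M\<^sup>2 / f
      \<le> (stop_mult_const * word_count (M * L))\<^sup>2 * M\<^sup>2 / (c\<^sub>0 * M powr (2 * s))"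
    using f by (intro frac_le mult_right_mono) auto
  also have "\<dots> = square_const * (M powr 2 / M powr (2 * s)) * (word_count (M * L))\<^sup>2"
    using M by (simp add: square_const_def power_mult_distrib powr_numeral)
  also have "M powr 2 / M powr (2 * s) = M powr (2 - 2 * s)" by (simp add: powr_diff)
  also have "(f * word_count L)\<^sup>2 * M\<^sup>2 / f = f * M\<^sup>2 * (word_count L)\<^sup>2"
    using f by (simp add: power2_eq_square)
  finally show ?thesis by (simp only: f_def)
qed

lemma word_count_cut_below:
  assumes G: "0 < G" and LG: "1 \<le> L / G" and X: "0 < X" "X \<le> L" and H: "1 \<le> H"
  shows "word_count (2 * X / G) * (1 + H * L / X)
      \<le> 2 * H * (dilate_const * (doubling * word_count (L / G)))"
proof -
  define r where "r = L / X"
  have r: "1 \<le> r" using X by (simp add: r_def)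
  have "1 * 1 \<le> H * r" using r H by (intro mult_mono) auto
  then have "1 + H * L / X \<le> 2 * H * r" by (simp add: r_def)
  also have "\<dots> \<le> 2 * H * r powr (2 * s)"
    using powr_mono[of 1 "2 * s" r] s_gt r H by (intro mult_left_mono) auto
  finally have "word_count (2 * X / G) * (1 + H * L / X)
      \<le> word_count (2 * X / G) * (2 * H * r powr (2 * s))"
    using word_count_nonneg by (intro mult_left_mono) auto
  also have "\<dots> = 2 * H * (word_count (2 * X / G) * r powr (2 * s))" by simp
  also have "\<dots> \<le> 2 * H * (dilate_const * word_count (2 * X / G * r))"
    using word_count_dilate[OF r, of "2 * X / G"] H by (intro mult_left_mono) auto
  also have "2 * X / G * r = 2 * (L / G)" using X by (simp add: r_def)
  also have "2 * H * (dilate_const * word_count (2 * (L / G)))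
      \<le> 2 * H * (dilate_const * (doubling * word_count (L / G)))"
    using word_count_double[OF LG] dilate_const_pos H by (intro mult_left_mono) auto
  finally show ?thesis .
qed

lemma word_count_cut_above:
  assumes G: "0 < G" and LG: "1 \<le> L / G" and X: "0 < X" "L \<le> X" "X \<le> L * H" and H: "1 \<le> H"
  shows "word_count (2 * X / G) * (1 + H * L / X)
      \<le> doubling * (2 * H) powr growth_exp * word_count (L / G) * (2 * H)"
proof (rule mult_mono)
  have "2 * X / G \<le> 2 * (L * H) / G" using X G by (intro divide_right_mono) auto
  then have "2 * X / G \<le> (2 * H) * (L / G)" by (simp add: ac_simps)
  then have "word_count (2 * X / G) \<le> word_count ((2 * H) * (L / G))" by (rule word_count_mono)
  also have "\<dots> \<le> doubling * (2 * H) powr growth_exp * word_count (L / G)"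
    using LG H by (intro word_count_scale) auto
  finally show "word_count (2 * X / G) \<le> doubling * (2 * H) powr growth_exp * word_count (L / G)" .
  have "0 < L / G" using LG by linarith
  then have L: "0 < L" using G by (simp add: zero_less_divide_iff)
  have "H * L / X \<le> H * L / L" using X L H by (intro divide_left_mono) auto
  then show "1 + H * L / X \<le> 2 * H" using L H by simp
  show "0 \<le> 1 + H * L / X" using L H X by (intro add_nonneg_nonneg) auto
qed (use word_count_nonneg doubling_ge_2 in auto)

lemma word_count_cut:
  assumes G: "0 < G" and LG: "1 \<le> L / G" and X: "0 < X" and H: "1 \<le> H" and XL: "X \<le> L * H"
  shows "word_count (2 * X / G) * (1 + H * L / X)
      \<le> cut_const * H powr (growth_exp + 1) * word_count (L / G)"
proof (cases "X \<le> L")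
  case True
  have "word_count (2 * X / G) * (1 + H * L / X)
      \<le> 2 * H * (dilate_const * (doubling * word_count (L / G)))"
    by (rule word_count_cut_below[OF G LG X True H])
  also have "\<dots> = (2 * dilate_const * doubling) * H powr 1 * word_count (L / G)" using H by simp
  also have "\<dots> \<le> cut_const * H powr (growth_exp + 1) * word_count (L / G)"
    using cut_const_pos doubling_ge_2 dilate_const_pos H growth_exp_ge_1 word_count_nonneg
    by (intro mult_right_mono mult_mono powr_mono) (auto simp: cut_const_def)
  finally show ?thesis .
next
  case False
  then have "word_count (2 * X / G) * (1 + H * L / X)
      \<le> doubling * (2 * H) powr growth_exp * word_count (L / G) * (2 * H)"
    using G LG X XL H by (intro word_count_cut_above) auto
  also have "\<dots> = (2 * doubling * 2 powr growth_exp) * H powr (growth_exp + 1) * word_count (L / G)"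
    using H by (simp add: powr_mult powr_add)
  also have "\<dots> \<le> cut_const * H powr (growth_exp + 1) * word_count (L / G)"
    using dilate_const_pos doubling_ge_2 word_count_nonneg
    by (intro mult_right_mono) (auto simp: cut_const_def)
  finally show ?thesis .
qed

subsection \<open>Mean squares of the exponential sum\<close>

definition reduction_const :: "nat \<Rightarrow> real" where
  "reduction_const k = 4 * (dilate_const\<^sup>2 + (stop_mult_const * dilate_const)\<^sup>2
     + (stop_mult_const * exp_sum_const * doubling)\<^sup>2 + sieve_const k)"

lemma reduction_const_pos: "0 < reduction_const k"
  using dilate_const_pos sieve_const_pos[of k]
  by (simp add: reduction_const_def add_pos_nonneg add_nonneg_pos)

lemma short_words_square_le:
  assumes "1 \<le> L" "M * L = N"
  shows "(word_count M)\<^sup>2 \<le> dilate_const\<^sup>2 * ((word_count N)\<^sup>2 * L powr (- 4 * s))"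
proof -
  have "word_count M \<le> dilate_const * L powr (- 2 * s) * word_count N"
    using word_count_le_dilate[OF assms(1), of M] assms(2) by simp
  then have "(word_count M)\<^sup>2 \<le> (dilate_const * L powr (- 2 * s) * word_count N)\<^sup>2"
    using word_count_nonneg by (intro power_mono) auto
  also have "\<dots> = dilate_const\<^sup>2 * ((word_count N)\<^sup>2 * (L powr (- 2 * s))\<^sup>2)"
    by (simp add: power_mult_distrib)
  also have "(L powr (- 2 * s))\<^sup>2 = L powr (- 4 * s)"
    by (simp add: power2_eq_square powr_add[symmetric])
  finally show ?thesis .
qed

lemma short_suffixes_square_le:
  assumes "1 \<le> M" "1 \<le> B" "M * L = N"
  shows "(real (card (stop_words M)) * word_count (L / B))\<^sup>2
    \<le> (stop_mult_const * dilate_const)\<^sup>2 * ((word_count N)\<^sup>2 * B powr (- 4 * s))"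
proof -
  let ?f = "real (card (stop_words M))"
  have "word_count (L / B) \<le> dilate_const * B powr (- 2 * s) * word_count L"
    using word_count_le_dilate[OF assms(2), of "L / B"] assms(2) by simp
  then have "?f * word_count (L / B) \<le> ?f * (dilate_const * B powr (- 2 * s) * word_count L)"
    by (intro mult_left_mono) auto
  also have "\<dots> = dilate_const * B powr (- 2 * s) * (?f * word_count L)" by simp
  also have "\<dots> \<le> dilate_const * B powr (- 2 * s) * (stop_mult_const * word_count N)"
    using card_stop_words_mult_le[OF assms(1), of L] assms(3) dilate_const_pos
    by (intro mult_left_mono) auto
  finally have "(?f * word_count (L / B))\<^sup>2
      \<le> (dilate_const * B powr (- 2 * s) * (stop_mult_const * word_count N))\<^sup>2"
    using word_count_nonneg by (intro power_mono) auto
  also have "\<dots> = (stop_mult_const * dilate_const)\<^sup>2 * ((word_count N)\<^sup>2 * (B powr (- 2 * s))\<^sup>2)"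
    by (simp add: power_mult_distrib)
  also have "(B powr (- 2 * s))\<^sup>2 = B powr (- 4 * s)"
    by (simp add: power2_eq_square powr_add[symmetric])
  finally show ?thesis .
qed

lemma long_suffixes_square_le:
  assumes "1 \<le> M" "1 \<le> L" "M * L = N"
  shows "(real (card (stop_words M)) * exp (- H / 2)
      * (\<Sum>w\<in>words_upto Z. exp (- real (cont w) / (2 * L))))\<^sup>2
    \<le> (stop_mult_const * exp_sum_const * doubling)\<^sup>2 * ((word_count N)\<^sup>2 * exp (- H))"
proof -
  let ?f = "real (card (stop_words M))" and ?E = "\<Sum>w\<in>words_upto Z. exp (- real (cont w) / (2 * L))"
  have "?E \<le> exp_sum_const * word_count (2 * L)" using assms(2) by (intro sum_exp_words_le) auto
  also have "\<dots> \<le> exp_sum_const * (doubling * word_count L)"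
    using word_count_double[OF assms(2)] exp_sum_const_pos by (intro mult_left_mono) auto
  finally have "?f * exp (- H / 2) * ?E
      \<le> ?f * exp (- H / 2) * (exp_sum_const * (doubling * word_count L))"
    by (intro mult_left_mono) auto
  also have "\<dots> = exp_sum_const * doubling * exp (- H / 2) * (?f * word_count L)" by simp
  also have "\<dots> \<le> exp_sum_const * doubling * exp (- H / 2) * (stop_mult_const * word_count N)"
    using card_stop_words_mult_le[OF assms(1), of L] assms(3) exp_sum_const_pos doubling_ge_2
    by (intro mult_left_mono) auto
  finally have "(?f * exp (- H / 2) * ?E)\<^sup>2
      \<le> (exp_sum_const * doubling * exp (- H / 2) * (stop_mult_const * word_count N))\<^sup>2"
    by (intro power_mono) (auto intro!: mult_nonneg_nonneg sum_nonneg)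
  also have "\<dots> = (stop_mult_const * exp_sum_const * doubling)\<^sup>2
      * ((word_count N)\<^sup>2 * (exp (- H / 2))\<^sup>2)"
    by (simp add: power_mult_distrib)
  also have "(exp (- H / 2))\<^sup>2 = exp (- H)" by (simp add: power2_eq_square exp_add[symmetric])
  finally show ?thesis .
qed

lemma expsum_square_le:
  assumes N: "0 < N" and M: "1 < M" and L: "1 \<le> L" and LM: "M * L = real N"
    and HN: "2 * step_ratio * H \<le> N" and B: "1 \<le> B" and n: "B * H < 2 ^ n"
  shows "(cmod (expsum N \<theta>))\<^sup>2
    \<le> 4 * ((dilate_const\<^sup>2 + (stop_mult_const * dilate_const)\<^sup>2
      + (stop_mult_const * exp_sum_const * doubling)\<^sup>2) *
        ((word_count N)\<^sup>2 * (L powr (- 4 * s) + B powr (- 4 * s) + exp (- H))))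
      + 4 * (real n * (\<Sum>i<n. (cmod (bilinear_sum N \<theta> M (dyadic_block (L * H) (L / B) i)))\<^sup>2))"
proof -
  let ?f = "real (card (stop_words M))" and ?g = "(word_count N)\<^sup>2"
  let ?P = "\<lambda>i. bilinear_sum N \<theta> M (dyadic_block (L * H) (L / B) i)"
  let ?E = "\<Sum>w\<in>words_upto ((real N)\<^sup>2). exp (- real (cont w) / (2 * L))"
  let ?c = "dilate_const\<^sup>2" and ?d = "(stop_mult_const * dilate_const)\<^sup>2"
    and ?e = "(stop_mult_const * exp_sum_const * doubling)\<^sup>2"
  have M1: "1 \<le> M" using M by simp
  have "(cmod (\<Sum>i<n. ?P i))\<^sup>2 \<le> (\<Sum>i<n. cmod (?P i))\<^sup>2" by (intro power_mono norm_sum) auto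
  also have "\<dots> \<le> (\<Sum>i<n. (cmod (?P i))\<^sup>2) * card {..<n}" by (rule sum_squared_le_sum_of_squares)
  finally have dyadic: "(cmod (\<Sum>i<n. ?P i))\<^sup>2 \<le> real n * (\<Sum>i<n. (cmod (?P i))\<^sup>2)"
    by (simp add: mult.commute)
  have "(cmod (expsum N \<theta>))\<^sup>2
      \<le> (word_count M + ?f * word_count (L / B) + cmod (\<Sum>i<n. ?P i) + ?f * exp (- H / 2) * ?E)\<^sup>2"
    by (intro power_mono norm_expsum_le[OF N M HN LM B n]) auto
  also have "\<dots> \<le> 4 * ((word_count M)\<^sup>2 + (?f * word_count (L / B))\<^sup>2 + (cmod (\<Sum>i<n. ?P i))\<^sup>2
      + (?f * exp (- H / 2) * ?E)\<^sup>2)"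
    by (rule power2_sum4_le)
  also have "\<dots> \<le> 4 * (?c * (?g * L powr (- 4 * s)) + ?d * (?g * B powr (- 4 * s))
      + real n * (\<Sum>i<n. (cmod (?P i))\<^sup>2) + ?e * (?g * exp (- H)))"
    by (intro mult_left_mono add_mono dyadic short_words_square_le[OF L LM]
        short_suffixes_square_le[OF M1 B LM]
        long_suffixes_square_le[OF M1 L LM]) simp
  also have "\<dots> = 4 * (?c * (?g * L powr (- 4 * s)) + ?d * (?g * B powr (- 4 * s))
      + ?e * (?g * exp (- H)))
      + 4 * (real n * (\<Sum>i<n. (cmod (?P i))\<^sup>2))" by simp
  also have "?c * (?g * L powr (- 4 * s)) + ?d * (?g * B powr (- 4 * s)) + ?e * (?g * exp (- H))
      \<le> (?c + ?d + ?e) * (?g * L powr (- 4 * s)) + (?c + ?d + ?e) * (?g * B powr (- 4 * s))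
        + (?c + ?d + ?e) * (?g * exp (- H))"
    by (intro add_mono mult_right_mono) auto
  also have "\<dots> = (?c + ?d + ?e) * (?g * (L powr (- 4 * s) + B powr (- 4 * s) + exp (- H)))"
    by (simp only: distrib_left)
  finally show ?thesis by simp
qed

definition near_pairs_bounded :: "real \<Rightarrow> real set \<Rightarrow> real \<Rightarrow> real \<Rightarrow> real \<Rightarrow> bool" where
  "near_pairs_bounded \<kappa> \<Theta> Y Z D \<longleftrightarrow>
    (\<forall>\<theta>\<in>\<Theta>. \<forall>X V. Y \<le> X \<longrightarrow> X \<le> Z \<longrightarrow> V \<subseteq> dyadic_words X \<longrightarrow> near_pairs \<kappa> \<Theta> V \<theta> \<le> D)"

lemma bilinear_block_mean_square_le:
  assumes N: "0 < N" and M: "1 < M" and L: "0 < L" and H: "1 \<le> H" and B: "1 \<le> B"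
    and \<Theta>: "finite \<Theta>" and D: "0 \<le> D"
    and pairs: "near_pairs_bounded (H / M) \<Theta> (L / B) (L * H) D"
  shows "(\<Sum>\<theta>\<in>\<Theta>. (cmod (bilinear_sum N \<theta> M (dyadic_block (L * H) (L / B) i)))\<^sup>2)
    \<le> sieve_const k * (real (card (stop_words M)) * M\<^sup>2
      * (D + (word_count (L * H))\<^sup>2 * real (card \<Theta>) / H ^ Suc k))"
proof -
  let ?V = "dyadic_block (L * H) (L / B) i" and ?X = "2 ^ i * (L / B)"
  have V: "?V \<subseteq> words_upto (L * H)" by (auto simp: dyadic_block_def)
  have "near_pairs (H / M) \<Theta> ?V \<theta> \<le> D" if "\<theta> \<in> \<Theta>" for \<theta>
  proof (cases "?V = {}")
    case False
    then have "?X \<le> L * H" by (auto simp: dyadic_block_def words_upto_def)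
    moreover have "1 * (L / B) \<le> ?X" using L B by (intro mult_right_mono) auto
    moreover have "?V \<subseteq> dyadic_words ?X"
      by (auto simp: dyadic_block_def words_upto_def dyadic_words_def)
    ultimately show ?thesis using pairs that by (simp add: near_pairs_bounded_def)
  qed (simp add: near_pairs_def D)
  then have "(\<Sum>\<theta>\<in>\<Theta>. (cmod (bilinear_sum N \<theta> M ?V))\<^sup>2)
      \<le> real (card (stop_words M))
        * (sieve_const k * M\<^sup>2 * (D + (real (card ?V))\<^sup>2 * real (card \<Theta>) / H ^ Suc k))"
    using N \<Theta> M H D finite_subset[OF V finite_words_upto] by (intro bilinear_large_sieve) auto
  also have "\<dots> \<le> real (card (stop_words M))
      * (sieve_const k * M\<^sup>2 * (D + (word_count (L * H))\<^sup>2 * real (card \<Theta>) / H ^ Suc k))"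
    using card_le_word_count[OF V] sieve_const_pos[of k] H
    by (intro mult_left_mono add_left_mono divide_right_mono mult_right_mono power_mono) auto
  finally show ?thesis by (simp only: mult_ac)
qed

lemma sum_bilinear_blocks_mean_square_le:
  assumes "0 < N" "1 < M" "0 < L" "1 \<le> H" "1 \<le> B" "finite \<Theta>" "0 \<le> D"
    and "near_pairs_bounded (H / M) \<Theta> (L / B) (L * H) D"
  shows "(\<Sum>\<theta>\<in>\<Theta>. \<Sum>i<n. (cmod (bilinear_sum N \<theta> M (dyadic_block (L * H) (L / B) i)))\<^sup>2)
    \<le> real n * (sieve_const k * (real (card (stop_words M)) * M\<^sup>2
      * (D + (word_count (L * H))\<^sup>2 * real (card \<Theta>) / H ^ Suc k)))"
proof -
  let ?P = "\<lambda>\<theta> i. (cmod (bilinear_sum N \<theta> M (dyadic_block (L * H) (L / B) i)))\<^sup>2"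
  have "(\<Sum>\<theta>\<in>\<Theta>. \<Sum>i<n. ?P \<theta> i) = (\<Sum>i<n. \<Sum>\<theta>\<in>\<Theta>. ?P \<theta> i)" by (rule sum.swap)
  also have "\<dots> \<le> (\<Sum>i<n. sieve_const k * (real (card (stop_words M)) * M\<^sup>2
      * (D + (word_count (L * H))\<^sup>2 * real (card \<Theta>) / H ^ Suc k)))"
    by (intro sum_mono bilinear_block_mean_square_le assms)
  finally show ?thesis by simp
qed

lemma ex_power2_greater:
  assumes "1 \<le> (x::real)"
  shows "\<exists>n. x < 2 ^ n \<and> real n \<le> 2 + log 2 x"
proof -
  define n where "n = nat \<lfloor>log 2 x\<rfloor> + 1"
  have "0 \<le> log 2 x" using assms by simp
  then have n: "log 2 x < n" "real n \<le> 2 + log 2 x" unfolding n_def by linarith+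
  have "x = 2 powr (log 2 x)" using assms by simp
  also have "\<dots> < 2 powr n" using n by simp
  finally show ?thesis using n(2) by (intro exI[of _ n]) (simp add: powr_realpow)
qed

lemma mean_square_reduction:
  assumes N: "0 < N" and M: "1 < M" and L: "1 \<le> L" and LM: "M * L = real N"
    and H: "1 \<le> H" and B: "1 \<le> B" and HN: "2 * step_ratio * H \<le> N" and \<Theta>: "finite \<Theta>" and D: "0 \<le> D"
    and pairs: "near_pairs_bounded (H / M) \<Theta> (L / B) (L * H) D"
  shows "(\<Sum>\<theta>\<in>\<Theta>. (cmod (expsum N \<theta>))\<^sup>2) \<le> reduction_const k *
    ((word_count N)\<^sup>2 * real (card \<Theta>) * (L powr (- 4 * s) + B powr (- 4 * s) + exp (- H)) +
     (2 + log 2 (B * H))\<^sup>2 * (real (card (stop_words M)) * M\<^sup>2 *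
       (D + (word_count (L * H))\<^sup>2 * real (card \<Theta>) / H ^ Suc k)))"
proof -
  define err where "err = L powr (- 4 * s) + B powr (- 4 * s) + exp (- H)"
  define W
    where "W = real (card (stop_words M)) * M\<^sup>2
        * (D + (word_count (L * H))\<^sup>2 * real (card \<Theta>) / H ^ Suc k)"
  define c
    where "c = dilate_const\<^sup>2 + (stop_mult_const * dilate_const)\<^sup>2
        + (stop_mult_const * exp_sum_const * doubling)\<^sup>2"
  have "0 \<le> W" using D H by (simp add: W_def)
  have "0 \<le> err" by (simp add: err_def add_nonneg_nonneg)
  have "1 * 1 \<le> B * H" using B H by (intro mult_mono) auto
  then obtain n where n: "B * H < 2 ^ n" "real n \<le> 2 + log 2 (B * H)"
    using ex_power2_greater by auto
  let ?P = "\<lambda>\<theta> i. (cmod (bilinear_sum N \<theta> M (dyadic_block (L * H) (L / B) i)))\<^sup>2"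
  have "(\<Sum>\<theta>\<in>\<Theta>. \<Sum>i<n. ?P \<theta> i) \<le> real n * (sieve_const k * W)"
    unfolding W_def using N M L H B \<Theta> D pairs by (intro sum_bilinear_blocks_mean_square_le) auto
  then have "real n * (\<Sum>\<theta>\<in>\<Theta>. \<Sum>i<n. ?P \<theta> i) \<le> real n * (real n * (sieve_const k * W))"
    by (rule mult_left_mono) simp
  also have "\<dots> = (real n)\<^sup>2 * (sieve_const k * W)" by (simp add: power2_eq_square)
  also have "\<dots> \<le> (2 + log 2 (B * H))\<^sup>2 * (sieve_const k * W)"
    using n(2) \<open>0 \<le> W\<close> sieve_const_pos[of k] by (intro mult_right_mono power_mono) auto
  finally have dyadic: "4 * (real n * (\<Sum>\<theta>\<in>\<Theta>. \<Sum>i<n. ?P \<theta> i))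
      \<le> (4 * sieve_const k) * ((2 + log 2 (B * H))\<^sup>2 * W)"
    by (simp add: mult_ac)
  have "(\<Sum>\<theta>\<in>\<Theta>. (cmod (expsum N \<theta>))\<^sup>2)
      \<le> (\<Sum>\<theta>\<in>\<Theta>. 4 * (c * ((word_count N)\<^sup>2 * err)) + 4 * (real n * (\<Sum>i<n. ?P \<theta> i)))"
    unfolding c_def err_def by (intro sum_mono expsum_square_le[OF N M L LM HN B n(1)])
  also have "\<dots> = (4 * c) * ((word_count N)\<^sup>2 * real (card \<Theta>) * err)
      + 4 * (real n * (\<Sum>\<theta>\<in>\<Theta>. \<Sum>i<n. ?P \<theta> i))"
    by (simp add: sum.distrib sum_distrib_left[symmetric])
  also have "\<dots> \<le> (4 * c) * ((word_count N)\<^sup>2 * real (card \<Theta>) * err)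
      + (4 * sieve_const k) * ((2 + log 2 (B * H))\<^sup>2 * W)"
    by (rule add_left_mono[OF dyadic])
  also have "\<dots> \<le> reduction_const k * ((word_count N)\<^sup>2 * real (card \<Theta>) * err)
      + reduction_const k * ((2 + log 2 (B * H))\<^sup>2 * W)"
    using \<open>0 \<le> W\<close> \<open>0 \<le> err\<close> sieve_const_pos[of k]
    by (intro add_mono mult_right_mono) (auto simp: c_def reduction_const_def)
  finally show ?thesis by (simp only: distrib_left err_def W_def)
qed

end

lemma exp_minus_le:
  assumes "0 < x" "0 < n"
  shows "exp (- x) \<le> (real n / x) ^ n"
proof -
  have "x / n \<le> exp (x / n)" using exp_ge_add_one_self[of "x / n"] by linarith
  then have "(x / n) ^ n \<le> exp (x / n) ^ n" using assms by (intro power_mono) auto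
  also have "\<dots> = exp x" using assms(2) by (simp add: exp_of_nat_mult[symmetric])
  finally have "inverse (exp x) \<le> inverse ((x / n) ^ n)"
    using assms by (intro le_imp_inverse_le) auto
  then show ?thesis by (simp add: exp_minus power_inverse[symmetric])
qed

definition log_const :: "real \<Rightarrow> real" where
  "log_const a = (2 + 2 / (a * ln 2))\<^sup>2"

lemma log_square_le_powr:
  fixes a x :: real
  assumes "0 < a" "1 \<le> x"
  shows "(2 + log 2 x)\<^sup>2 \<le> log_const a * x powr a"
proof -
  have "ln x \<le> x powr (a / 2) / (a / 2)" using assms by (intro ln_powr_bound) auto
  then have "log 2 x \<le> x powr (a / 2) / (a / 2) / ln 2"
    unfolding log_def by (intro divide_right_mono) auto
  moreover have "1 \<le> x powr (a / 2)" using assms by (simp add: ge_one_powr_ge_zero)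
  ultimately have "2 + log 2 x \<le> (2 + 2 / (a * ln 2)) * x powr (a / 2)" by (simp add: algebra_simps)
  then have "(2 + log 2 x)\<^sup>2 \<le> ((2 + 2 / (a * ln 2)) * x powr (a / 2))\<^sup>2"
    using assms by (intro power_mono) auto
  also have "\<dots> = log_const a * x powr a"
    by (simp add: log_const_def power_mult_distrib power2_eq_square powr_add[symmetric])
  finally show ?thesis .
qed

context dense_alphabet
begin

text \<open>With \<open>H = R\<^sup>h\<close> the tail of the kernel needs \<open>H\<^sup>k\<close> to beat a fixed power of \<open>R\<close>, hence \<open>k\<close> of
  order \<open>1 / h\<close>.\<close>

definition kernel_order :: "real \<Rightarrow> nat" where
  "kernel_order h = nat \<lceil>2 * growth_exp + 4 / h\<rceil>"

definition truncation_const :: "real \<Rightarrow> real" where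
  "truncation_const h = 2 + real (nat \<lceil>3 / h\<rceil>) ^ nat \<lceil>3 / h\<rceil>"

definition mean_square_const :: "real \<Rightarrow> real" where
  "mean_square_const h = reduction_const (kernel_order h) *
     (12 * truncation_const h + log_const h * (1 + 1200 * square_const * doubling\<^sup>2))"

lemma truncation_const_pos: "0 < truncation_const h"
  unfolding truncation_const_def by (intro add_pos_nonneg) auto

lemma log_const_nonneg: "0 \<le> log_const h"
  by (simp add: log_const_def)

lemma mean_square_const_pos: "0 < mean_square_const h"
  unfolding mean_square_const_def
  using reduction_const_pos square_const_pos truncation_const_pos log_const_nonneg
  by (intro mult_pos_pos add_pos_nonneg) auto

lemma truncation_errors_le:
  assumes R: "1 \<le> R" and h: "0 < h" and L: "R powr (3/4) \<le> L"
  shows "L powr (- 4 * s) + (R powr (3/5)) powr (- 4 * s) + exp (- (R powr h))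
    \<le> truncation_const h * R powr (- 21/10)"
proof -
  define n where "n = nat \<lceil>3 / h\<rceil>"
  have "0 < 3 / h" using h by simp
  then have n: "0 < n" "3 / h \<le> n" unfolding n_def by linarith+
  then have "3 \<le> h * n" using h by (simp add: pos_divide_le_eq mult.commute)
  have R_powr: "R powr a \<le> R powr b" if "a \<le> b" for a b using R that by (intro powr_mono) auto
  have "L powr (- 4 * s) \<le> (R powr (3/4)) powr (- 4 * s)"
    using L R s_gt by (intro powr_mono2') auto
  also have "\<dots> \<le> R powr (- 21/10)" unfolding powr_powr using s_gt by (intro R_powr) auto
  finally have long: "L powr (- 4 * s) \<le> R powr (- 21/10)" .
  have short: "(R powr (3/5)) powr (- 4 * s) \<le> R powr (- 21/10)"
    unfolding powr_powr using s_gt by (intro R_powr) auto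
  have "exp (- (R powr h)) \<le> (real n / R powr h) ^ n" using R n by (intro exp_minus_le) auto
  also have "\<dots> = real n ^ n * R powr (- (h * n))"
  proof -
    have "(R powr h) ^ n = R powr (h * n)" using R by (simp add: powr_powr[symmetric] powr_realpow)
    then show ?thesis unfolding power_divide powr_minus by (simp add: divide_inverse)
  qed
  also have "\<dots> \<le> real n ^ n * R powr (- 21/10)"
    using \<open>3 \<le> h * n\<close> by (intro mult_left_mono R_powr) auto
  finally show ?thesis using long short by (simp add: n_def truncation_const_def algebra_simps)
qed

lemma card_truncation_errors_le:
  assumes R: "1 \<le> R" and h: "0 < h" and L: "R powr (3/4) \<le> L" and \<Theta>: "real (card \<Theta>) \<le> 12 * R\<^sup>2"
  shows "real (card \<Theta>) * (L powr (- 4 * s) + (R powr (3/5)) powr (- 4 * s) + exp (- (R powr h)))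
    \<le> 12 * truncation_const h * R powr (- 1/10)"
proof -
  have "real (card \<Theta>) * (L powr (- 4 * s) + (R powr (3/5)) powr (- 4 * s) + exp (- (R powr h)))
      \<le> (12 * R\<^sup>2) * (truncation_const h * R powr (- 21/10))"
    using \<Theta> truncation_errors_le[OF R h L] by (intro mult_mono) (auto intro!: add_nonneg_nonneg)
  also have "\<dots> = 12 * truncation_const h * (R powr 2 * R powr (- 21/10))"
    using R by (simp add: powr_numeral)
  also have "R powr 2 * R powr (- 21/10) = R powr (- 1/10)" by (simp add: powr_add[symmetric])
  finally show ?thesis .
qed

lemma log_square_le_scale:
  assumes "1 \<le> R" "0 < h" "h \<le> 2/5"
  shows "(2 + log 2 (R powr (3/5) * R powr h))\<^sup>2 \<le> log_const h * R powr h"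
proof -
  have "1 * 1 \<le> R powr (3/5) * R powr h"
    using assms by (intro mult_mono) (auto simp: ge_one_powr_ge_zero)
  then have "(2 + log 2 (R powr (3/5) * R powr h))\<^sup>2
      \<le> log_const h * (R powr (3/5) * R powr h) powr h"
    using assms(2) by (intro log_square_le_powr) auto
  also have "(R powr (3/5) * R powr h) powr h = R powr ((3/5 + h) * h)"
    by (simp add: powr_add[symmetric] powr_powr)
  also have "\<dots> \<le> R powr (1 * h)" using assms by (intro powr_mono mult_right_mono) auto
  finally show ?thesis by (simp add: mult_left_mono log_const_nonneg)
qed

lemma card_stop_words_square_le_scale:
  assumes M: "1 < M" "M \<le> 100 * R ^ 3" and R: "1 \<le> R"
  shows "real (card (stop_words M)) * M\<^sup>2 * (word_count L)\<^sup>2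
      \<le> square_const * (100 * R) * (word_count (M * L))\<^sup>2"
proof -
  have "M powr (2 - 2 * s) \<le> M powr (1/4)" using M(1) s_gt by (intro powr_mono) auto
  also have "\<dots> \<le> (100 * R ^ 3) powr (1/4)" using M by (intro powr_mono2) auto
  also have "\<dots> = 100 powr (1/4) * R powr (3/4)"
    using R by (simp add: powr_mult powr_powr flip: powr_numeral)
  also have "\<dots> \<le> 100 powr 1 * R powr 1" using R by (intro mult_mono powr_mono) auto
  finally have "M powr (2 - 2 * s) \<le> 100 * R" using R by simp
  then have "square_const * M powr (2 - 2 * s) * (word_count (M * L))\<^sup>2
      \<le> square_const * (100 * R) * (word_count (M * L))\<^sup>2"
    using square_const_pos by (intro mult_right_mono mult_left_mono) auto
  then show ?thesis using card_stop_words_square_le[of M L] M(1) by linarith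
qed

lemma kernel_tail_le:
  assumes M: "1 < M" "M \<le> 100 * R ^ 3" and R: "1 \<le> R" and h: "0 < h" and L: "1 \<le> L"
    and \<Theta>: "real (card \<Theta>) \<le> 12 * R\<^sup>2"
    and H: "H = R powr h" and k: "k = kernel_order h"
  shows "H * (real (card (stop_words M)) * M\<^sup>2
      * ((word_count (L * H))\<^sup>2 * real (card \<Theta>) / H ^ Suc k))
    \<le> 1200 * square_const * doubling\<^sup>2 * ((word_count (M * L))\<^sup>2 * R powr (- 1/10))"
proof -
  let ?\<gamma> = "growth_exp"
  have H1: "1 \<le> H" using R h by (simp add: H ge_one_powr_ge_zero)
  have "2 * ?\<gamma> + 4 / h \<le> k" unfolding k kernel_order_def by linarith
  then have "h * (2 * ?\<gamma>) + 4 \<le> h * k" using h by (simp add: field_simps)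
  have "word_count (L * H) \<le> doubling * H powr ?\<gamma> * word_count L"
    using word_count_scale[OF L H1] by (simp add: mult.commute)
  then have "(word_count (L * H))\<^sup>2 \<le> (doubling * H powr ?\<gamma> * word_count L)\<^sup>2"
    using word_count_nonneg by (intro power_mono) auto
  then have "(word_count (L * H))\<^sup>2 * real (card \<Theta>) / H ^ Suc k
      \<le> (doubling * H powr ?\<gamma> * word_count L)\<^sup>2 * (12 * R\<^sup>2) / H ^ Suc k"
    using \<Theta> H1 by (intro divide_right_mono mult_mono) auto
  then have "H * (real (card (stop_words M)) * M\<^sup>2
      * ((word_count (L * H))\<^sup>2 * real (card \<Theta>) / H ^ Suc k))
      \<le> H * (real (card (stop_words M)) * M\<^sup>2
        * ((doubling * H powr ?\<gamma> * word_count L)\<^sup>2 * (12 * R\<^sup>2) / H ^ Suc k))"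
    using H1 by (intro mult_left_mono) auto
  also have "\<dots> = (real (card (stop_words M)) * M\<^sup>2 * (word_count L)\<^sup>2)
      * (12 * doubling\<^sup>2 * (R\<^sup>2 * ((H powr ?\<gamma>)\<^sup>2 / H ^ k)))"
    using H1 by (simp add: power_mult_distrib)
  also have "\<dots> \<le> (square_const * (100 * R) * (word_count (M * L))\<^sup>2)
      * (12 * doubling\<^sup>2 * (R\<^sup>2 * ((H powr ?\<gamma>)\<^sup>2 / H ^ k)))"
    using card_stop_words_square_le_scale[OF M R] H1 by (intro mult_right_mono) auto
  also have "\<dots> = 1200 * square_const * doubling\<^sup>2
      * ((word_count (M * L))\<^sup>2 * (R powr 3 * ((H powr ?\<gamma>)\<^sup>2 / H ^ k)))"
    using R by (simp add: powr_numeral power3_eq_cube power2_eq_square)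
  also have "R powr 3 * ((H powr ?\<gamma>)\<^sup>2 / H ^ k) = R powr (3 + (h * (2 * ?\<gamma>) - h * k))"
  proof -
    have "H ^ k = R powr (h * k)" using R by (simp add: H powr_powr[symmetric] powr_realpow)
    moreover have "(H powr ?\<gamma>)\<^sup>2 = R powr (h * (2 * ?\<gamma>))"
      by (simp add: H powr_powr power2_eq_square powr_add[symmetric] algebra_simps)
    ultimately show ?thesis by (simp only: powr_add powr_diff)
  qed
  also have "\<dots> \<le> R powr (- 1/10)" using \<open>h * (2 * ?\<gamma>) + 4 \<le> h * k\<close> R by (intro powr_mono) auto
  finally show ?thesis using square_const_pos by (simp add: mult_left_mono)
qed

text \<open>Each frequency set is described by one parameter \<open>R\<close> with about \<open>R\<^sup>2\<close> grid points:
  \<open>R = Q K\<close> on a major arc and \<open>R = N\<^sup>1\<^sup>/\<^sup>2\<close> on the minor arcs.\<close>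

lemma mean_square_le:
  assumes N: "0 < N" and M: "1 < M" "M \<le> 100 * R ^ 3" and R: "1 \<le> R" and h: "0 < h" "h \<le> 2/5"
    and LM: "M * L = real N" and L: "R powr (3/4) \<le> L" and H: "H = R powr h"
    and HN: "2 * step_ratio * H \<le> N"
    and \<Theta>: "finite \<Theta>" "real (card \<Theta>) \<le> 12 * R\<^sup>2" and D: "0 \<le> D"
    and pairs: "near_pairs_bounded (H / M) \<Theta> (L / R powr (3/5)) (L * H) D"
  shows "(\<Sum>\<theta>\<in>\<Theta>. (cmod (expsum N \<theta>))\<^sup>2) \<le> mean_square_const h *
    ((word_count N)\<^sup>2 * R powr (- 1/10) + H * (real (card (stop_words M)) * M\<^sup>2) * D)"
proof -
  define B where "B = R powr (3/5)"
  define k where "k = kernel_order h"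
  define t where "t = 1200 * square_const * doubling\<^sup>2"
  define main where "main = H * (real (card (stop_words M)) * M\<^sup>2) * D"
  define decay where "decay = (word_count N)\<^sup>2 * R powr (- 1/10)"
  let ?tail = "(word_count (L * H))\<^sup>2 * real (card \<Theta>) / H ^ Suc k"
    and ?f = "real (card (stop_words M)) * M\<^sup>2"
  have H1: "1 \<le> H" and B1: "1 \<le> B" using R h by (simp_all add: H B_def ge_one_powr_ge_zero)
  have "1 \<le> R powr (3/4)" using R by (simp add: ge_one_powr_ge_zero)
  then have L1: "1 \<le> L" using L by linarith
  have nonneg: "0 \<le> t" "0 \<le> main" "0 \<le> decay"
    using square_const_pos D H1 by (auto simp: t_def main_def decay_def)
  have truncation: "(word_count N)\<^sup>2 * real (card \<Theta>)
      * (L powr (- 4 * s) + B powr (- 4 * s) + exp (- H)) \<le> 12 * truncation_const h * decay"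
    using mult_left_mono[OF card_truncation_errors_le[OF R h(1) L \<Theta>(2)], of "(word_count N)\<^sup>2"]
    by (simp add: B_def H decay_def mult_ac)
  have "(2 + log 2 (B * H))\<^sup>2 * (?f * (D + ?tail)) \<le> (log_const h * H) * (?f * (D + ?tail))"
    using log_square_le_scale[OF R h] D H1 unfolding B_def H by (intro mult_right_mono) auto
  also have "\<dots> = log_const h * (main + H * (?f * ?tail))"
    by (simp only: main_def distrib_left mult_ac)
  also have "\<dots> \<le> log_const h * (main + t * decay)"
    using kernel_tail_le[OF M R h(1) L1 \<Theta>(2) H k_def] log_const_nonneg
    by (intro mult_left_mono add_left_mono) (simp_all add: t_def decay_def LM)
  finally have sieve: "(2 + log 2 (B * H))\<^sup>2 * (?f * (D + ?tail))
      \<le> log_const h * (main + t * decay)" .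
  have "(\<Sum>\<theta>\<in>\<Theta>. (cmod (expsum N \<theta>))\<^sup>2)
      \<le> reduction_const k * (12 * truncation_const h * decay + log_const h * (main + t * decay))"
    using mean_square_reduction[OF N M(1) L1 LM H1 B1 HN \<Theta>(1) D, of k] pairs
      truncation sieve reduction_const_pos[of k]
    unfolding B_def by (smt (verit) mult_left_mono)
  also have "\<dots> \<le> reduction_const k
      * ((12 * truncation_const h + log_const h * (1 + t)) * (decay + main))"
    using nonneg truncation_const_pos[of h] log_const_nonneg[of h] reduction_const_pos[of k]
    by (intro mult_left_mono) (simp_all add: algebra_simps)
  finally show ?thesis
    by (simp only: mean_square_const_def main_def decay_def t_def k_def mult.assoc)
qed

subsection \<open>The major arcs\<close>

definition major_exp :: real where
  "major_exp = 1 / (8 * (2 * growth_exp + 4))"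

definition major_pairs_const :: real where
  "major_pairs_const = 60 * class_const * cut_const\<^sup>2 * dilate_const"

definition major_const :: real where
  "major_const = mean_square_const major_exp * (1 + 100 * square_const * major_pairs_const)"

lemma major_exp_bounds: "0 < major_exp" "major_exp \<le> 1/48" "major_exp * (2 * growth_exp + 4) = 1/8"
  using growth_exp_ge_1 by (auto simp: major_exp_def field_simps)

lemma major_pairs_const_pos: "0 < major_pairs_const"
  using class_const_pos cut_const_pos dilate_const_pos by (simp add: major_pairs_const_def)

lemma major_const_pos: "0 < major_const"
  using mean_square_const_pos[of major_exp] square_const_pos major_pairs_const_pos
  by (simp add: major_const_def add_pos_nonneg)

lemma card_dyadic_mult_le:
  assumes "1 \<le> L" "0 < X" "1 \<le> H" "X \<le> L * H" "V \<subseteq> dyadic_words X"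
  shows "real (card V) * (1 + H * L / X) \<le> cut_const * H powr (growth_exp + 1) * word_count L"
proof -
  have "real (card V) \<le> word_count (2 * X / 1)"
    using assms(5) dyadic_words_subset[of X] by (intro card_le_word_count) auto
  then have "real (card V) * (1 + H * L / X) \<le> word_count (2 * X / 1) * (1 + H * L / X)"
    using assms by (intro mult_right_mono) auto
  also have "\<dots> \<le> cut_const * H powr (growth_exp + 1) * word_count (L / 1)"
    using assms by (intro word_count_cut) auto
  finally show ?thesis by simp
qed

lemma card_dyadic_mult_word_count_le:
  assumes "1 \<le> G" "G \<le> L" "0 < X" "1 \<le> H" "X \<le> L * H" "V \<subseteq> dyadic_words X"
  shows "real (card V) * ((1 + H * L / X)\<^sup>2 * word_count (2 * X / G))
    \<le> cut_const\<^sup>2 * dilate_const * H powr (2 * growth_exp + 2) * (word_count L)\<^sup>2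
      * G powr (- 2 * s)"
proof -
  define \<Lambda> where "\<Lambda> = 1 + H * L / X"
  define U where "U = cut_const * H powr (growth_exp + 1)"
  have L: "1 \<le> L" using assms by linarith
  then have "0 \<le> \<Lambda>" "0 \<le> U" using assms cut_const_pos by (auto simp: \<Lambda>_def U_def)
  have word: "real (card V) * \<Lambda> \<le> U * word_count L"
    unfolding \<Lambda>_def U_def using L assms by (intro card_dyadic_mult_le) auto
  have partner: "word_count (2 * X / G) * \<Lambda> \<le> U * (dilate_const * G powr (- 2 * s) * word_count L)"
  proof -
    have "word_count (2 * X / G) * \<Lambda> \<le> U * word_count (L / G)"
      unfolding \<Lambda>_def U_def using assms by (intro word_count_cut) auto
    also have "\<dots> \<le> U * (dilate_const * G powr (- 2 * s) * word_count L)"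
      using word_count_le_dilate[OF assms(1), of "L / G"] assms(1) \<open>0 \<le> U\<close>
      by (intro mult_left_mono) auto
    finally show ?thesis .
  qed
  have "(real (card V) * \<Lambda>) * (word_count (2 * X / G) * \<Lambda>)
      \<le> (U * word_count L) * (U * (dilate_const * G powr (- 2 * s) * word_count L))"
    using \<open>0 \<le> \<Lambda>\<close> \<open>0 \<le> U\<close> word_count_nonneg by (intro mult_mono[OF word partner]) auto
  also have "\<dots> = cut_const\<^sup>2 * dilate_const * (H powr (growth_exp + 1) * H powr (growth_exp + 1))
      * (word_count L)\<^sup>2 * G powr (- 2 * s)"
    by (simp add: U_def power2_eq_square)
  also have "H powr (growth_exp + 1) * H powr (growth_exp + 1) = H powr (2 * growth_exp + 2)"
    by (simp add: powr_add[symmetric])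
  finally show ?thesis by (simp add: \<Lambda>_def power2_eq_square mult_ac)
qed

lemma major_powr_le:
  assumes "1 \<le> Q" "1 \<le> K"
  shows "Q powr (4 - 4 * s) * K powr (2 - 2 * s) * ((sqrt K * Q) powr (- 2 * s) * Q)
      \<le> (Q * K) powr (- 1/4)"
proof -
  have "(sqrt K * Q) powr (- 2 * s) = K powr (- s) * Q powr (- 2 * s)"
    using assms by (simp add: powr_mult powr_half_sqrt[symmetric] powr_powr)
  then have "Q powr (4 - 4 * s) * K powr (2 - 2 * s) * ((sqrt K * Q) powr (- 2 * s) * Q)
      = (Q powr (4 - 4 * s) * Q powr (- 2 * s) * Q powr 1) * (K powr (2 - 2 * s) * K powr (- s))"
    using assms by simp
  also have "\<dots> = Q powr (5 - 6 * s) * K powr (2 - 3 * s)"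
    unfolding powr_add[symmetric] by (simp add: algebra_simps)
  also have "\<dots> \<le> Q powr (- 1/4) * K powr (- 1/4)"
    using assms s_gt by (intro mult_mono powr_mono) auto
  also have "\<dots> = (Q * K) powr (- 1/4)" using assms by (simp add: powr_mult)
  finally show ?thesis .
qed

lemma sieve_scale_powr_le:
  assumes "1 \<le> Q" "1 \<le> K" "1 \<le> H"
  shows "(100 * (Q\<^sup>2 * K * H)) powr (2 - 2 * s)
      \<le> 100 * (Q powr (4 - 4 * s) * K powr (2 - 2 * s)) * H"
proof -
  have "(Q\<^sup>2) powr (2 - 2 * s) = Q powr (4 - 4 * s)"
    using assms by (simp add: powr_numeral[symmetric] powr_powr algebra_simps del: powr_numeral)
  then have "(100 * (Q\<^sup>2 * K * H)) powr (2 - 2 * s)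
      = 100 powr (2 - 2 * s) * (Q powr (4 - 4 * s) * K powr (2 - 2 * s)) * H powr (2 - 2 * s)"
    using assms by (simp add: powr_mult)
  also have "\<dots> \<le> 100 powr 1 * (Q powr (4 - 4 * s) * K powr (2 - 2 * s)) * H powr 1"
    using s_gt assms by (intro mult_mono mult_right_mono powr_mono) auto
  finally show ?thesis using assms by simp
qed

end

locale major_scale = dense_alphabet +
  fixes N :: nat and Q K R H M L :: real
  assumes Q_ge_1: "1 \<le> Q" and K_ge_1: "1 \<le> K" and N_ge: "200 * step_ratio * R powr (37/10) \<le> real N"
    and R_eq: "R = Q * K" and H_eq: "H = R powr major_exp"
    and M_eq: "M = 100 * (Q\<^sup>2 * K * H)" and L_eq: "L = real N / M"
begin

definition pairs_bound :: real where
  "pairs_bound = major_pairs_const * H powr (2 * growth_exp + 2) * (word_count L)\<^sup>2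
      * ((sqrt K * Q) powr (- 2 * s) * Q)"

lemma R_bounds: "1 \<le> R" "Q \<le> R" "K \<le> R"
proof -
  have "Q * 1 \<le> R" "1 * K \<le> R" unfolding R_eq using Q_ge_1 K_ge_1 by (intro mult_mono; simp)+
  then show "1 \<le> R" "Q \<le> R" "K \<le> R" using Q_ge_1 by auto
qed

lemma H_ge_1: "1 \<le> H"
  using R_bounds(1) major_exp_bounds(1) by (simp add: H_eq ge_one_powr_ge_zero)

lemma M_gt_1: "1 < M"
proof -
  have "1 * 1 * 1 \<le> Q\<^sup>2 * K * H"
    using Q_ge_1 K_ge_1 H_ge_1 by (intro mult_mono) (auto simp: one_le_power)
  then show ?thesis by (simp add: M_eq)
qed

lemma M_mult_L: "M * L = real N"
  using M_gt_1 by (simp add: L_eq)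

lemma Q_square_K_le: "Q\<^sup>2 * K \<le> R\<^sup>2"
  using R_bounds(2) Q_ge_1 K_ge_1 mult_left_mono[OF R_bounds(2), of R]
  by (simp add: R_eq power2_eq_square mult_ac)

lemma sqrt_K_Q_bounds: "1 \<le> sqrt K * Q" "sqrt K * Q \<le> R"
  using mult_mono[of 1 "sqrt K" 1 Q] mult_right_mono[of "sqrt K" K Q] Q_ge_1 K_ge_1
  by (simp_all add: R_eq mult.commute real_le_lsqrt power2_eq_square)

lemma M_le: "M \<le> 100 * R powr (2 + major_exp)"
proof -
  have "Q\<^sup>2 * K * H \<le> R\<^sup>2 * H" using Q_square_K_le H_ge_1 by (intro mult_right_mono) auto
  also have "\<dots> = R powr (2 + major_exp)" using R_bounds(1) by (simp add: H_eq powr_add powr_numeral)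
  finally show ?thesis by (simp add: M_eq)
qed

lemma L_ge:
  assumes "e \<le> 8/5"
  shows "2 * step_ratio * R powr e \<le> L"
proof -
  have "2 * step_ratio * R powr e * M \<le> 2 * step_ratio * R powr e * (100 * R powr (2 + major_exp))"
    using M_le step_ratio_ge_2 by (intro mult_left_mono) auto
  also have "\<dots> = 200 * step_ratio * R powr (e + (2 + major_exp))" by (simp add: powr_add)
  also have "\<dots> \<le> 200 * step_ratio * R powr (37/10)"
    using R_bounds(1) assms major_exp_bounds(2) step_ratio_ge_2
    by (intro mult_left_mono powr_mono) auto
  also have "\<dots> \<le> N" by (rule N_ge)
  finally show ?thesis using M_gt_1 by (simp add: L_eq pos_le_divide_eq)
qed

lemma R_le_L: "R \<le> L"
proof -
  have "1 * R \<le> 2 * step_ratio * R"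
    using step_ratio_ge_2 R_bounds(1) by (intro mult_right_mono) auto
  also have "\<dots> \<le> L" using L_ge[of 1] R_bounds(1) by simp
  finally show ?thesis by simp
qed

lemma L_le_N: "L \<le> real N"
proof -
  have "1 * L \<le> M * L" using M_gt_1 R_le_L R_bounds(1) by (intro mult_right_mono) auto
  then show ?thesis using M_mult_L by simp
qed

lemma N_pos: "0 < N"
  using L_le_N R_le_L R_bounds(1) by linarith

lemma near_pairs_gap:
  assumes "X \<le> L * H"
  shows "H / M + 4 * K * X / N < 1 / Q\<^sup>2"
proof -
  have L: "0 < L" using R_le_L R_bounds(1) by linarith
  have "4 * K * X / N \<le> 4 * K * (L * H) / N"
    using assms K_ge_1 by (intro divide_right_mono mult_left_mono) auto
  also have "\<dots> = 4 * K * (H / M)" unfolding M_mult_L[symmetric] using L by simp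
  finally have "H / M + 4 * K * X / N \<le> (1 + 4 * K) * (H / M)" by (simp add: algebra_simps)
  also have "\<dots> \<le> (5 * K) * (H / M)" using K_ge_1 H_ge_1 M_gt_1 by (intro mult_right_mono) auto
  also have "\<dots> = 5 / 100 * (1 / Q\<^sup>2)" using K_ge_1 H_ge_1 Q_ge_1 by (simp add: M_eq field_simps)
  also have "\<dots> < 1 / Q\<^sup>2" using Q_ge_1 by (simp add: field_simps)
  finally show ?thesis .
qed

lemma dyadic_range_ge:
  assumes "L / R powr (3/5) \<le> X"
  shows "2 * step_ratio * sqrt K * Q \<le> X"
proof -
  have "2 * step_ratio * (sqrt K * Q) \<le> 2 * step_ratio * R"
    using sqrt_K_Q_bounds(2) step_ratio_ge_2 by (intro mult_left_mono) auto
  also have "\<dots> = 2 * step_ratio * R powr (8/5) / R powr (3/5)"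
    using R_bounds(1) powr_diff[of R "8/5" "3/5"] by (simp flip: times_divide_eq_right)
  also have "\<dots> \<le> L / R powr (3/5)" using L_ge[of "8/5"] by (intro divide_right_mono) auto
  also have "\<dots> \<le> X" by (rule assms)
  finally show ?thesis by (simp only: mult.assoc)
qed

lemma near_pairs_le_pairs_bound:
  assumes \<theta>: "\<theta> \<in> major_arcs N Q K" and X: "L / R powr (3/5) \<le> X" "X \<le> L * H"
    and V: "V \<subseteq> dyadic_words X"
  shows "near_pairs (H / M) (major_arcs N Q K) V \<theta> \<le> pairs_bound"
proof -
  let ?W = "word_count (2 * X / (sqrt K * Q))"
  have "0 < L / R powr (3/5)" using R_bounds(1) R_le_L by simp
  then have X0: "0 < X" using X(1) by linarith
  have "near_pairs (H / M) (major_arcs N Q K) V \<theta>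
      \<le> real (card V) * (60 * class_const * (1 + H / M * N / X)\<^sup>2 * ?W * Q)"
    using dyadic_range_ge[OF X(1)] near_pairs_gap[OF X(2)] H_ge_1 M_gt_1
    by (intro major_arcs_near_pairs_le N_pos Q_ge_1 K_ge_1 X0 \<theta> V) auto
  also have "1 + H / M * N / X = 1 + H * L / X" unfolding M_mult_L[symmetric] using M_gt_1 by simp
  also have "real (card V) * (60 * class_const * (1 + H * L / X)\<^sup>2 * ?W * Q)
      = 60 * class_const * Q * (real (card V) * ((1 + H * L / X)\<^sup>2 * ?W))" by simp
  also have "\<dots> \<le> 60 * class_const * Q *
      (cut_const\<^sup>2 * dilate_const * H powr (2 * growth_exp + 2) * (word_count L)\<^sup>2
        * (sqrt K * Q) powr (- 2 * s))"
    using sqrt_K_Q_bounds R_le_L X(2) V X0 H_ge_1 Q_ge_1 class_const_pos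
    by (intro mult_left_mono card_dyadic_mult_word_count_le) auto
  also have "\<dots> = pairs_bound" by (simp add: pairs_bound_def major_pairs_const_def)
  finally show ?thesis .
qed

lemma card_stop_words_square_le_QKH:
  "real (card (stop_words M)) * M\<^sup>2 * (word_count L)\<^sup>2
    \<le> 100 * square_const * (Q powr (4 - 4 * s) * K powr (2 - 2 * s)) * H * (word_count N)\<^sup>2"
proof -
  have "real (card (stop_words M)) * M\<^sup>2 * (word_count L)\<^sup>2
      \<le> square_const * M powr (2 - 2 * s) * (word_count N)\<^sup>2"
    using card_stop_words_square_le[of M L] M_gt_1 by (simp add: M_mult_L)
  also have "\<dots> \<le> square_const * (100 * (Q powr (4 - 4 * s) * K powr (2 - 2 * s)) * H)
      * (word_count N)\<^sup>2"
    unfolding M_eq using sieve_scale_powr_le[OF Q_ge_1 K_ge_1 H_ge_1] square_const_pos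
    by (intro mult_right_mono mult_left_mono) auto
  finally show ?thesis by (simp only: mult_ac)
qed

lemma powr_saving_le:
  "H powr (2 * growth_exp + 4)
      * (Q powr (4 - 4 * s) * K powr (2 - 2 * s) * ((sqrt K * Q) powr (- 2 * s) * Q))
    \<le> R powr (- 1/10)"
proof -
  have "H powr (2 * growth_exp + 4) = R powr (1/8)"
    by (simp only: H_eq powr_powr major_exp_bounds(3))
  then have "H powr (2 * growth_exp + 4)
      * (Q powr (4 - 4 * s) * K powr (2 - 2 * s) * ((sqrt K * Q) powr (- 2 * s) * Q))
      \<le> R powr (1/8) * R powr (- 1/4)"
    using major_powr_le[OF Q_ge_1 K_ge_1] by (simp add: R_eq mult_left_mono)
  also have "\<dots> = R powr (- 1/8)" by (simp add: powr_add[symmetric])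
  also have "\<dots> \<le> R powr (- 1/10)" using R_bounds(1) by (intro powr_mono) auto
  finally show ?thesis .
qed

lemma main_term_le:
  "H * (real (card (stop_words M)) * M\<^sup>2) * pairs_bound
    \<le> 100 * square_const * major_pairs_const * ((word_count N)\<^sup>2 * R powr (- 1/10))"
proof -
  let ?\<gamma> = "growth_exp" and ?G = "(sqrt K * Q) powr (- 2 * s) * Q"
    and ?P = "Q powr (4 - 4 * s) * K powr (2 - 2 * s)"
  have "H * (real (card (stop_words M)) * M\<^sup>2) * pairs_bound
      = (real (card (stop_words M)) * M\<^sup>2 * (word_count L)\<^sup>2)
        * (H * H powr (2 * ?\<gamma> + 2) * (major_pairs_const * ?G))"
    by (simp add: pairs_bound_def)
  also have "\<dots> \<le> (100 * square_const * ?P * H * (word_count N)\<^sup>2)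
      * (H * H powr (2 * ?\<gamma> + 2) * (major_pairs_const * ?G))"
    using H_ge_1 Q_ge_1 major_pairs_const_pos
    by (intro mult_right_mono card_stop_words_square_le_QKH) auto
  also have "\<dots> = 100 * square_const * major_pairs_const *
      ((word_count N)\<^sup>2 * ((H powr 1 * H powr 1 * H powr (2 * ?\<gamma> + 2)) * (?P * ?G)))"
    using H_ge_1 by simp
  also have "H powr 1 * H powr 1 * H powr (2 * ?\<gamma> + 2) = H powr (2 * ?\<gamma> + 4)"
    unfolding powr_add[symmetric] by (simp add: algebra_simps)
  finally show ?thesis
    using powr_saving_le square_const_pos major_pairs_const_pos
    by (smt (verit) mult_left_mono mult_nonneg_nonneg zero_le_power2)
qed

lemma mean_square:
  "(\<Sum>\<theta>\<in>major_arcs N Q K. (cmod (expsum N \<theta>))\<^sup>2)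
      \<le> major_const * ((word_count N)\<^sup>2 * R powr (- 1/10))"
proof -
  have "(\<Sum>\<theta>\<in>major_arcs N Q K. (cmod (expsum N \<theta>))\<^sup>2) \<le> mean_square_const major_exp *
      ((word_count N)\<^sup>2 * R powr (- 1/10) + H * (real (card (stop_words M)) * M\<^sup>2) * pairs_bound)"
  proof (rule mean_square_le[OF N_pos M_gt_1 _ R_bounds(1) major_exp_bounds(1) _ M_mult_L _ H_eq])
    have "R powr (2 + major_exp) \<le> R powr 3"
      using R_bounds(1) major_exp_bounds(2) by (intro powr_mono) auto
    then show "M \<le> 100 * R ^ 3" using M_le R_bounds(1) by (simp add: powr_numeral)
    have "R powr (3/4) \<le> R powr 1" using R_bounds(1) by (intro powr_mono) auto
    then show "R powr (3/4) \<le> L" using R_le_L R_bounds(1) by simp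
    show "2 * step_ratio * H \<le> N"
      using L_ge[of major_exp] L_le_N major_exp_bounds(2) by (simp add: H_eq)
    show "finite (major_arcs N Q K)"
      using major_arcs_subset_grid finite_grid by (rule finite_subset)
    have "real (card (major_arcs N Q K)) \<le> 12 * (Q\<^sup>2 * K)"
      using R_bounds(3) R_le_L L_le_N by (intro card_major_arcs_le N_pos Q_ge_1 K_ge_1) auto
    then show "real (card (major_arcs N Q K)) \<le> 12 * R\<^sup>2" using Q_square_K_le by linarith
    show "0 \<le> pairs_bound" using major_pairs_const_pos Q_ge_1 by (simp add: pairs_bound_def)
  qed (use major_exp_bounds(2) near_pairs_le_pairs_bound in \<open>auto simp: near_pairs_bounded_def\<close>)
  also have "\<dots> \<le> mean_square_const major_exp *
      ((word_count N)\<^sup>2 * R powr (- 1/10)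
        + 100 * square_const * major_pairs_const * ((word_count N)\<^sup>2 * R powr (- 1/10)))"
    using main_term_le mean_square_const_pos[of major_exp]
    by (intro mult_left_mono add_left_mono) auto
  also have "\<dots> = major_const * ((word_count N)\<^sup>2 * R powr (- 1/10))"
    by (simp add: major_const_def algebra_simps)
  finally show ?thesis .
qed

end

lemma (in dense_alphabet) major_arcs_mean_square:
  assumes "1 \<le> Q" "1 \<le> K" "200 * step_ratio * (Q * K) powr (37/10) \<le> real N"
  shows "(\<Sum>\<theta>\<in>major_arcs N Q K. (cmod (expsum N \<theta>))\<^sup>2)
      \<le> major_const * ((word_count N)\<^sup>2 * (Q * K) powr (- 1/10))"
proof -
  define H where "H = (Q * K) powr major_exp"
  define M where "M = 100 * (Q\<^sup>2 * K * H)"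
  interpret major_scale A s c\<^sub>0 N Q K "Q * K" H M "real N / M"
    by unfold_locales (use assms in \<open>auto simp: H_def M_def\<close>)
  show ?thesis by (rule mean_square)
qed

subsection \<open>The minor arcs\<close>

definition minor_arcs :: "nat \<Rightarrow> real set" where
  "minor_arcs N = {\<theta> \<in> grid N. \<exists>a q::int. coprime a q \<and> 0 < q \<and> real N powr (1/4) \<le> q \<and>
     real_of_int q \<le> real N powr (3/4) \<and> \<bar>\<theta> - a / q\<bar> \<le> 1 / (real_of_int q)\<^sup>2}"

lemma minor_arcs_subset_grid: "minor_arcs N \<subseteq> grid N"
  by (auto simp: minor_arcs_def)

context dense_alphabet
begin

text \<open>The saving \<open>N powr (s - 7/8)\<close> of the main term pays for \<open>growth_exp + 6\<close> powers of
  \<open>H = N powr (minor_exp / 2)\<close>.\<close>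

definition minor_exp :: real where
  "minor_exp = 2 * (s - 7/8) / (growth_exp + 6)"

definition minor_pairs_const :: real where
  "minor_pairs_const = 7920 * cut_const"

definition minor_const :: real where
  "minor_const = mean_square_const minor_exp
      * (1 + dilate_const * square_const * minor_pairs_const)"

lemma minor_exp_bounds: "0 < minor_exp" "minor_exp \<le> 1/8"
  "minor_exp * (growth_exp + 6) = 2 * (s - 7/8)"
  using growth_exp_ge_1 s_gt s_less by (auto simp: minor_exp_def field_simps)

lemma minor_pairs_const_pos: "0 < minor_pairs_const"
  using cut_const_pos by (simp add: minor_pairs_const_def)

lemma minor_const_pos: "0 < minor_const"
  using mean_square_const_pos[of minor_exp] square_const_pos dilate_const_pos minor_pairs_const_pos
  by (simp add: minor_const_def add_pos_nonneg)

end

locale minor_scale = dense_alphabet +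
  fixes N :: nat and R H M L :: real
  assumes N_ge: "17 ^ 8 \<le> real N" "(2 * step_ratio)\<^sup>2 \<le> real N"
    and R_eq: "R = real N powr (1/2)" and H_eq: "H = real N powr (minor_exp / 2)"
    and M_eq: "M = real N powr (5/8)" and L_eq: "L = real N powr (3/8)"
begin

definition pairs_bound :: real where
  "pairs_bound = minor_pairs_const * H powr (growth_exp + 5) * word_count L * R"

lemma N_gt_1: "1 < real N"
  using N_ge(1) by (rule less_le_trans[rotated]) simp

lemma N_powr_mono: "a \<le> b \<Longrightarrow> real N powr a \<le> real N powr b"
  using N_gt_1 by (intro powr_mono) auto

lemma scale_ge_1: "1 \<le> R" "1 \<le> H" "1 < M" "1 \<le> L"
  using N_gt_1 minor_exp_bounds(1) by (auto simp: R_eq H_eq M_eq L_eq ge_one_powr_ge_zero)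

lemma M_mult_L: "M * L = real N"
  using N_gt_1 by (simp add: M_eq L_eq powr_add[symmetric])

lemma R_square: "R\<^sup>2 = real N"
  using N_gt_1 by (simp add: R_eq power2_eq_square powr_add[symmetric])

lemma H_eq_R_powr: "H = R powr minor_exp"
  by (simp add: H_eq R_eq powr_powr)

lemma H_square_less: "16 * H\<^sup>2 < real N powr (1/4)"
proof -
  have "17 = ((17::real) ^ 8) powr (1/8)"
    by (simp add: powr_realpow[symmetric] powr_powr del: powr_numeral)
  also have "\<dots> \<le> real N powr (1/8)" using N_ge(1) by (intro powr_mono2) auto
  finally have "17 * real N powr (1/8) \<le> real N powr (1/8) * real N powr (1/8)"
    by (intro mult_right_mono) auto
  moreover have "H\<^sup>2 \<le> real N powr (1/8)"
    unfolding H_eq power2_eq_square powr_add[symmetric] using minor_exp_bounds(2)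
    by (intro N_powr_mono) simp
  moreover have "0 < real N powr (1/8)" using N_gt_1 by simp
  ultimately have "16 * H\<^sup>2 < real N powr (1/8) * real N powr (1/8)" by linarith
  then show ?thesis by (simp add: powr_add[symmetric])
qed

lemma block_count_le:
  fixes q :: real
  assumes q: "real N powr (1/4) \<le> q" and X: "0 < X" "X \<le> L * H"
  shows "8 * X\<^sup>2 / q + 2 \<le> H\<^sup>2 * (8 * (real N powr (3/4) / q) + 2)"
proof -
  have "0 < real N powr (1/4)" using N_gt_1 by simp
  then have "0 < q" using q by linarith
  have "X\<^sup>2 \<le> (L * H)\<^sup>2" using X by (intro power_mono) auto
  moreover have "L\<^sup>2 = real N powr (3/4)" by (simp add: L_eq power2_eq_square powr_add[symmetric])
  ultimately have "X\<^sup>2 / q \<le> H\<^sup>2 * (real N powr (3/4) / q)"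
    using \<open>0 < q\<close> by (simp add: power_mult_distrib divide_right_mono mult.commute)
  moreover have "1 \<le> H\<^sup>2" using scale_ge_1(2) by simp
  ultimately have "8 * (X\<^sup>2 / q) + 2 \<le> 8 * (H\<^sup>2 * (real N powr (3/4) / q)) + 2 * H\<^sup>2" by linarith
  then show ?thesis by (simp add: algebra_simps)
qed

lemma block_size_le:
  fixes q :: real
  assumes q: "0 \<le> q" and X: "X \<le> L * H"
  shows "8 * (H / M * X) * q + 3 \<le> H\<^sup>2 * (8 * (real N powr (- 1/4) * q) + 3)"
proof -
  have "H / M * X \<le> H / M * (L * H)" using X scale_ge_1(2,3) by (intro mult_left_mono) auto
  also have "\<dots> = H\<^sup>2 * (L / M)" by (simp add: power2_eq_square)
  also have "L / M = real N powr (- 1/4)" by (simp add: L_eq M_eq powr_diff[symmetric])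
  finally have "H / M * X * q \<le> H\<^sup>2 * real N powr (- 1/4) * q"
    using q by (intro mult_right_mono) auto
  moreover have "1 \<le> H\<^sup>2" using scale_ge_1(2) by simp
  ultimately have "8 * (H / M * X * q) + 3 \<le> 8 * (H\<^sup>2 * real N powr (- 1/4) * q) + 3 * H\<^sup>2"
    by linarith
  then show ?thesis by (simp only: distrib_left mult_ac)
qed

lemma determinant_count_le:
  fixes q :: real
  assumes q: "real N powr (1/4) \<le> q" "q \<le> real N powr (3/4)" and X: "0 < X" "X \<le> L * H"
  shows "(8 * X\<^sup>2 / q + 2) * (8 * (H / M * X) * q + 3) \<le> H ^ 4 * (110 * R)"
proof -
  have "0 < real N powr (1/4)" using N_gt_1 by simp
  then have q0: "0 < q" using q(1) by linarith
  have "real N powr (3/4) / q \<le> real N powr (3/4) / real N powr (1/4)"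
    using q(1) q0 N_gt_1 by (intro divide_left_mono) auto
  then have quotient: "real N powr (3/4) / q \<le> R" by (simp add: R_eq powr_diff[symmetric])
  have "real N powr (- 1/4) * q \<le> real N powr (- 1/4) * real N powr (3/4)"
    using q(2) by (intro mult_left_mono) auto
  then have multiple: "real N powr (- 1/4) * q \<le> R" by (simp add: R_eq powr_add[symmetric])
  have "(8 * X\<^sup>2 / q + 2) * (8 * (H / M * X) * q + 3)
      \<le> (H\<^sup>2 * (8 * (real N powr (3/4) / q) + 2)) * (H\<^sup>2 * (8 * (real N powr (- 1/4) * q) + 3))"
    using q q0 X scale_ge_1(2,3) by (intro mult_mono block_count_le block_size_le) auto
  also have "\<dots> = H ^ 4
      * (64 * (real N powr (3/4) * real N powr (- 1/4)) + 24 * (real N powr (3/4) / q)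
      + 16 * (real N powr (- 1/4) * q) + 6)"
    using q0 by (simp add: field_simps power2_eq_square power4_eq_xxxx)
  also have "real N powr (3/4) * real N powr (- 1/4) = R" by (simp add: R_eq powr_add[symmetric])
  also have "H ^ 4 * (64 * R + 24 * (real N powr (3/4) / q) + 16 * (real N powr (- 1/4) * q) + 6)
      \<le> H ^ 4 * (110 * R)"
  proof (rule mult_left_mono)
    show "64 * R + 24 * (real N powr (3/4) / q) + 16 * (real N powr (- 1/4) * q) + 6 \<le> 110 * R"
      using quotient multiple scale_ge_1(1) by linarith
  qed simp
  finally show ?thesis .
qed

lemma near_pairs_gap:
  assumes "X \<le> L * H"
  shows "16 * (H / M) * X < 1"
proof -
  have "16 * (H / M) * X \<le> 16 * (H / M) * (L * H)"
    using assms scale_ge_1(2,3) by (intro mult_left_mono) auto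
  also have "\<dots> = 16 * H\<^sup>2 * (L / M)" by (simp add: power2_eq_square)
  also have "L / M = 1 / real N powr (1/4)"
    by (simp add: L_eq M_eq powr_diff[symmetric] powr_minus_divide[symmetric])
  also have "16 * H\<^sup>2 * (1 / real N powr (1/4)) < 1" using H_square_less N_gt_1 by simp
  finally show ?thesis .
qed

lemma near_pairs_le_pairs_bound:
  assumes \<theta>: "\<theta> \<in> minor_arcs N" and X: "0 < X" "X \<le> L * H" and V: "V \<subseteq> dyadic_words X"
  shows "near_pairs (H / M) (minor_arcs N) V \<theta> \<le> pairs_bound"
proof -
  obtain a q :: int where aq: "coprime a q" "0 < q" "real N powr (1/4) \<le> q" "q \<le> real N powr (3/4)"
    "\<bar>\<theta> - a / q\<bar> \<le> 1 / (real_of_int q)\<^sup>2" using \<theta> unfolding minor_arcs_def by blast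
  have "near_pairs (H / M) (minor_arcs N) V \<theta>
      \<le> real (card V) * (72 * (1 + H / M * N / X)
        * ((8 * X\<^sup>2 / q + 2) * (8 * (H / M) * X * q + 3)))"
    using N_gt_1 aq(1,2,5) X scale_ge_1(2,3) near_pairs_gap[OF X(2)] minor_arcs_subset_grid V
    by (intro minor_near_pairs_le) auto
  also have "1 + H / M * N / X = 1 + H * L / X"
    unfolding M_mult_L[symmetric] using scale_ge_1(3) by simp
  also have "real (card V)
      * (72 * (1 + H * L / X) * ((8 * X\<^sup>2 / q + 2) * (8 * (H / M) * X * q + 3)))
      = 72 * ((real (card V) * (1 + H * L / X)) * ((8 * X\<^sup>2 / q + 2) * (8 * (H / M * X) * q + 3)))"
    by (simp only: mult_ac)
  also have "\<dots> \<le> 72 * ((cut_const * H powr (growth_exp + 1) * word_count L) * (H ^ 4 * (110 * R)))"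
  proof (rule mult_left_mono[OF mult_mono])
    show "real (card V) * (1 + H * L / X) \<le> cut_const * H powr (growth_exp + 1) * word_count L"
      using scale_ge_1 by (intro card_dyadic_mult_le X V) auto
    show "(8 * X\<^sup>2 / q + 2) * (8 * (H / M * X) * q + 3) \<le> H ^ 4 * (110 * R)"
      by (rule determinant_count_le[OF aq(3,4) X])
  qed (use cut_const_pos word_count_nonneg aq(2) X scale_ge_1(2,3) in auto)
  also have "\<dots> = minor_pairs_const * (H powr (growth_exp + 1) * H powr 4) * word_count L * R"
    using scale_ge_1(2) by (simp add: minor_pairs_const_def powr_numeral)
  also have "H powr (growth_exp + 1) * H powr 4 = H powr (growth_exp + 5)"
    unfolding powr_add[symmetric] by (simp add: algebra_simps)
  finally show ?thesis by (simp only: pairs_bound_def)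
qed

lemma card_stop_words_mult_word_count_le:
  "real (card (stop_words M)) * M\<^sup>2 * word_count L
    \<le> dilate_const * (square_const * M powr (2 - 2 * s) * (word_count N)\<^sup>2) / L powr (2 * s)"
proof -
  define f where "f = real (card (stop_words M)) * M\<^sup>2"
  have "0 \<le> f" by (simp add: f_def)
  have "f * word_count L * L powr (2 * s) \<le> f * word_count L * (dilate_const * word_count L)"
    using powr_le_word_count[OF scale_ge_1(4)] \<open>0 \<le> f\<close> word_count_nonneg
    by (intro mult_left_mono) auto
  also have "\<dots> = dilate_const * (f * (word_count L)\<^sup>2)" by (simp add: power2_eq_square)
  also have "\<dots> \<le> dilate_const * (square_const * M powr (2 - 2 * s) * (word_count N)\<^sup>2)"
    using card_stop_words_square_le[of M L] scale_ge_1(3) dilate_const_pos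
    by (intro mult_left_mono) (auto simp: f_def M_mult_L)
  finally show ?thesis using scale_ge_1(4) by (simp add: f_def pos_le_divide_eq)
qed

lemma powr_saving_le:
  "H powr (growth_exp + 6) * (M powr (2 - 2 * s) / L powr (2 * s) * R) \<le> 1"
proof -
  have "minor_exp / 2 * (growth_exp + 6) = s - 7/8" using minor_exp_bounds(3) by simp
  then have "H powr (growth_exp + 6) = real N powr (s - 7/8)" by (simp only: H_eq powr_powr)
  moreover have "M powr (2 - 2 * s) / L powr (2 * s) * R
      = real N powr (5/8 * (2 - 2 * s) - 3/8 * (2 * s) + 1/2)"
    by (simp only: M_eq L_eq R_eq powr_powr powr_add[symmetric] powr_diff[symmetric])
  moreover have "s - 7/8 + (5/8 * (2 - 2 * s) - 3/8 * (2 * s) + 1/2) = 7/8 - s" by algebra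
  ultimately have "H powr (growth_exp + 6) * (M powr (2 - 2 * s) / L powr (2 * s) * R)
      = real N powr (7/8 - s)"
    by (simp only: powr_add[symmetric])
  also have "\<dots> \<le> real N powr 0" using s_gt by (intro N_powr_mono) simp
  finally show ?thesis using N_gt_1 by simp
qed

lemma main_term_le:
  "H * (real (card (stop_words M)) * M\<^sup>2) * pairs_bound
    \<le> dilate_const * square_const * minor_pairs_const * (word_count N)\<^sup>2"
proof -
  let ?c = "dilate_const * square_const * minor_pairs_const * (word_count N)\<^sup>2"
  have "H * (real (card (stop_words M)) * M\<^sup>2) * pairs_bound
      = (real (card (stop_words M)) * M\<^sup>2 * word_count L)
        * (H * (minor_pairs_const * H powr (growth_exp + 5) * R))"
    by (simp add: pairs_bound_def)
  also have "\<dots> \<le> (dilate_const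
      * (square_const * M powr (2 - 2 * s) * (word_count N)\<^sup>2) / L powr (2 * s))
      * (H * (minor_pairs_const * H powr (growth_exp + 5) * R))"
    using scale_ge_1 minor_pairs_const_pos
    by (intro mult_right_mono card_stop_words_mult_word_count_le) auto
  also have "\<dots> = ?c * ((H powr 1 * H powr (growth_exp + 5))
      * (M powr (2 - 2 * s) / L powr (2 * s) * R))"
    using scale_ge_1 by simp
  also have "H powr 1 * H powr (growth_exp + 5) = H powr (growth_exp + 6)"
    unfolding powr_add[symmetric] by (simp add: algebra_simps)
  also have "?c * (H powr (growth_exp + 6) * (M powr (2 - 2 * s) / L powr (2 * s) * R)) \<le> ?c * 1"
    using powr_saving_le dilate_const_pos square_const_pos minor_pairs_const_pos
    by (intro mult_left_mono) auto
  finally show ?thesis by simp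
qed

lemma mean_square: "(\<Sum>\<theta>\<in>minor_arcs N. (cmod (expsum N \<theta>))\<^sup>2) \<le> minor_const * (word_count N)\<^sup>2"
proof -
  have "(\<Sum>\<theta>\<in>minor_arcs N. (cmod (expsum N \<theta>))\<^sup>2) \<le> mean_square_const minor_exp *
      ((word_count N)\<^sup>2 * R powr (- 1/10) + H * (real (card (stop_words M)) * M\<^sup>2) * pairs_bound)"
  proof (rule mean_square_le[OF _ scale_ge_1(3) _ scale_ge_1(1) minor_exp_bounds(1) _ M_mult_L _
      H_eq_R_powr])
    have "M \<le> real N powr (3/2)" unfolding M_eq by (intro N_powr_mono) simp
    also have "\<dots> = R ^ 3" using scale_ge_1(1) by (simp add: R_eq powr_powr flip: powr_numeral)
    also have "\<dots> \<le> 100 * R ^ 3" using scale_ge_1(1) by simp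
    finally show "M \<le> 100 * R ^ 3" .
    show "R powr (3/4) \<le> L" by (simp add: R_eq L_eq powr_powr)
    have "2 * step_ratio \<le> R"
      using N_ge(2) step_ratio_ge_2 by (simp add: R_eq powr_half_sqrt real_le_rsqrt)
    moreover have "H \<le> R" unfolding H_eq R_eq using minor_exp_bounds(2) by (intro N_powr_mono) simp
    ultimately have "2 * step_ratio * H \<le> R * R" using scale_ge_1(1,2) by (intro mult_mono) auto
    then show "2 * step_ratio * H \<le> N" using R_square by (simp add: power2_eq_square)
    show "finite (minor_arcs N)" using minor_arcs_subset_grid finite_grid by (rule finite_subset)
    have "card (minor_arcs N) \<le> N"
      using card_mono[OF finite_grid[of N] minor_arcs_subset_grid] card_grid_le[of N] by linarith
    then show "real (card (minor_arcs N)) \<le> 12 * R\<^sup>2" unfolding R_square by linarith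
    show "0 \<le> pairs_bound"
      using minor_pairs_const_pos word_count_nonneg scale_ge_1(1) by (simp add: pairs_bound_def)
    have "0 < L / R powr (3/5)" using scale_ge_1(1,4) by simp
    then show "near_pairs_bounded (H / M) (minor_arcs N) (L / R powr (3/5)) (L * H) pairs_bound"
      unfolding near_pairs_bounded_def by (intro ballI allI impI near_pairs_le_pairs_bound) auto
  qed (use N_gt_1 minor_exp_bounds(2) in auto)
  also have "\<dots> \<le> mean_square_const minor_exp *
      ((word_count N)\<^sup>2 * 1 + dilate_const * square_const * minor_pairs_const * (word_count N)\<^sup>2)"
  proof (intro mult_left_mono add_mono main_term_le)
    show "R powr (- 1/10) \<le> 1" using powr_mono[of "- 1/10" 0 R] scale_ge_1(1) by simp
  qed (use mean_square_const_pos[of minor_exp] in auto)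
  also have "\<dots> = minor_const * (word_count N)\<^sup>2" by (simp add: minor_const_def algebra_simps)
  finally show ?thesis .
qed

end

lemma (in dense_alphabet) minor_arcs_mean_square:
  assumes "17 ^ 8 \<le> real N" "(2 * step_ratio)\<^sup>2 \<le> real N"
  shows "(\<Sum>\<theta>\<in>minor_arcs N. (cmod (expsum N \<theta>))\<^sup>2) \<le> minor_const * (word_count N)\<^sup>2"
proof -
  interpret minor_scale A s c\<^sub>0 N "real N powr (1/2)" "real N powr (minor_exp / 2)"
    "real N powr (5/8)" "real N powr (3/8)"
    by unfold_locales (use assms in auto)
  show ?thesis by (rule mean_square)
qed

subsection \<open>Dirichlet approximation of the grid\<close>

lemma dyadic_bracket:
  fixes x :: real
  shows "\<exists>i::nat. x \<le> 2 ^ i \<and> (i = 0 \<or> 2 ^ i / 2 \<le> x)"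
proof -
  obtain n :: nat where "x < 2 ^ n" using real_arch_pow[of 2 x] by auto
  then have ex: "\<exists>i::nat. x \<le> 2 ^ i" by (intro exI[of _ n]) simp
  define i where "i = (LEAST i::nat. x \<le> 2 ^ i)"
  have "x \<le> 2 ^ i" unfolding i_def using ex by (rule LeastI_ex)
  moreover have "2 ^ i / 2 \<le> x" if "i \<noteq> 0"
  proof -
    obtain j where j: "i = Suc j" using \<open>i \<noteq> 0\<close> by (cases i) auto
    then have "\<not> x \<le> 2 ^ j" using not_less_Least[of j "\<lambda>i. x \<le> 2 ^ i"] unfolding i_def by simp
    then show ?thesis using j by simp
  qed
  ultimately show ?thesis by (intro exI[of _ i]) auto
qed

lemma sum_UN_le:
  fixes f :: "'a \<Rightarrow> real"
  assumes "finite I" "\<And>i. i \<in> I \<Longrightarrow> finite (S i)" "\<And>x. 0 \<le> f x"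
  shows "sum f (\<Union>i\<in>I. S i) \<le> (\<Sum>i\<in>I. sum f (S i))"
  using assms(1,2)
proof (induction I)
  case (insert i I)
  have fin: "finite (S i)" "finite (\<Union>j\<in>I. S j)" using insert by auto
  have "sum f (\<Union>j\<in>insert i I. S j) = sum f (S i \<union> (\<Union>j\<in>I. S j))" by simp
  also have "\<dots> \<le> sum f (S i) + sum f (\<Union>j\<in>I. S j)"
    using sum.union_inter[OF fin, of f] sum_nonneg[of "S i \<inter> (\<Union>j\<in>I. S j)" f] assms(3) by simp
  also have "\<dots> \<le> sum f (S i) + (\<Sum>j\<in>I. sum f (S j))" using insert by auto
  finally show ?case using insert by simp
qed simp

lemma dirichlet_fraction:
  fixes \<theta> x :: real
  assumes "1 \<le> x"
  obtains a q :: int where "coprime a q" "0 < q" "real_of_int q \<le> x" "x * (q * \<bar>\<theta> - a / q\<bar>) \<le> 2"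
    "q * (q * \<bar>\<theta> - a / q\<bar>) \<le> 1"
proof -
  define n where "n = nat \<lfloor>x\<rfloor>"
  have "1 \<le> \<lfloor>x\<rfloor>" using assms by simp
  then have "real n = real_of_int \<lfloor>x\<rfloor>" by (simp add: n_def)
  then have n: "0 < n" "real n \<le> x" "x \<le> 2 * real n" using \<open>1 \<le> \<lfloor>x\<rfloor>\<close> by linarith+
  obtain a q :: int where aq: "coprime a q" "0 < q" "q \<le> int n" "\<bar>of_int q * \<theta> - of_int a\<bar> < 1 / n"
    using Dirichlet_approx_coprime[OF n(1)] by metis
  define e where "e = q * \<bar>\<theta> - a / q\<bar>"
  have "of_int q * \<theta> - of_int a = q * (\<theta> - a / q)" using aq(2) by (simp add: field_simps)
  then have "\<bar>of_int q * \<theta> - of_int a\<bar> = e" using aq(2) by (simp add: e_def abs_mult)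
  then have e: "n * e \<le> 1" "0 \<le> e" using aq(4) n(1) by (simp_all add: field_simps)
  have q_le: "real_of_int q \<le> real n" using aq(3) by linarith
  have "x * e \<le> (2 * n) * e" "q * e \<le> n * e" using n(3) q_le e(2) by (intro mult_right_mono; simp)+
  then have "x * e \<le> 2" "q * e \<le> 1" using e(1) by linarith+
  then show thesis using q_le n(2) by (intro that[OF aq(1,2)]) (auto simp: e_def)
qed

definition dyadic_levels :: "real \<Rightarrow> (nat \<times> nat) set" where
  "dyadic_levels Y = {(i, l). 2 ^ i * 2 ^ l \<le> Y}"

lemma in_major_arcs_dyadic:
  fixes a q :: int
  assumes N: "0 < N" and \<theta>: "\<theta> \<in> grid N" and aq: "coprime a q" "0 < q" "real_of_int q \<le> y" "1 \<le> y"
    and close: "real N * \<bar>\<theta> - a / q\<bar> * q \<le> 2 * y"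
  shows "\<exists>(i, l)\<in>dyadic_levels (8 * y). \<theta> \<in> major_arcs N (2 ^ i) (2 ^ l)"
proof -
  define t where "t = real N * \<bar>\<theta> - a / q\<bar>"
  have q1: "1 \<le> real_of_int q" using aq(2) by linarith
  obtain i :: nat where i: "q \<le> 2 ^ i" "i = 0 \<or> 2 ^ i / 2 \<le> real_of_int q"
    using dyadic_bracket[of q] by auto
  obtain l :: nat where l: "t \<le> 2 ^ l" "l = 0 \<or> 2 ^ l / 2 \<le> t" using dyadic_bracket by blast
  have Q: "2 ^ i \<le> 2 * real_of_int q" using i q1 by auto
  have "(2::real) ^ i * 2 ^ l \<le> 8 * y"
  proof (cases "l = 0")
    case True
    then show ?thesis using Q aq(3,4) by simp
  next
    case False
    then have "2 ^ l \<le> 2 * t" using l by simp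
    then have "(2::real) ^ i * 2 ^ l \<le> (2 * real_of_int q) * (2 * t)"
      using Q q1 by (intro mult_mono) auto
    also have "\<dots> = 4 * (t * q)" by simp
    finally show ?thesis using close by (simp add: t_def)
  qed
  moreover have "\<theta> \<in> major_arcs N (2 ^ i) (2 ^ l)"
    unfolding major_arcs_def
  proof (intro CollectI conjI exI)
    show "\<theta> \<in> grid N" "coprime a q" "0 < q" by fact+
    show "2 ^ i / 2 \<le> real_of_int q" using i q1 by auto
    show "real_of_int q \<le> 2 ^ i" using i by simp
    show "\<bar>\<theta> - a / q\<bar> \<le> 2 ^ l / N" using l(1) N by (simp add: t_def field_simps)
    have "l = 0 \<or> 2 ^ l / (2 * real N) \<le> \<bar>\<theta> - a / q\<bar>" using l(2) N by (simp add: t_def field_simps)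
    then show "2 ^ l = (1::real) \<or> 2 ^ l / (2 * real N) \<le> \<bar>\<theta> - a / q\<bar>" by auto
  qed
  ultimately show ?thesis by (auto simp: dyadic_levels_def)
qed

lemma grid_subset_arcs:
  assumes N: "1 \<le> N"
  shows "grid N \<subseteq> minor_arcs N \<union>
    (\<Union>(i, l)\<in>dyadic_levels (8 * real N powr (1/4)). major_arcs N (2 ^ i) (2 ^ l))"
proof
  fix \<theta> assume \<theta>: "\<theta> \<in> grid N"
  define x where "x = real N powr (3/4)"
  define y where "y = real N powr (1/4)"
  have x: "1 \<le> x" and y: "1 \<le> y" using N by (auto simp: x_def y_def ge_one_powr_ge_zero)
  have N_eq: "real N = y * x" using N by (simp add: x_def y_def powr_add[symmetric])
  obtain a q :: int where aq: "coprime a q" "0 < q" "real_of_int q \<le> x" "x * (q * \<bar>\<theta> - a / q\<bar>) \<le> 2"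
      "q * (q * \<bar>\<theta> - a / q\<bar>) \<le> 1"
    using x by (rule dirichlet_fraction)
  show "\<theta> \<in> minor_arcs N
      \<union> (\<Union>(i, l)\<in>dyadic_levels (8 * real N powr (1/4)). major_arcs N (2 ^ i) (2 ^ l))"
  proof (cases "y \<le> q")
    case True
    have "\<bar>\<theta> - a / q\<bar> \<le> 1 / (real_of_int q)\<^sup>2"
      using aq(2,5) by (simp add: pos_le_divide_eq power2_eq_square mult_ac)
    then have "\<theta> \<in> minor_arcs N"
      using \<theta> aq(1-3) True unfolding minor_arcs_def x_def y_def by blast
    then show ?thesis by blast
  next
    case False
    have "real N * \<bar>\<theta> - a / q\<bar> * q = y * (x * (q * \<bar>\<theta> - a / q\<bar>))"
      unfolding N_eq by (simp only: mult_ac)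
    also have "\<dots> \<le> y * 2" using aq(4) y by (intro mult_left_mono) auto
    finally show ?thesis
      using in_major_arcs_dyadic[OF _ \<theta> aq(1,2), of y] N y False by (force simp: y_def mult.commute)
  qed
qed

lemma dyadic_levels_subset: "dyadic_levels Y \<subseteq> {..<nat \<lceil>Y\<rceil>} \<times> {..<nat \<lceil>Y\<rceil>}"
proof
  fix il assume "il \<in> dyadic_levels Y"
  then obtain i l where il: "il = (i, l)" "2 ^ i * 2 ^ l \<le> Y" by (auto simp: dyadic_levels_def)
  have "(2::real) ^ i * 1 \<le> 2 ^ i * 2 ^ l" "1 * (2::real) ^ l \<le> 2 ^ i * 2 ^ l"
    by (intro mult_mono; simp)+
  moreover have "real i < 2 ^ i" "real l < 2 ^ l" by (rule of_nat_less_two_power)+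
  ultimately have "real i < Y" "real l < Y" using il(2) by linarith+
  then show "il \<in> {..<nat \<lceil>Y\<rceil>} \<times> {..<nat \<lceil>Y\<rceil>}" unfolding il(1) by (auto; linarith)
qed

lemma sum_dyadic_levels_powr_le:
  fixes e :: real
  assumes "0 < e"
  shows "(\<Sum>(i, l)\<in>dyadic_levels Y. (2 ^ i * 2 ^ l) powr (- e)) \<le> (1 / (1 - 2 powr (- e)))\<^sup>2"
proof -
  define \<rho> :: real where "\<rho> = 2 powr (- e)"
  define m where "m = nat \<lceil>Y\<rceil>"
  have \<rho>: "0 < \<rho>" "\<rho> < 1" unfolding \<rho>_def using assms powr_less_cancel_iff[of 2 "- e" 0] by auto
  have geometric: "(\<Sum>i<m. \<rho> ^ i) \<le> 1 / (1 - \<rho>)"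
    using sum_le_suminf[of "\<lambda>i. \<rho> ^ i" "{..<m}"] suminf_geometric[of \<rho>] summable_geometric[of \<rho>] \<rho>
    by simp
  have "(2 ^ i * 2 ^ l) powr (- e) = \<rho> ^ i * \<rho> ^ l" for i l :: nat
    by (simp add: \<rho>_def powr_mult powr_power powr_realpow[symmetric] powr_powr ac_simps)
  then have "(\<Sum>(i, l)\<in>dyadic_levels Y. (2 ^ i * 2 ^ l) powr (- e))
      = (\<Sum>(i, l)\<in>dyadic_levels Y. \<rho> ^ i * \<rho> ^ l)"
    by simp
  also have "\<dots> \<le> (\<Sum>(i, l)\<in>{..<m} \<times> {..<m}. \<rho> ^ i * \<rho> ^ l)"
    using dyadic_levels_subset[of Y] \<rho> by (intro sum_mono2) (auto simp: m_def)
  also have "\<dots> = (\<Sum>i<m. \<rho> ^ i) * (\<Sum>l<m. \<rho> ^ l)" by (simp add: sum_product sum.cartesian_product)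
  also have "\<dots> \<le> (1 / (1 - \<rho>)) * (1 / (1 - \<rho>))"
    using geometric \<rho> by (intro mult_mono sum_nonneg) auto
  finally show ?thesis by (simp add: \<rho>_def power2_eq_square)
qed

context dense_alphabet
begin

definition expsum_const :: real where
  "expsum_const = minor_const + major_const * (1 / (1 - 2 powr (- 1/10)))\<^sup>2"

lemma expsum_const_pos: "0 < expsum_const"
  using minor_const_pos major_const_pos by (simp add: expsum_const_def add_pos_nonneg)

lemma expsum_mean_square:
  assumes N: "17 ^ 8 \<le> real N" "(2 * step_ratio)\<^sup>2 \<le> real N"
    "200 * step_ratio * (8 * real N powr (1/4)) powr (37/10) \<le> real N"
  shows "(\<Sum>\<theta>\<in>grid N. (cmod (expsum N \<theta>))\<^sup>2) \<le> expsum_const * (word_count N)\<^sup>2"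
proof -
  let ?f = "\<lambda>\<theta>. (cmod (expsum N \<theta>))\<^sup>2" and ?I = "dyadic_levels (8 * real N powr (1/4))"
  let ?arcs = "\<lambda>(i, l). major_arcs N (2 ^ i) (2 ^ l)"
  have finI: "finite ?I" using finite_subset[OF dyadic_levels_subset] by blast
  have fin: "finite (minor_arcs N)" "finite (major_arcs N Q K)" for Q K
    using finite_subset[OF minor_arcs_subset_grid
        finite_grid] finite_subset[OF major_arcs_subset_grid finite_grid] .
  have finU: "finite (\<Union>p\<in>?I. ?arcs p)" using finI fin by auto
  have "1 \<le> real N" using N(1) by (rule order_trans[rotated]) simp
  then have "sum ?f (grid N) \<le> sum ?f (minor_arcs N \<union> (\<Union>p\<in>?I. ?arcs p))"
    using grid_subset_arcs[of N] fin(1) finU by (intro sum_mono2) auto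
  also have "\<dots> \<le> sum ?f (minor_arcs N) + sum ?f (\<Union>p\<in>?I. ?arcs p)"
    using sum.union_inter[OF fin(1) finU, of ?f] sum_nonneg[of "minor_arcs N \<inter> (\<Union>p\<in>?I. ?arcs p)" ?f]
    by simp
  also have "\<dots> \<le> sum ?f (minor_arcs N) + (\<Sum>p\<in>?I. sum ?f (?arcs p))"
    using finI fin by (intro add_left_mono sum_UN_le) auto
  also have "(\<Sum>p\<in>?I. sum ?f (?arcs p))
      \<le> (\<Sum>(i, l)\<in>?I. major_const * (word_count N)\<^sup>2 * (2 ^ i * 2 ^ l) powr (- 1/10))"
  proof (rule sum_mono, clarify)
    fix i l assume "(i, l) \<in> ?I"
    then have "(2 ^ i * 2 ^ l) powr (37/10) \<le> (8 * real N powr (1/4)) powr (37/10)"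
      by (intro powr_mono2) (auto simp: dyadic_levels_def)
    then have "200 * step_ratio * (2 ^ i * 2 ^ l) powr (37/10)
        \<le> 200 * step_ratio * (8 * real N powr (1/4)) powr (37/10)"
      using step_ratio_ge_2 by (intro mult_left_mono) auto
    then have "200 * step_ratio * (2 ^ i * 2 ^ l) powr (37/10) \<le> real N" using N(3) by linarith
    then show "sum ?f (major_arcs N (2 ^ i) (2 ^ l))
        \<le> major_const * (word_count N)\<^sup>2 * (2 ^ i * 2 ^ l) powr (- 1/10)"
      unfolding mult.assoc[of major_const] by (intro major_arcs_mean_square) auto
  qed
  also have "\<dots> = major_const * (word_count N)\<^sup>2 * (\<Sum>(i, l)\<in>?I. (2 ^ i * 2 ^ l) powr (- 1/10))"
    by (simp add: sum_distrib_left case_prod_beta)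
  also have "\<dots> \<le> major_const * (word_count N)\<^sup>2 * (1 / (1 - 2 powr (- 1/10)))\<^sup>2"
    using sum_dyadic_levels_powr_le[of "1/10"] major_const_pos by (intro mult_left_mono) auto
  also have "sum ?f (minor_arcs N) \<le> minor_const * (word_count N)\<^sup>2"
    by (rule minor_arcs_mean_square[OF N(1,2)])
  finally show ?thesis by (simp add: expsum_const_def algebra_simps)
qed

lemma eventually_expsum_mean_square:
  "\<forall>\<^sub>F N in sequentially. (\<Sum>\<theta>\<in>grid N. (cmod (expsum N \<theta>))\<^sup>2) \<le> expsum_const * (word_count N)\<^sup>2"
proof -
  have "0 < step_ratio" using step_ratio_ge_2 by simp
  then have "\<forall>\<^sub>F N in sequentially. 200 * step_ratio * (8 * real N powr (1/4)) powr (37/10)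
      \<le> real N"
    by real_asymp
  moreover have "\<forall>\<^sub>F N in sequentially. 17 ^ 8 \<le> real N"
    "\<forall>\<^sub>F N in sequentially. (2 * step_ratio)\<^sup>2 \<le> real N"
    by real_asymp+
  ultimately show ?thesis by eventually_elim (rule expsum_mean_square)
qed

end

subsection \<open>From the mean square to a positive proportion\<close>

lemma sum_cis_grid:
  fixes m :: int
  assumes "0 < N"
  shows "(\<Sum>j<N. cis (2 * pi * (real j / real N * real_of_int m)))
      = of_real (real N * of_bool (int N dvd m))"
proof -
  define z where "z = cis (2 * pi * real_of_int m / real N)"
  have z: "cis (2 * pi * (real j / real N * real_of_int m)) = z ^ j" for j
    unfolding z_def Complex.DeMoivre by (rule arg_cong[of _ _ cis]) simp
  have "z ^ N = cis (2 * pi * real_of_int m)"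
    unfolding z_def Complex.DeMoivre using assms by simp
  then have zN: "z ^ N = 1" by (simp add: cis_multiple_2pi)
  have "z = 1 \<longleftrightarrow> int N dvd m"
  proof
    assume "int N dvd m"
    then obtain n where "m = int N * n" by (auto simp: dvd_def)
    then have "2 * pi * real_of_int m / real N = 2 * pi * real_of_int n" using assms by simp
    then show "z = 1" by (simp only: z_def cis_multiple_2pi Ints_of_int)
  next
    assume "z = 1"
    then have "cos (2 * pi * real_of_int m / real N) = 1" by (simp add: z_def complex_eq_iff)
    then obtain n :: int where "2 * pi * real_of_int m / real N = of_int n * 2 * pi"
      using cos_one_2pi_int by blast
    then have "real_of_int m = real_of_int (int N * n)" using assms by (simp add: field_simps)
    then have "m = int N * n" by (simp only: of_int_eq_iff)
    then show "int N dvd m" by simp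
  qed
  then show ?thesis
    unfolding z using zN by (cases "z = 1") (auto simp: geometric_sum)
qed

context alphabet
begin

definition collisions :: "real \<Rightarrow> (nat list \<times> nat list) set" where
  "collisions X = {(w, w'). w \<in> words_upto X \<and> w' \<in> words_upto X \<and> cont w = cont w'}"

lemma finite_collisions: "finite (collisions X)"
  by (rule finite_subset[of _ "words_upto X \<times> words_upto X"])
    (auto simp: collisions_def finite_words_upto)

lemma expsum_mean_square_eq:
  assumes N: "0 < N"
  shows "(\<Sum>\<theta>\<in>grid N. (cmod (expsum N \<theta>))\<^sup>2)
    = (\<Sum>(w, w')\<in>words_upto ((real N)\<^sup>2) \<times> words_upto ((real N)\<^sup>2). exp (- (real (cont w)
      + real (cont w')) / N) *
         (real N * of_bool (int N dvd int (cont w) - int (cont w'))))"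
proof -
  let ?\<Omega> = "words_upto ((real N)\<^sup>2)"
  let ?e = "\<lambda>w w'. exp (- (real (cont w) + real (cont w')) / N)"
  let ?t = "\<lambda>j w w'. of_real (?e w w')
      * cis (2 * pi * (real j / N * real_of_int (int (cont w) - int (cont w'))))"
  have "inj_on (\<lambda>j. real j / real N) {..<N}" using N by (auto simp: inj_on_def)
  then have "complex_of_real (\<Sum>\<theta>\<in>grid N. (cmod (expsum N \<theta>))\<^sup>2)
      = (\<Sum>j<N. expsum N (real j / N) * cnj (expsum N (real j / N)))"
    unfolding grid_def by
      (simp add: sum.reindex complex_norm_square del: of_real_power flip: of_real_power)
  also have "\<dots> = (\<Sum>j<N. \<Sum>w\<in>?\<Omega>. \<Sum>w'\<in>?\<Omega>. ?t j w w')"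
    unfolding expsum_def cnj_sum sum_product damped_power_mult_cnj by (simp add: right_diff_distrib)
  also have "\<dots> = (\<Sum>w\<in>?\<Omega>. \<Sum>j<N. \<Sum>w'\<in>?\<Omega>. ?t j w w')" by (rule sum.swap)
  also have "\<dots> = (\<Sum>w\<in>?\<Omega>. \<Sum>w'\<in>?\<Omega>. \<Sum>j<N. ?t j w w')" by (intro sum.cong refl sum.swap)
  also have "\<dots> = (\<Sum>w\<in>?\<Omega>. \<Sum>w'\<in>?\<Omega>. of_real (?e w w'
      * (real N * of_bool (int N dvd int (cont w) - int (cont w')))))"
    unfolding sum_distrib_left[symmetric] sum_cis_grid[OF N] of_real_mult ..
  finally show ?thesis
    unfolding of_real_sum[symmetric] of_real_eq_iff by (simp add: sum.cartesian_product)
qed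

lemma card_collisions_le_mean_square:
  assumes N: "0 < N"
  shows "real N * exp (- 2) * real (card (collisions N)) \<le> (\<Sum>\<theta>\<in>grid N. (cmod (expsum N \<theta>))\<^sup>2)"
proof -
  let ?\<Omega> = "words_upto ((real N)\<^sup>2)"
  define F where "F = (\<lambda>(w, w'). exp (- (real (cont w) + real (cont w')) / N) *
    (real N * of_bool (int N dvd int (cont w) - int (cont w'))))"
  have "real N \<le> (real N)\<^sup>2" using N by (simp add: power2_eq_square)
  then have subset: "collisions N \<subseteq> ?\<Omega> \<times> ?\<Omega>" by (auto simp: collisions_def words_upto_def)
  have "real N * exp (- 2) * real (card (collisions N)) = (\<Sum>p\<in>collisions N. exp (- 2) * real N)"
    by simp
  also have "\<dots> \<le> (\<Sum>p\<in>collisions N. F p)"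
  proof (rule sum_mono)
    fix p assume "p \<in> collisions N"
    then obtain w w'
      where p: "p = (w, w')" "cont w = cont w'" "real (cont w) \<le> N" "real (cont w') \<le> N"
      by (auto simp: collisions_def words_upto_def)
    have "real (cont w) + real (cont w') \<le> 2 * N" using p by simp
    then have "exp (- 2) \<le> exp (- (real (cont w) + real (cont w')) / N)"
      using N by (simp add: field_simps)
    then show "exp (- 2) * real N \<le> F p" using p(1,2) by (simp add: F_def mult_right_mono)
  qed
  also have "\<dots> \<le> (\<Sum>p\<in>?\<Omega> \<times> ?\<Omega>. F p)"
    using subset finite_words_upto by (intro sum_mono2) (auto simp: F_def)
  also have "\<dots> = (\<Sum>\<theta>\<in>grid N. (cmod (expsum N \<theta>))\<^sup>2)" unfolding F_def expsum_mean_square_eq[OF N] ..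
  finally show ?thesis .
qed

lemma cont_in_cfrac_denoms:
  assumes "w \<in> words_upto X" "w \<noteq> []"
  shows "cont w \<in> cfrac_denoms A X"
proof -
  have w: "w \<in> lists A" "0 \<notin> set w" "real (cont w) \<le> X"
    using assms zero_notin_word by (auto simp: words_upto_def)
  have "0 < cont_tl w" using cont_tl_eq_0_iff[OF w(2)] assms(2) by simp
  moreover have "coprime (cont_tl w) (cont w)"
    using coprime_cont[of w] by (simp add: coprime_commute)
  moreover have "real (cont_tl w) / real (cont w) = cfrac w" using cfrac_eq_cont[OF w(2)] by simp
  ultimately show ?thesis using w cont_pos[OF w(2)] assms(2) unfolding cfrac_denoms_def by auto
qed

lemma finite_cfrac_denoms: "finite (cfrac_denoms A X)"
  by (rule finite_subset[of _ "{..nat \<lfloor>X\<rfloor>}"]) (auto simp: cfrac_denoms_def le_nat_floor)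

lemma word_count_le_twice_nonempty:
  assumes "step_ratio \<le> X"
  shows "word_count X \<le> 2 * real (card (words_upto X - {[]}))"
proof -
  obtain d where "d \<in> A" using A_nonempty by blast
  then have "[d] \<in> words_upto X - {[]}"
    using digit_less_step_ratio[OF \<open>d \<in> A\<close>] assms by (auto simp: words_upto_def)
  then have "0 < card (words_upto X - {[]})" using finite_words_upto card_gt_0_iff by blast
  moreover have "[] \<in> words_upto X" using assms step_ratio_ge_2 by (simp add: words_upto_def)
  then have "card (words_upto X) = Suc (card (words_upto X - {[]}))"
    by (rule card.remove[OF finite_words_upto])
  ultimately show ?thesis by (simp add: word_count_def)
qed

lemma word_count_square_le:
  assumes "step_ratio \<le> X"
  shows "(word_count X)\<^sup>2 \<le> 4 * real (card (cfrac_denoms A X)) * real (card (collisions X))"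
proof -
  define W where "W = words_upto X - {[]}"
  define fibre where "fibre n = {w \<in> W. cont w = n}" for n
  have fin: "finite W" "finite (cont ` W)" "finite (fibre n)" for n
    using finite_words_upto by (auto simp: W_def fibre_def)
  have "real (card W) = (\<Sum>n\<in>cont ` W. real (card (fibre n)))"
    using sum.image_gen[OF fin(1), of "\<lambda>_. 1 :: real" cont] by (simp add: fibre_def)
  then have "(real (card W))\<^sup>2 \<le> (\<Sum>n\<in>cont ` W. (real (card (fibre n)))\<^sup>2) * card (cont ` W)"
    using sum_squared_le_sum_of_squares[of "\<lambda>n. real (card (fibre n))" "cont ` W"] by simp
  also have "\<dots> \<le> real (card (collisions X)) * card (cfrac_denoms A X)"
  proof (rule mult_mono)
    have "(\<Sum>n\<in>cont ` W. card (fibre n) * card (fibre n)) = card (\<Union>n\<in>cont ` W. fibre n \<times> fibre n)"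
      unfolding card_cartesian_product[symmetric]
      using fin by (intro card_UN_disjoint[symmetric]) (auto simp: fibre_def)
    also have "\<dots> \<le> card (collisions X)"
      by (intro card_mono finite_collisions) (auto simp: fibre_def W_def collisions_def)
    finally have "real (\<Sum>n\<in>cont ` W. card (fibre n) * card (fibre n)) \<le> real (card (collisions X))"
      unfolding of_nat_le_iff .
    then show "(\<Sum>n\<in>cont ` W. (real (card (fibre n)))\<^sup>2) \<le> real (card (collisions X))"
      by (simp add: power2_eq_square)
    show "real (card (cont ` W)) \<le> card (cfrac_denoms A X)"
      unfolding of_nat_le_iff using cont_in_cfrac_denoms
      by (intro card_mono finite_cfrac_denoms) (auto simp: W_def)
  qed auto
  finally have "(real (card W))\<^sup>2 \<le> real (card (collisions X)) * card (cfrac_denoms A X)" .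
  moreover have "(word_count X)\<^sup>2 \<le> (2 * real (card W))\<^sup>2"
    unfolding W_def by (intro power_mono word_count_le_twice_nonempty assms word_count_nonneg)
  ultimately show ?thesis by (simp add: power_mult_distrib mult_ac)
qed

end

context dense_alphabet
begin

lemma card_cfrac_denoms_ge:
  assumes N: "step_ratio \<le> real N"
    and mean_square: "(\<Sum>\<theta>\<in>grid N. (cmod (expsum N \<theta>))\<^sup>2) \<le> expsum_const * (word_count N)\<^sup>2"
  shows "exp (- 2) / (4 * expsum_const) * real N \<le> real (card (cfrac_denoms A N))"
proof -
  define p where "p = real (card (collisions N))"
  define d where "d = real (card (cfrac_denoms A N))"
  have N0: "0 < N" "1 \<le> real N" using N step_ratio_ge_2 by auto
  have square: "(word_count N)\<^sup>2 \<le> 4 * d * p"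
    unfolding p_def d_def by (rule word_count_square_le[OF N])
  have "0 < (word_count N)\<^sup>2" using word_count_ge_1[OF N0(2)] by simp
  then have "p \<noteq> 0" using square by auto
  then have "0 < p" by (simp add: p_def)
  have "real N * exp (- 2) * p \<le> expsum_const * (word_count N)\<^sup>2"
    unfolding p_def using card_collisions_le_mean_square[OF N0(1)] mean_square by linarith
  also have "\<dots> \<le> expsum_const * (4 * d * p)"
    using square expsum_const_pos by (intro mult_left_mono) auto
  finally have "(real N * exp (- 2)) * p \<le> (expsum_const * (4 * d)) * p" by (simp only: mult.assoc)
  then have "real N * exp (- 2) \<le> expsum_const * (4 * d)"
    using \<open>0 < p\<close> by (simp only: mult_le_cancel_right_pos)
  then show ?thesis using expsum_const_pos by (simp add: d_def field_simps)
qed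

lemma cfrac_denoms_positive_proportion:
  "\<exists>c>0. \<forall>\<^sub>F X::real in at_top. real (card (cfrac_denoms A X)) \<ge> c * X"
proof -
  define c where "c = exp (- 2) / (4 * expsum_const)"
  have "0 < c" using expsum_const_pos by (simp add: c_def)
  have "\<forall>\<^sub>F N in sequentially. step_ratio \<le> real N" by real_asymp
  then have "\<forall>\<^sub>F N in sequentially. c * real N \<le> real (card (cfrac_denoms A N))"
    using eventually_expsum_mean_square
    unfolding c_def by eventually_elim (rule card_cfrac_denoms_ge)
  then have "\<forall>\<^sub>F X::real in at_top. c * real (nat \<lfloor>X\<rfloor>)
      \<le> real (card (cfrac_denoms A (real (nat \<lfloor>X\<rfloor>))))"
    by (rule eventually_compose_filterlim)
      (rule filterlim_compose[OF filterlim_nat_sequentially filterlim_floor_sequentially])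
  then have "\<forall>\<^sub>F X::real in at_top. c / 2 * X \<le> real (card (cfrac_denoms A X))"
    using eventually_ge_at_top[of 1]
  proof eventually_elim
    case (elim X)
    have "1 \<le> \<lfloor>X\<rfloor>" using elim(2) by simp
    then have floor: "real (nat \<lfloor>X\<rfloor>) \<le> X" "X \<le> 2 * real (nat \<lfloor>X\<rfloor>)" by linarith+
    then have "c / 2 * X \<le> c * real (nat \<lfloor>X\<rfloor>)" using \<open>0 < c\<close> by (simp add: field_simps)
    also have "\<dots> \<le> real (card (cfrac_denoms A (real (nat \<lfloor>X\<rfloor>))))" by (rule elim(1))
    also have "\<dots> \<le> real (card (cfrac_denoms A X))"
      using floor(1) by (intro of_nat_mono card_mono finite_cfrac_denoms)
        (auto simp: cfrac_denoms_def)
    finally show ?case .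
  qed
  then show ?thesis using \<open>0 < c\<close> by (intro exI[of _ "c / 2"]) auto
qed

end

lemma hausdorff_measure_neq_0:
  assumes "0 \<le> s" "ereal s < hausdorff_dim E"
  shows "hausdorff_measure s E \<noteq> 0"
proof
  assume "hausdorff_measure s E = 0"
  then have "hausdorff_dim E \<le> ereal s"
    unfolding hausdorff_dim_def using assms(1) by (intro INF_lower) auto
  then show False using assms(2) by simp
qed

theorem theorem2:
  fixes A :: "nat set"
  assumes "finite A" and "0 \<notin> A" and "2 \<le> card A"
    and "hausdorff_dim (cfrac_set A) > ereal (7 / 8)"
  shows "\<exists>c::real. c > 0 \<and>
           (\<forall>\<^sub>F N::real in at_top. real (card (cfrac_denoms A N)) \<ge> c * N)"
proof -
  interpret alphabet A using assms by unfold_locales auto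
  have "ereal (7/8) < min (hausdorff_dim (cfrac_set A)) 1" using assms(4) by simp
  then obtain s where "ereal (7/8) < ereal s" "ereal s < min (hausdorff_dim (cfrac_set A)) 1"
    using ereal_dense2 by blast
  then have s: "7/8 < s" "s < 1" "ereal s < hausdorff_dim (cfrac_set A)" by auto
  then have "hausdorff_measure s (cfrac_set A) \<noteq> 0" by (intro hausdorff_measure_neq_0) auto
  then obtain c\<^sub>0 where "0 < c\<^sub>0" "\<forall>M\<ge>1. c\<^sub>0 * M powr (2 * s) \<le> real (card (stop_words M))"
    using card_stop_words_ge[of s] s(1) by auto
  then interpret dense_alphabet A s c\<^sub>0 using s by unfold_locales auto
  show ?thesis using cfrac_denoms_positive_proportion by auto
qed

end
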